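(* Let $V$ be a discrete valuation ring with quotient field $K$ and valuation $v$, let $\mathcal{K}:K=K_0\subsetneq K_1\subsetneq K_2\subsetneq\cdots$ be a sequence of field extensions with $[K_{i+1}:K_i]<\infty$ for every $i$, let $K_\infty=\bigcup_i K_i$, and let $A$ be the integral closure of $V$ in $K_\infty$. Suppose that $A$ is an almost Dedekind domain, and let $\mathcal{T}=\mathcal{T}(v,\mathcal{K})$ be the ramification tree of $v$ with respect to $\mathcal{K}$. Then the SP-rank of $A$ equals the SP-rank of $\mathcal{T}$.
   Context: Almost Dedekind domains: an integral domain $D$ with quotient field $F$ is almost Dedekind if $D_M$ is a discrete valuation ring for every $M\in\mathrm{Max}(D)$. A maximal ideal $M$ of $D$ is critical if it contains no nonzero finitely generated radical ideal; $\mathrm{Crit}(D)$ is the set of critical maximal ideals. Define recursively: $T_0=D$, $\mathrm{Crit}^0(D)=\mathrm{Max}(D)$; for $\alpha=\beta+1$, $\mathrm{Crit}^\alpha(D)=\{P\in\mathrm{Max}(D): PT_\beta\in\mathrm{Crit}(T_\beta)\}$; for $\alpha$ a limit ordinal, $\mathrm{Crit}^\alpha(D)=\bigcap_{\beta<\alpha}\mathrm{Crit}^\beta(D)$; and in all cases $T_\alpha=\bigcap\{D_M: M\in\mathrm{Crit}^\alpha(D)\}$ (with $T_\alpha=F$ and no critical ideals if $\mathrm{Crit}^\alpha(D)=\emptyset$). The maximal ideals of $T_\alpha$ are exactly the extensions of the elements of $\mathrm{Crit}^\alpha(D)$. The SP-rank of $D$ is the smallest ordinal $\alpha$ such that $\mathrm{Crit}^\alpha(D)=\emptyset$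 (it always exists). Ramification tree: the elements of $\mathcal{T}(v,\mathcal{K})$ are the extensions of $v$ to $K_i$, for each $i$ (valuations being identified with their valuation rings); $v_1\le v_2$ if and only if $v_2$ is an extension of $v_1$. An edge is a pair $(v_1,v_2)$ with $v_1<v_2$ and no element strictly between; its weight is the ramification index $w(v_1,v_2)=e(v_2/v_1)=(\Gamma_{v_2}:\Gamma_{v_1})$. This is a weighted tree with root $v$, every vertex having finite height, with no maximal elements. Tree SP-rank: let $\mathcal{T}$ be a weighted tree (edge weights positive integers). A path is a sequence $(a_i)$ of vertices, with each $(a_i,a_{i+1})$ an edge; a maximal path is an infinite path starting from the root; every infinite path extends to a unique maximal path; $\mathrm{MaxPath}(\mathcal{T})$ is the set of maximal paths. The weight of an infinite path $\pi=(a_i)_{i\in\mathbb{N}}$ is $w(\pi)=\prod_i w(a_i,a_{i+1})\in\mathbb{N}^+\cup\{\infty\}$; $\pi$ is finitely ramified if $w(\pi)<\infty$, and unramified if $w(\pi)=1$. For a finitely ramified $\pi$, $u(\pi)$ denotes the largest infinite subpath of $\pi$ that is unramified. Suppose all paths of $\mathcal{T}$ are finitely ramified (this is the case for $\mathcal{T}(v,\mathcal{K})$ when $A$ is almost Dedekind). Define $\mathrm{Crit}^0(\mathcal{T})=\mathrm{MaxPath}(\mathcal{T})$; for $\alpha=\beta+1$, $\mathrm{Crit}^\alpha(\mathcal{T})$ is the set of maximal paths $\pi$ such that for every $a\in u(\pi)$ there is an infinite path $\pi'$ starting from $a$ with $w(\pi')>1$ whose maximal extension is in $\mathrm{Crit}^\beta(\mathcal{T})$;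 for $\alpha$ a limit ordinal, $\mathrm{Crit}^\alpha(\mathcal{T})=\bigcap_{\beta<\alpha}\mathrm{Crit}^\beta(\mathcal{T})$. The SP-rank of $\mathcal{T}$ is the smallest ordinal $\beta$ such that $\mathrm{Crit}^\beta(\mathcal{T})=\emptyset$. *)

theory Defs
  imports "HOL-Algebra.Algebra" "HOL-Library.Extended_Nat"
begin

section \<open>Ordinals and transfinite iteration\<close>

text \<open>
  The ordinals that are order types of well-orders on subsets of \<open>'u\<close>, as isomorphism classes
  of such well-orders. They form an initial segment of all ordinals, so zero, successor
  and limit have their usual meaning.
\<close>

quotient_type 'u ordinal = "'u rel" / partial: "\<lambda>r s. r =o s"
proof (rule part_equivpI)
  show "\<exists>r :: 'u rel. r =o r"
    by (rule exI[of _ "{}"], rule ordIso_reflexive) simp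
qed (auto intro!: sympI transpI intro: ordIso_symmetric ordIso_transitive)

instantiation ordinal :: (type) wellorder
begin

lift_definition less_eq_ordinal :: "'a ordinal \<Rightarrow> 'a ordinal \<Rightarrow> bool" is "\<lambda>r s. r \<le>o s"
  by (meson ordIso_ordLeq_trans ordIso_symmetric ordLeq_ordIso_trans)

lift_definition less_ordinal :: "'a ordinal \<Rightarrow> 'a ordinal \<Rightarrow> bool" is "\<lambda>r s. r <o s"
  by (meson ordIso_ordLess_trans ordIso_symmetric ordLess_ordIso_trans)

instance
proof
  fix x y z :: "'a ordinal"
  show "x < y \<longleftrightarrow> x \<le> y \<and> \<not> y \<le> x"
    by transfer (meson not_ordLess_ordLeq ordLess_imp_ordLeq ordLess_or_ordLeq ordLeq_Well_order_simp)
  show "x \<le> x"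
    by transfer (rule ordIso_imp_ordLeq)
  show "x \<le> y \<Longrightarrow> y \<le> z \<Longrightarrow> x \<le> z"
    by transfer (rule ordLeq_transitive)
  show "x \<le> y \<Longrightarrow> y \<le> x \<Longrightarrow> x = y"
    by transfer (simp add: ordIso_iff_ordLeq)
  show "x \<le> y \<or> y \<le> x"
    by transfer (meson ordIso_Well_order_simp ordLeq_total)
next
  fix P :: "'a ordinal \<Rightarrow> bool" and a
  assume step: "\<And>x. (\<And>y. y < x \<Longrightarrow> P y) \<Longrightarrow> P x"
  have wf: "wf (inv_image (ordLess :: ('a rel \<times> 'a rel) set) rep_ordinal)"
    by (rule wf_inv_image[OF wf_ordLess])
  have lt: "(y, x) \<in> inv_image ordLess rep_ordinal" if "y < x" for x y :: "'a ordinal"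
    using that Quotient_rel_rep[OF Quotient_ordinal]
    by (simp add: less_ordinal_def)
  show "P a"
    using wf
  proof (induction a rule: wf_induct_rule)
    case (less x)
    show ?case
      by (rule step, rule less, rule lt)
  qed
qed

end

definition succ_of :: "'o::wellorder \<Rightarrow> 'o \<Rightarrow> bool"
  where "succ_of \<alpha> \<beta> \<longleftrightarrow> \<beta> < \<alpha> \<and> (\<forall>\<gamma><\<alpha>. \<gamma> \<le> \<beta>)"

lemma succ_of_unique: "succ_of \<alpha> \<beta> \<Longrightarrow> succ_of \<alpha> \<gamma> \<Longrightarrow> \<gamma> = \<beta>"
  by (meson order.antisym succ_of_def)

lemma the_succ_of: "succ_of \<alpha> \<beta> \<Longrightarrow> (THE \<beta>. succ_of \<alpha> \<beta>) = \<beta>"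
  by (blast intro: the_equality succ_of_unique)

text \<open>The sequence \<open>C\<^sub>0 = C\<close>, \<open>C\<^bsub>\<beta>+1\<^esub> = f C\<^sub>\<beta>\<close>, and \<open>C\<^sub>\<alpha> = \<Inter>\<^bsub>\<beta><\<alpha>\<^esub> C\<^sub>\<beta>\<close> for a limit \<open>\<alpha>\<close>.\<close>

function transfinite :: "('x set \<Rightarrow> 'x set) \<Rightarrow> 'x set \<Rightarrow> 'o::wellorder \<Rightarrow> 'x set"
  where "transfinite f C \<alpha> =
    (if \<forall>\<beta>. \<alpha> \<le> \<beta> then C
     else if \<exists>\<beta>. succ_of \<alpha> \<beta> then f (transfinite f C (THE \<beta>. succ_of \<alpha> \<beta>))
     else (\<Inter>\<beta>\<in>{..<\<alpha>}. transfinite f C \<beta>))"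
  by auto
termination
proof (relation "inv_image {(x, y). x < y} (\<lambda>(f, C, \<alpha>). \<alpha>)")
  show "wf (inv_image {(x, y :: 'o::wellorder). x < y} (\<lambda>(f :: 'x set \<Rightarrow> 'x set, C :: 'x set, \<alpha>). \<alpha>))"
    by (rule wf_inv_image[OF wf])
qed (auto simp: the_succ_of succ_of_def[THEN iffD1])

declare transfinite.simps [simp del]

lemma transfinite_zero: "(\<And>\<beta>. \<alpha> \<le> \<beta>) \<Longrightarrow> transfinite f C \<alpha> = C"
  by (subst transfinite.simps) simp

lemma transfinite_succ: "succ_of \<alpha> \<beta> \<Longrightarrow> transfinite f C \<alpha> = f (transfinite f C \<beta>)"
  by (subst transfinite.simps) (auto simp: the_succ_of succ_of_def leD)

lemma transfinite_limit:
  "\<exists>\<beta>. \<beta> < \<alpha> \<Longrightarrow> \<nexists>\<beta>. succ_of \<alpha> \<beta> \<Longrightarrow> transfinite f C \<alpha> = (\<Inter>\<beta>\<in>{..<\<alpha>}. transfinite f C \<beta>)"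
  by (subst transfinite.simps) (auto simp: leD)


section \<open>Subrings of a field\<close>

text \<open>
  All domains are subrings (given by their carrier sets) of one ambient field \<open>L\<close>;
  \<open>L\<lparr>carrier := D\<rparr>\<close> is \<open>D\<close> regarded as a ring.
\<close>

definition quotient_field :: "('a, 'b) ring_scheme \<Rightarrow> 'a set \<Rightarrow> 'a set"
  where "quotient_field L D =
    {a \<otimes>\<^bsub>L\<^esub> inv\<^bsub>L\<^esub> b | a b. a \<in> D \<and> b \<in> D - {\<zero>\<^bsub>L\<^esub>}}"

definition localization :: "('a, 'b) ring_scheme \<Rightarrow> 'a set \<Rightarrow> 'a set \<Rightarrow> 'a set"
  where "localization L D P = {a \<otimes>\<^bsub>L\<^esub> inv\<^bsub>L\<^esub> b | a b. a \<in> D \<and> b \<in> D - P}"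

definition integral_closure :: "('a, 'b) ring_scheme \<Rightarrow> 'a set \<Rightarrow> 'a set \<Rightarrow> 'a set"
  where "integral_closure L D E =
    {x \<in> E. \<exists>p. p \<noteq> [] \<and> set p \<subseteq> D \<and> lead_coeff p = \<one>\<^bsub>L\<^esub> \<and> ring.eval L p x = \<zero>\<^bsub>L\<^esub>}"

definition valuation_ring :: "('a, 'b) ring_scheme \<Rightarrow> 'a set \<Rightarrow> bool"
  where "valuation_ring L W \<longleftrightarrow> subring W L \<and>
    (\<forall>x \<in> quotient_field L W - {\<zero>\<^bsub>L\<^esub>}. x \<in> W \<or> inv\<^bsub>L\<^esub> x \<in> W)"

text \<open>The value group of the valuation with ring \<open>W\<close> and quotient field \<open>F\<close> is \<open>F\<^sup>*/W\<^sup>*\<close>.\<close>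

definition value_group :: "('a, 'b) ring_scheme \<Rightarrow> 'a set \<Rightarrow> 'a set monoid"
  where "value_group L W =
    units_of (L\<lparr>carrier := quotient_field L W\<rparr>) Mod Units (L\<lparr>carrier := W\<rparr>)"

definition discrete_valuation_ring :: "('a, 'b) ring_scheme \<Rightarrow> 'a set \<Rightarrow> bool"
  where "discrete_valuation_ring L W \<longleftrightarrow>
    valuation_ring L W \<and> value_group L W \<cong> integer_group"

text \<open>\<open>extends L W1 W2\<close>: the valuation of \<open>W2\<close> is an extension of that of \<open>W1\<close>.\<close>

definition extends :: "('a, 'b) ring_scheme \<Rightarrow> 'a set \<Rightarrow> 'a set \<Rightarrow> bool"
  where "extends L W1 W2 \<longleftrightarrow> W2 \<inter> quotient_field L W1 = W1"

text \<open>
  The index in the value group of \<open>W2\<close> of the image of the value group of \<open>W1\<close>. As \<^const>\<open>card\<close>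
  is 0 on infinite sets, the value is meaningful only for finite index, which is
  automatic for finite field extensions.
\<close>

definition ramification_index :: "('a, 'b) ring_scheme \<Rightarrow> 'a set \<Rightarrow> 'a set \<Rightarrow> nat"
  where "ramification_index L W1 W2 = card (rcosets\<^bsub>value_group L W2\<^esub>
    ((\<lambda>x. Units (L\<lparr>carrier := W2\<rparr>) #>\<^bsub>units_of (L\<lparr>carrier := quotient_field L W2\<rparr>)\<^esub> x) `
      (quotient_field L W1 - {\<zero>\<^bsub>L\<^esub>})))"


section \<open>Almost Dedekind domains and their SP-rank\<close>

definition Max_ideals :: "('a, 'b) ring_scheme \<Rightarrow> 'a set set"
  where "Max_ideals R = {M. maximalideal M R}"

definition almost_dedekind :: "('a, 'b) ring_scheme \<Rightarrow> 'a set \<Rightarrow> bool"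
  where "almost_dedekind L D \<longleftrightarrow> subring D L \<and>
    (\<forall>M \<in> Max_ideals (L\<lparr>carrier := D\<rparr>). discrete_valuation_ring L (localization L D M))"

definition radical_ideal :: "'a set \<Rightarrow> ('a, 'b) ring_scheme \<Rightarrow> bool"
  where "radical_ideal I R \<longleftrightarrow> ideal I R \<and>
    (\<forall>x \<in> carrier R. \<forall>n::nat. x [^]\<^bsub>R\<^esub> n \<in> I \<longrightarrow> x \<in> I)"

definition fin_gen_ideal :: "'a set \<Rightarrow> ('a, 'b) ring_scheme \<Rightarrow> bool"
  where "fin_gen_ideal I R \<longleftrightarrow> (\<exists>S. finite S \<and> S \<subseteq> carrier R \<and> I = Idl\<^bsub>R\<^esub> S)"

definition Crit_ideals :: "('a, 'b) ring_scheme \<Rightarrow> 'a set set"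
  where "Crit_ideals R = {M \<in> Max_ideals R.
    \<not> (\<exists>I \<subseteq> M. I \<noteq> {\<zero>\<^bsub>R\<^esub>} \<and> fin_gen_ideal I R \<and> radical_ideal I R)}"

text \<open>The ring \<open>T\<^sub>\<alpha>\<close>, as a function of the set \<open>C = Crit\<^sup>\<alpha>(D)\<close>.\<close>

definition SP_ring :: "('a, 'b) ring_scheme \<Rightarrow> 'a set \<Rightarrow> 'a set set \<Rightarrow> 'a set"
  where "SP_ring L D C =
    (if C = {} then quotient_field L D else (\<Inter>M\<in>C. localization L D M))"

text \<open>
  The condition \<open>C \<noteq> {}\<close> is the convention that \<open>T\<^sub>\<alpha>\<close> has no critical ideals if \<open>Crit\<^sup>\<alpha>(D)\<close>
  is empty.
\<close>

definition SP_step :: "('a, 'b) ring_scheme \<Rightarrow> 'a set \<Rightarrow> 'a set set \<Rightarrow> 'a set set"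
  where "SP_step L D C = {P \<in> Max_ideals (L\<lparr>carrier := D\<rparr>). C \<noteq> {} \<and>
    Idl\<^bsub>L\<lparr>carrier := SP_ring L D C\<rparr>\<^esub> P \<in> Crit_ideals (L\<lparr>carrier := SP_ring L D C\<rparr>)}"

definition SP_crit :: "('a, 'b) ring_scheme \<Rightarrow> 'a set \<Rightarrow> 'o::wellorder \<Rightarrow> 'a set set"
  where "SP_crit L D \<alpha> = transfinite (SP_step L D) (Max_ideals (L\<lparr>carrier := D\<rparr>)) \<alpha>"

text \<open>
  The type \<open>'a set ordinal\<close> is large enough for the rank: choosing for every \<open>\<beta>\<close> below the rank
  an element of \<open>Crit\<^sup>\<beta>(D)\<close> outside \<open>Crit\<^bsup>\<beta>+1\<^esup>(D)\<close> embeds the rank into the maximal ideals.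
\<close>

definition SP_rank :: "('a, 'b) ring_scheme \<Rightarrow> 'a set \<Rightarrow> 'a set ordinal"
  where "SP_rank L D = (LEAST \<alpha>. SP_crit L D \<alpha> = {})"


section \<open>Weighted trees and their SP-rank\<close>

record 'v weighted_tree =
  verts :: "'v set"
  tree_le :: "'v \<Rightarrow> 'v \<Rightarrow> bool"
  weight :: "'v \<Rightarrow> 'v \<Rightarrow> nat"

definition tree_root :: "'v weighted_tree \<Rightarrow> 'v"
  where "tree_root T = (THE r. r \<in> verts T \<and> (\<forall>a \<in> verts T. tree_le T r a))"

definition tree_lt :: "'v weighted_tree \<Rightarrow> 'v \<Rightarrow> 'v \<Rightarrow> bool"
  where "tree_lt T a b \<longleftrightarrow> tree_le T a b \<and> a \<noteq> b"

definition edge :: "'v weighted_tree \<Rightarrow> 'v \<Rightarrow> 'v \<Rightarrow> bool"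
  where "edge T a b \<longleftrightarrow> a \<in> verts T \<and> b \<in> verts T \<and> tree_lt T a b \<and>
    \<not> (\<exists>c \<in> verts T. tree_lt T a c \<and> tree_lt T c b)"

definition infinite_path :: "'v weighted_tree \<Rightarrow> (nat \<Rightarrow> 'v) \<Rightarrow> bool"
  where "infinite_path T \<pi> \<longleftrightarrow> (\<forall>i. edge T (\<pi> i) (\<pi> (Suc i)))"

definition MaxPath :: "'v weighted_tree \<Rightarrow> (nat \<Rightarrow> 'v) set"
  where "MaxPath T = {\<pi>. infinite_path T \<pi> \<and> \<pi> 0 = tree_root T}"

text \<open>The infinite subpaths of an infinite path are its tails.\<close>

definition tail :: "nat \<Rightarrow> (nat \<Rightarrow> 'v) \<Rightarrow> nat \<Rightarrow> 'v"
  where "tail k \<pi> = (\<lambda>i. \<pi> (k + i))"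

definition max_extension :: "'v weighted_tree \<Rightarrow> (nat \<Rightarrow> 'v) \<Rightarrow> nat \<Rightarrow> 'v"
  where "max_extension T \<pi> = (THE \<sigma>. \<sigma> \<in> MaxPath T \<and> (\<exists>k. \<pi> = tail k \<sigma>))"

text \<open>
  The infinite product of the weights along \<open>\<pi>\<close>: the partial products are nondecreasing since
  weights are positive.
\<close>

definition path_weight :: "'v weighted_tree \<Rightarrow> (nat \<Rightarrow> 'v) \<Rightarrow> enat"
  where "path_weight T \<pi> = (SUP n. enat (\<Prod>i<n. weight T (\<pi> i) (\<pi> (Suc i))))"

text \<open>
  The path \<open>u(\<pi>)\<close>, the largest unramified infinite subpath of \<open>\<pi>\<close>; it exists if \<open>\<pi>\<close> is finitely
  ramified.
\<close>

definition unramified_part :: "'v weighted_tree \<Rightarrow> (nat \<Rightarrow> 'v) \<Rightarrow> nat \<Rightarrow> 'v"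
  where "unramified_part T \<pi> = tail (LEAST k. path_weight T (tail k \<pi>) = 1) \<pi>"

definition tree_step :: "'v weighted_tree \<Rightarrow> (nat \<Rightarrow> 'v) set \<Rightarrow> (nat \<Rightarrow> 'v) set"
  where "tree_step T C = {\<pi> \<in> MaxPath T. \<forall>a \<in> range (unramified_part T \<pi>).
    \<exists>\<pi>'. infinite_path T \<pi>' \<and> \<pi>' 0 = a \<and> path_weight T \<pi>' > 1 \<and> max_extension T \<pi>' \<in> C}"

definition tree_crit :: "'v weighted_tree \<Rightarrow> 'o::wellorder \<Rightarrow> (nat \<Rightarrow> 'v) set"
  where "tree_crit T \<alpha> = transfinite (tree_step T) (MaxPath T) \<alpha>"

text \<open>
  The type \<open>'v ordinal\<close> is large enough for the rank: if \<open>\<pi>\<close> lies in \<open>Crit\<^sup>\<beta>\<close> but not in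
  \<open>Crit\<^bsup>\<beta>+1\<^esup>\<close>, some vertex of \<open>u(\<pi>)\<close> is not the start of a ramified infinite path whose maximal
  extension is in \<open>Crit\<^sup>\<beta>\<close>, and such vertices are distinct for distinct \<open>\<beta>\<close>.
\<close>

definition tree_SP_rank :: "'v weighted_tree \<Rightarrow> 'v ordinal"
  where "tree_SP_rank T = (LEAST \<alpha>. tree_crit T \<alpha> = {})"


section \<open>The ramification tree\<close>

text \<open>Valuations are identified with their valuation rings.\<close>

definition ramification_tree ::
    "('a, 'b) ring_scheme \<Rightarrow> 'a set \<Rightarrow> (nat \<Rightarrow> 'a set) \<Rightarrow> 'a set weighted_tree"
  where "ramification_tree L V K =
    \<lparr>verts = {W. valuation_ring L W \<and> (\<exists>i. quotient_field L W = K i) \<and> extends L V W},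
     tree_le = extends L,
     weight = ramification_index L\<rparr>"

end

(* A maximal ideal M of A corresponds to the maximal path i |-> A_M \<inter> K_i of the ramification tree,
   and every maximal path arises this way: the union of its valuation rings lies above some A_M, and
   a discrete valuation ring is a maximal proper subring of its quotient field. A path is unramified
   from level i on iff K_i contains a uniformizer of A_M, so the step of the tree derivation can be
   read off the ideals; by transfinite induction it suffices to match it with the step of the ring
   derivation, on sets C of ideals that are closed in the topology of the path space.

   Put T = \<Inter>{A_M | M \<in> C}. The key element, for given P and i, is an x \<in> A \<inter> K_i that generates the
   maximal ideal of A_P \<inter> K_i and is a unit at all other extensions of V to K_i; it exists because
   there are only finitely many of these. If every path of C through the vertex A_P \<inter> K_i is
   unramified from there on, x has value 0 or 1 at every member of C, so x T is a nonzero finitely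
   generated radical ideal in P T. Conversely, let I be a finitely generated ideal in P T with
   generators in K_i. If a path of C passes through A_P \<inter> K_i and ramifies later, then all elements
   of I have value at least 2 at the corresponding M, and I is not radical. *)
theory Submission
  imports Defs
begin

section \<open>Valuation rings and discrete valuations\<close>

text \<open>The rings \<open>A \<inter> K i\<close> are never treated as Dedekind domains; what is
  needed at a finite level is deduced from the valuations \<open>val M\<close> on the union of the
  tower. Two obstacles shape this. An element \<open>z\<close> of \<open>A_M \<inter> K i\<close>
  must become a fraction of elements of \<open>A \<inter> K i\<close>. If \<open>z\<close> is a root
  of a primitive polynomial over \<open>V\<close>, each Horner prefix \<open>p1\<close> gives
  integral elements \<open>p1(z)\<close> and \<open>z p1(z)\<close> whose quotient is
  \<open>z\<close>, and for some prefix they do not both lie in a given maximal ideal. Two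
  valuations with the same ring on \<open>K i\<close> may differ there by a factor, as each is
  normalised on the whole union. So only membership in the ring and in its maximal ideal passes from
  one path to another, and a generator is characterised by divisibility, not by its value. This is
  the origin of the value 2: positivity passes from \<open>P\<close> to \<open>M\<close>, and value
  1 is excluded since \<open>K i\<close> contains no uniformizer of \<open>M\<close>. A radical
  ideal localises to a radical ideal, which in the discrete valuation ring \<open>A_M\<close> cannot
  be a nonzero ideal inside the square of the maximal ideal.\<close>

lemma (in field) inv_nonzero [simp]:
  assumes "x \<in> carrier R" "x \<noteq> \<zero>"
  shows "inv x \<in> carrier R" "inv x \<noteq> \<zero>" "x \<otimes> inv x = \<one>" "inv x \<otimes> x = \<one>" "inv (inv x) = x"
proof -
  have u: "x \<in> Units R" using assms field_Units by auto
  show "inv x \<in> carrier R" "x \<otimes> inv x = \<one>" "inv x \<otimes> x = \<one>" "inv (inv x) = x" using u by auto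
  show "inv x \<noteq> \<zero>" using Units_inv_Units[OF u] field_Units by auto
qed

section \<open>Quotient fields and valuation rings inside the ambient field\<close>

lemma (in field) quotient_field_subset:
  assumes "subfield F R" "D \<subseteq> F" shows "quotient_field R D \<subseteq> F"
  using assms subfieldE(1)[OF assms(1)] subfield_m_inv(1)[OF assms(1)] 
  unfolding quotient_field_def by (auto intro!: subringE(6) dest: subsetD)

lemma (in field) subset_quotient_field:
  assumes "subring D R" shows "D \<subseteq> quotient_field R D"
proof
  fix x assume x: "x \<in> D"
  then have "x = x \<otimes> inv \<one>" "\<one> \<in> D - {\<zero>}"
    using subringE(1,3)[OF assms] by auto
  then show "x \<in> quotient_field R D" using x unfolding quotient_field_def by blast
qed

lemma (in field) quotient_field_eqI:
  assumes "subfield F R" "subring W R" "W \<subseteq> F"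
    and "\<And>x. x \<in> F \<Longrightarrow> x \<noteq> \<zero> \<Longrightarrow> x \<in> W \<or> inv x \<in> W"
  shows "quotient_field R W = F"
proof
  show "quotient_field R W \<subseteq> F" using quotient_field_subset assms by auto
  show "F \<subseteq> quotient_field R W"
  proof
    fix x assume x: "x \<in> F"
    then have xc: "x \<in> carrier R" using subfieldE(3)[OF assms(1)] by auto
    show "x \<in> quotient_field R W"
    proof (cases "x \<in> W")
      case True
      then show ?thesis using subset_quotient_field[OF assms(2)] by auto
    next
      case False
      then have "x \<noteq> \<zero>" using subringE(2)[OF assms(2)] by auto
      then have "inv x \<in> W - {\<zero>}" "x = \<one> \<otimes> inv (inv x)" using assms(4)[OF x] False xc by auto
      then show ?thesis unfolding quotient_field_def using subringE(3)[OF assms(2)] by blast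
    qed
  qed
qed

lemma (in field) valuation_ringI:
  assumes "subfield F R" "subring W R" "W \<subseteq> F"
    and "\<And>x. x \<in> F \<Longrightarrow> x \<noteq> \<zero> \<Longrightarrow> x \<in> W \<or> inv x \<in> W"
  shows "valuation_ring R W"
  using assms quotient_field_eqI[OF assms] unfolding valuation_ring_def by auto

lemma (in field) Units_subring:
  assumes "subring W R"
  shows "Units (R\<lparr>carrier := W\<rparr>) = {x \<in> W - {\<zero>}. inv x \<in> W}"
proof -
  have "x \<in> W - {\<zero>} \<and> inv x \<in> W" if "x \<in> Units (R\<lparr>carrier := W\<rparr>)" for x
  proof -
    from that obtain y where y: "x \<in> W" "y \<in> W" "x \<otimes> y = \<one>" "y \<otimes> x = \<one>" unfolding Units_def by auto
    then have c: "x \<in> carrier R" "y \<in> carrier R" using subringE(1)[OF assms] by auto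
    then have "x \<noteq> \<zero>" "inv x = y" using y by (auto intro: inv_char)
    then show ?thesis using y by auto
  qed
  moreover have "x \<in> Units (R\<lparr>carrier := W\<rparr>)" if "x \<in> W" "x \<noteq> \<zero>" "inv x \<in> W" for x
    using that subringE(1)[OF assms] inv_nonzero(3,4)[of x] unfolding Units_def
    by (auto simp: subset_iff intro!: bexI[of _ "inv x"])
  ultimately show ?thesis by auto
qed

text \<open>The valuation is normalised by \<open>val_surj\<close> and constrained only on the
  nonzero elements of \<open>F\<close>. The ultrametric inequality is not among the axioms; it comes
  from \<open>W\<close> being closed under addition.\<close>

locale discrete_valuation = field R for R (structure) +
  fixes F W :: "'a set" and v :: "'a \<Rightarrow> int"
  assumes F: "subfield F R"
    and W: "subring W R" "W \<subseteq> F"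
    and val_mult: "\<lbrakk>x \<in> F; x \<noteq> \<zero>; y \<in> F; y \<noteq> \<zero>\<rbrakk> \<Longrightarrow> v (x \<otimes> y) = v x + v y"
    and val_surj: "\<exists>x \<in> F - {\<zero>}. v x = 1"
    and mem_iff: "\<lbrakk>x \<in> F; x \<noteq> \<zero>\<rbrakk> \<Longrightarrow> x \<in> W \<longleftrightarrow> 0 \<le> v x"
begin

lemmas F_subring = subringE[OF subfieldE(1)[OF F]]
lemmas W_subring = subringE[OF W(1)]

lemma F_carr: "x \<in> F \<Longrightarrow> x \<in> carrier R"
  using F_subring(1) by auto

lemma F_inv: "x \<in> F \<Longrightarrow> x \<noteq> \<zero> \<Longrightarrow> inv x \<in> F"
  using subfield_m_inv(1)[OF F] by auto

lemma val_one: "v \<one> = 0"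
  using val_mult[of \<one> \<one>] F_subring(3) F_carr by auto

lemma val_inv: "x \<in> F \<Longrightarrow> x \<noteq> \<zero> \<Longrightarrow> v (inv x) = - v x"
  using val_mult[of x "inv x"] F_inv[of x] F_carr[of x] val_one by auto

lemma val_div: "\<lbrakk>x \<in> F; x \<noteq> \<zero>; y \<in> F; y \<noteq> \<zero>\<rbrakk> \<Longrightarrow> v (x \<otimes> inv y) = v x - v y"
  using val_mult[of x "inv y"] val_inv[of y] F_inv[of y] F_carr by auto

lemma F_mult_nonzero: "\<lbrakk>x \<in> F; x \<noteq> \<zero>; y \<in> F; y \<noteq> \<zero>\<rbrakk> \<Longrightarrow> x \<otimes> y \<in> F \<and> x \<otimes> y \<noteq> \<zero>"
  using F_subring(6)[of x y] F_carr[of x] F_carr[of y] integral[of x y] by auto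

lemma val_pow: "x \<in> F \<Longrightarrow> x \<noteq> \<zero> \<Longrightarrow> x [^] (n::nat) \<in> F \<and> x [^] n \<noteq> \<zero> \<and> v (x [^] n) = int n * v x"
proof (induction n)
  case 0
  then show ?case using val_one F_subring(3) by auto
next
  case (Suc n)
  then show ?case using val_mult[of "x [^] n" x] F_mult_nonzero[of "x [^] n" x] by (auto simp: algebra_simps)
qed

text \<open>The fractional ideals of \<open>W\<close>: \<open>fball 0\<close> is \<open>W\<close>
  and \<open>fball 1\<close> is its maximal ideal. Zero is adjoined by hand because the number
  \<open>v \<zero>\<close> carries no information.\<close>

definition fball :: "int \<Rightarrow> 'a set" where
  "fball n = {x \<in> F. x = \<zero> \<or> n \<le> v x}"

lemma fball_0: "fball 0 = W"
  using mem_iff W(2) W_subring(2) F_subring(2) unfolding fball_def by auto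

lemma fball_antimono: "m \<le> n \<Longrightarrow> fball n \<subseteq> fball m"
  unfolding fball_def by auto

lemma fball_mult: "x \<in> fball m \<Longrightarrow> y \<in> fball n \<Longrightarrow> x \<otimes> y \<in> fball (m + n)"
  unfolding fball_def using F_subring(2,6) F_carr val_mult
  by (cases "x = \<zero>"; cases "y = \<zero>") auto

lemma fball_neg: "x \<in> fball n \<Longrightarrow> \<ominus> x \<in> fball n"
proof -
  assume x: "x \<in> fball n"
  have "\<ominus> \<one> \<in> fball 0" using fball_0 W_subring(3,5) by auto
  then have "\<ominus> \<one> \<otimes> x \<in> fball (0 + n)" using x fball_mult by blast
  then show ?thesis using x F_carr unfolding fball_def by (auto simp: l_minus)
qed

text \<open>Dividing by the element of smaller value reduces the ultrametric inequality to
  \<open>1 + y/x\<close> being in \<open>W\<close>.\<close>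

lemma fball_add_aux:
  assumes "x \<in> F" "x \<noteq> \<zero>" "y \<in> F" "y \<noteq> \<zero>" "v x \<le> v y"
  shows "x \<oplus> y \<in> fball (v x)"
proof -
  have c: "x \<in> carrier R" "y \<in> carrier R" using assms F_carr by auto
  have "y \<otimes> inv x \<in> F" "y \<otimes> inv x \<noteq> \<zero>" "0 \<le> v (y \<otimes> inv x)"
    using F_mult_nonzero[of y "inv x"] F_inv assms c val_div by auto
  then have "\<one> \<oplus> y \<otimes> inv x \<in> fball 0"
    using fball_0 mem_iff W_subring(3,7) by auto
  moreover have "x \<in> fball (v x)" using assms unfolding fball_def by auto
  ultimately have "x \<otimes> (\<one> \<oplus> y \<otimes> inv x) \<in> fball (v x + 0)" using fball_mult by blast
  moreover have "x \<otimes> (\<one> \<oplus> y \<otimes> inv x) = x \<oplus> y"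
  proof -
    have "x \<otimes> (y \<otimes> inv x) = y \<otimes> (x \<otimes> inv x)" using c assms by (metis m_lcomm inv_nonzero(1))
    then show ?thesis using c assms by (simp add: r_distr)
  qed
  ultimately show ?thesis by simp
qed

lemma fball_add: "x \<in> fball n \<Longrightarrow> y \<in> fball n \<Longrightarrow> x \<oplus> y \<in> fball n"
proof -
  assume xy: "x \<in> fball n" "y \<in> fball n"
  then have F': "x \<in> F" "y \<in> F" unfolding fball_def by auto
  have c: "x \<in> carrier R" "y \<in> carrier R" using F' F_carr by auto
  consider "x = \<zero>" | "y = \<zero>" | "x \<noteq> \<zero>" "y \<noteq> \<zero>" "v x \<le> v y" | "x \<noteq> \<zero>" "y \<noteq> \<zero>" "v y \<le> v x" by linarith
  then show ?thesis
  proof cases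
    case 3
    then show ?thesis using fball_add_aux[of x y] fball_antimono[of n "v x"] xy F' unfolding fball_def by auto
  next
    case 4
    then have "y \<oplus> x \<in> fball n" using fball_add_aux[of y x] fball_antimono[of n "v y"] xy F' unfolding fball_def by auto
    then show ?thesis using c add.m_comm by simp
  qed (use xy c in auto)
qed

text \<open>If the sum were zero or had larger value than \<open>x\<close>, subtracting
  \<open>y\<close> would put \<open>x\<close> into the next smaller ball.\<close>

lemma val_add_lt:
  assumes "x \<in> F" "x \<noteq> \<zero>" "y \<in> fball (v x + 1)"
  shows "x \<oplus> y \<noteq> \<zero>" "v (x \<oplus> y) = v x"
proof -
  have c: "x \<in> carrier R" "y \<in> carrier R" "y \<in> F" using assms F_carr unfolding fball_def by auto
  have m: "\<ominus> y \<in> fball (v x + 1)" using fball_neg assms by auto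
  have e: "(x \<oplus> y) \<oplus> \<ominus> y = x" using c by (simp add: a_assoc r_neg)
  have n: "x \<notin> fball (v x + 1)" using assms unfolding fball_def by auto
  show nz: "x \<oplus> y \<noteq> \<zero>"
    using e n m c by (metis a_inv_closed l_zero)
  have "x \<oplus> y \<in> fball (v x)"
    using fball_add[of x "v x" y] assms fball_antimono[of "v x" "v x + 1"] unfolding fball_def by auto
  then have "v x \<le> v (x \<oplus> y)" using nz unfolding fball_def by auto
  moreover have "\<not> v x + 1 \<le> v (x \<oplus> y)"
  proof
    assume "v x + 1 \<le> v (x \<oplus> y)"
    then have "x \<oplus> y \<in> fball (v x + 1)" using c assms F_subring(7) unfolding fball_def by auto
    from fball_add[OF this m] show False using e n by auto
  qed
  ultimately show "v (x \<oplus> y) = v x" by auto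
qed

lemma mem_or_inv_mem: "x \<in> F \<Longrightarrow> x \<noteq> \<zero> \<Longrightarrow> x \<in> W \<or> inv x \<in> W"
  using mem_iff[of x] mem_iff[of "inv x"] val_inv[of x] F_inv[of x] F_carr[of x] by auto

lemma W_proper: "W \<noteq> F"
proof -
  obtain x where x: "x \<in> F" "x \<noteq> \<zero>" "v x = 1" using val_surj by auto
  then have "inv x \<in> F" "inv x \<notin> W" using F_inv mem_iff val_inv F_carr by auto
  then show ?thesis by auto
qed

text \<open>An element of negative value has powers of arbitrarily low value, so every element of
  \<open>F\<close> is such a power times an element of \<open>W\<close>.\<close>

lemma maximal_subring:
  assumes "subring S R" "W \<subseteq> S" "S \<subseteq> F" "S \<noteq> W" shows "S = F"
proof -
  obtain s where s: "s \<in> S" "s \<notin> W" using assms by auto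
  then have sF: "s \<in> F" "s \<noteq> \<zero>" using assms W_subring(2) by auto
  then have sneg: "v s < 0" using mem_iff s by auto
  have sp: "s [^] (n::nat) \<in> S" for n
    by (induction n) (use s subringE(3,6)[OF assms(1)] in auto)
  have "x \<in> S" if x: "x \<in> F" for x
  proof (cases "x = \<zero>")
    case True
    then show ?thesis using subringE(2)[OF assms(1)] by simp
  next
    case False
    define n where "n = nat \<bar>v x\<bar>"
    note p = val_pow[OF sF, of n]
    have "int n * v s \<le> int n * (-1)" using sneg by (intro mult_left_mono) auto
    then have "v (x \<otimes> inv (s [^] n)) \<ge> 0"
      using val_div[OF x False, of "s [^] n"] p unfolding n_def by auto
    moreover have d: "x \<otimes> inv (s [^] n) \<in> F \<and> x \<otimes> inv (s [^] n) \<noteq> \<zero>"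
      using F_mult_nonzero[of x "inv (s [^] n)"] p x False F_inv F_carr by auto
    ultimately have "x \<otimes> inv (s [^] n) \<in> S" using mem_iff assms by auto
    then have "x \<otimes> inv (s [^] n) \<otimes> s [^] n \<in> S" using sp subringE(6)[OF assms(1)] by auto
    moreover have "x \<otimes> inv (s [^] n) \<otimes> s [^] n = x"
      using x p F_carr by (simp add: m_assoc)
    ultimately show ?thesis by simp
  qed
  then show ?thesis using assms by auto
qed

end

text \<open>An isomorphism of the value group with the integers, composed with the class map, is a
  homomorphism \<open>w\<close> whose kernel is the unit group of \<open>W\<close>. It knows nothing
  of the order, so it remains to see that \<open>w\<close> has constant sign on \<open>W\<close> and
  to flip it if necessary.\<close>

lemma (in field) dvr_valuation:
  assumes F: "subfield F R" and dvr: "discrete_valuation_ring R W" and Q: "quotient_field R W = F"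
  obtains v where "discrete_valuation R F W v"
proof -
  let ?G = "units_of (R\<lparr>carrier := F\<rparr>)" and ?H = "Units (R\<lparr>carrier := W\<rparr>)"
  have W: "subring W R" and vr: "\<And>x. x \<in> F \<Longrightarrow> x \<noteq> \<zero> \<Longrightarrow> x \<in> W \<or> inv x \<in> W"
    and iso: "(?G Mod ?H) \<cong> integer_group"
    using dvr Q unfolding discrete_valuation_ring_def valuation_ring_def value_group_def by auto
  have WF: "W \<subseteq> F" using subset_quotient_field[OF W] Q by auto
  note Fs = subringE[OF subfieldE(1)[OF F]] and Ws = subringE[OF W]
  have uF: "Units (R\<lparr>carrier := F\<rparr>) = F - {\<zero>}" using subfield.subfield_Units[OF F] .
  have cG: "carrier ?G = F - {\<zero>}" using uF by (simp add: units_of_def)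
  have mG: "x \<otimes>\<^bsub>?G\<^esub> y = x \<otimes> y" for x y by (simp add: units_of_def)
  have oG: "\<one>\<^bsub>?G\<^esub> = \<one>" by (simp add: units_of_def)
  interpret FF: field "R\<lparr>carrier := F\<rparr>" using subfield_iff(2)[OF F] .
  interpret G: comm_group ?G by (rule FF.units_comm_group)
  have H: "?H = {x \<in> W - {\<zero>}. inv x \<in> W}" by (rule Units_subring[OF W])
  have invG: "inv\<^bsub>?G\<^esub> x = inv x" if "x \<in> F - {\<zero>}" for x
    by (rule G.inv_equality) (use that cG mG oG Fs(1) subfield_m_inv[OF F that] in \<open>auto simp: subset_iff\<close>)
  have sub: "subgroup ?H ?G"
  proof (rule G.subgroupI)
    show "?H \<subseteq> carrier ?G" using H cG WF by auto
    have "\<one> \<in> ?H" using H Ws(3) by auto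
    then show "?H \<noteq> {}" by blast
    show "inv\<^bsub>?G\<^esub> a \<in> ?H" if a: "a \<in> ?H" for a
    proof -
      have aF: "a \<in> F - {\<zero>}" "a \<in> carrier R" using a H WF Ws(1) by auto
      show ?thesis using a invG[OF aF(1)] H aF by auto
    qed
    show "a \<otimes>\<^bsub>?G\<^esub> b \<in> ?H" if ab: "a \<in> ?H" "b \<in> ?H" for a b
      using ab unfolding mG
      by (rule monoid.Units_m_closed[of "R\<lparr>carrier := W\<rparr>", simplified,
            OF ring.is_monoid[OF subring_is_ring[OF W]]])
  qed
  have N: "?H \<lhd> ?G" using sub G.normal_iff_subgroup by auto
  interpret N: normal ?H ?G by (rule N)
  obtain h where h: "h \<in> iso (?G Mod ?H) integer_group" using iso unfolding is_iso_def by auto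
  define w where "w x = h (?H #>\<^bsub>?G\<^esub> x)" for x
  have w_mult: "w (x \<otimes> y) = w x + w y" if "x \<in> F - {\<zero>}" "y \<in> F - {\<zero>}" for x y
  proof -
    have "?H #>\<^bsub>?G\<^esub> (x \<otimes>\<^bsub>?G\<^esub> y) = (?H #>\<^bsub>?G\<^esub> x) <#>\<^bsub>?G\<^esub> (?H #>\<^bsub>?G\<^esub> y)"
      using that cG by (simp add: N.rcos_sum)
    then show ?thesis using h that cG unfolding w_def iso_def hom_def carrier_FactGroup mG by auto
  qed
  have w_ker: "x \<in> ?H" if "x \<in> F - {\<zero>}" "w x = 0" for x
  proof -
    have g: "group (?G Mod ?H)" by (rule N.factorgroup_is_group)
    have h0: "h (\<one>\<^bsub>?G Mod ?H\<^esub>) = 0" using hom_one[OF Group.iso_imp_homomorphism[OF h] g] by simp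
    have "inj_on h (carrier (?G Mod ?H))" using h unfolding iso_def bij_betw_def by auto
    moreover have "?H #>\<^bsub>?G\<^esub> x \<in> carrier (?G Mod ?H)" using that cG unfolding carrier_FactGroup by auto
    moreover have "\<one>\<^bsub>?G Mod ?H\<^esub> \<in> carrier (?G Mod ?H)" using monoid.one_closed[OF group.is_monoid[OF g]] .
    ultimately have "?H #>\<^bsub>?G\<^esub> x = ?H"
      using h0 that unfolding w_def one_FactGroup by (metis inj_onD)
    then show ?thesis using G.rcos_self[of x ?H] that cG sub by auto
  qed
  have w_H: "w x = 0" if "x \<in> ?H" for x
  proof -
    have "x \<in> F - {\<zero>}" using that H WF by auto
    moreover have "?H #>\<^bsub>?G\<^esub> x = ?H" using that sub G.coset_join2 \<open>x \<in> F - {\<zero>}\<close> cG by auto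
    moreover have "h (\<one>\<^bsub>?G Mod ?H\<^esub>) = 0" using hom_one[OF Group.iso_imp_homomorphism[OF h] N.factorgroup_is_group] by simp
    ultimately show ?thesis unfolding w_def by simp
  qed
  have w_surj: "\<exists>x \<in> F - {\<zero>}. w x = n" for n
  proof -
    have "n \<in> h ` (carrier (?G Mod ?H))" using h unfolding iso_def bij_betw_def by auto
    then show ?thesis unfolding carrier_FactGroup cG w_def by auto
  qed
  have w_one: "w \<one> = 0" using w_mult[of \<one> \<one>] Fs by auto
  have w_pow: "x [^] (n::nat) \<in> F - {\<zero>} \<and> w (x [^] n) = int n * w x" if "x \<in> F - {\<zero>}" for x n
  proof (induction n)
    case 0
    then show ?case using w_one Fs by auto
  next
    case (Suc n)
    then have "x [^] n \<otimes> x \<in> F - {\<zero>}" using that Fs(1,6) integral[of "x [^] n" x] by (auto simp: subset_iff)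
    then show ?case using w_mult[of "x [^] n" x] Suc that by (auto simp: algebra_simps)
  qed
  have W_pow: "x [^] (n::nat) \<in> W" if "x \<in> W" for x n
    by (induction n) (use that Ws in auto)
  (* Two elements of \<open>W\<close> with values of opposite sign have powers whose product is a unit. *)
  have no_mix: "\<not> (w x > 0 \<and> w y < 0)" if x: "x \<in> W - {\<zero>}" and y: "y \<in> W - {\<zero>}" for x y
  proof
    assume a: "w x > 0 \<and> w y < 0"
    define m n where "m = nat (w x)" and "n = nat (- w y)"
    have n: "n > 0" using a unfolding n_def by auto
    have xF: "x \<in> F - {\<zero>}" and yF: "y \<in> F - {\<zero>}" using x y WF by auto
    have c: "x \<in> carrier R" "y \<in> carrier R" using x y Ws(1) by auto
    \<comment> \<open>Each exponent is the absolute value of the other element's value, so the two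
      contributions cancel.\<close>
    let ?z = "x [^] n \<otimes> y [^] m"
    have zF: "?z \<in> F - {\<zero>}"
      using w_pow[OF xF, of n] w_pow[OF yF, of m] Fs(6) c integral[of "x [^] n" "y [^] m"] by auto
    have "w ?z = 0" using w_mult[of "x [^] n" "y [^] m"] w_pow[OF xF, of n] w_pow[OF yF, of m] a
      unfolding m_def n_def by auto
    then have "?z \<in> ?H" using w_ker zF by auto
    then have iz: "inv ?z \<in> W" using H by auto
    \<comment> \<open>As \<open>n\<close> is positive, \<open>x\<close> divides the unit
      \<open>?z\<close> inside \<open>W\<close> and is itself a unit, contrary to its positive
      value.\<close>
    obtain k where k: "n = Suc k" using n by (cases n) auto
    have "x \<otimes> (x [^] k \<otimes> y [^] m \<otimes> inv ?z) = \<one>"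
    proof -
      have ac: "x \<otimes> (x [^] k \<otimes> y [^] m \<otimes> i) = ?z \<otimes> i" if i: "i \<in> carrier R" for i
        using c(1) nat_pow_closed[OF c(1), of k] nat_pow_closed[OF c(2), of m] i
        unfolding k nat_pow_Suc by (simp add: m_ac del: nat_pow_closed)
      have "inv ?z \<in> carrier R" using zF c by auto
      note ac[OF this]
      then show ?thesis using zF c by auto
    qed
    moreover have "x [^] k \<otimes> y [^] m \<otimes> inv ?z \<in> W" using W_pow x y iz Ws(6) by auto
    ultimately have "inv x \<in> W" using c Ws(1) by (metis comm_inv_char subset_iff)
    then have "x \<in> ?H" using x H by auto
    then show False using a w_H by auto
  qed
  \<comment> \<open>The sign that makes \<open>w\<close> nonnegative on \<open>W\<close>; by
    \<open>no_mix\<close> one choice serves all elements.\<close>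
  obtain e where e: "e = 1 \<or> e = (-1::int)" "\<And>x. x \<in> W - {\<zero>} \<Longrightarrow> 0 \<le> e * w x"
  proof (cases "\<exists>x \<in> W - {\<zero>}. w x > 0")
    case True
    then have "0 \<le> 1 * w y" if "y \<in> W - {\<zero>}" for y
    proof -
      from True obtain x where "x \<in> W - {\<zero>}" "w x > 0" by blast
      from no_mix[OF this(1) that] this(2) show ?thesis by linarith
    qed
    then show ?thesis using that[of 1] by blast
  next
    case False
    then have "0 \<le> -1 * w y" if "y \<in> W - {\<zero>}" for y
    proof -
      have "\<not> w y > 0" using False that by blast
      then show ?thesis by linarith
    qed
    then show ?thesis using that[of "-1"] by blast
  qed
  have w_inv: "w (inv x) = - w x" if "x \<in> F - {\<zero>}" for x
    using w_mult[of x "inv x"] that subfield_m_inv[OF F that] w_one by auto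
  have "discrete_valuation R F W (\<lambda>x. e * w x)"
  proof (intro discrete_valuation.intro discrete_valuation_axioms.intro)
    show "e * w (x \<otimes> y) = e * w x + e * w y" if "x \<in> F" "x \<noteq> \<zero>" "y \<in> F" "y \<noteq> \<zero>" for x y
      using w_mult[of x y] that by (simp add: algebra_simps)
    obtain x where "x \<in> F - {\<zero>}" "w x = e" using w_surj by blast
    then show "\<exists>x \<in> F - {\<zero>}. e * w x = 1" using e(1) by (intro bexI[of _ x]) auto
    show "x \<in> W \<longleftrightarrow> 0 \<le> e * w x" if x: "x \<in> F" "x \<noteq> \<zero>" for x
    proof
      assume "0 \<le> e * w x"
      show "x \<in> W"
      proof (rule ccontr)
        assume "x \<notin> W"
        then have i: "inv x \<in> W" "inv x \<noteq> \<zero>" using x vr subfield_m_inv[OF F, of x] by auto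
        have "0 \<le> e * w (inv x)" using e i by auto
        then have "w x = 0" using \<open>0 \<le> e * w x\<close> w_inv[of x] x e(1) by auto
        then have "x \<in> ?H" using w_ker x by auto
        then show False using H \<open>x \<notin> W\<close> by auto
      qed
    qed (use e(2) x in auto)
  qed (use F W WF field_axioms in auto)
  then show thesis by (rule that)
qed

section \<open>Integral elements\<close>

lemma (in ring) eval_smult:
  assumes "k \<in> carrier R" "set p \<subseteq> carrier R" "x \<in> carrier R"
  shows "eval (map ((\<otimes>) k) p) x = k \<otimes> eval p x"
  using assms(2)
proof (induction p)
  case (Cons c p)
  then show ?case using assms eval_in_carrier[of p x] by (simp add: r_distr m_assoc)
qed (use assms in auto)

text \<open>If \<open>x\<close> is a root of a monic \<open>p\<close>, then \<open>d \<otimes> x\<close> is a root of \<open>scale_poly d \<one> p\<close>, whose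
  coefficients other than the leading one are divisible by those of \<open>map (\<lambda>c. c \<otimes> d) p\<close>.\<close>

fun (in ring) scale_poly :: "'a \<Rightarrow> 'a \<Rightarrow> 'a list \<Rightarrow> 'a list" where
  "scale_poly d e [] = []"
| "scale_poly d e (c # p) = (c \<otimes> e) # scale_poly d (d \<otimes> e) p"

lemma (in ring) length_scale_poly [simp]: "length (scale_poly d e p) = length p"
  by (induction p arbitrary: e) auto

text \<open>The additional factor \<open>d\<close> on the left turns the exponent
  \<open>length p - 1\<close> into \<open>length p\<close>, so the induction meets no truncated
  subtraction.\<close>

lemma (in cring) eval_scale_poly:
  assumes "set p \<subseteq> carrier R" "d \<in> carrier R" "e \<in> carrier R" "x \<in> carrier R"
  shows "eval (scale_poly d e p) (d \<otimes> x) \<otimes> d = e \<otimes> d [^] length p \<otimes> eval p x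
    \<and> set (scale_poly d e p) \<subseteq> carrier R"
  using assms(1,3)
proof (induction p arbitrary: e)
  case Nil
  then show ?case using assms by auto
next
  case (Cons c p)
  let ?q = "scale_poly d (d \<otimes> e) p"
  have cl: "c \<in> carrier R" "e \<in> carrier R" "d \<otimes> e \<in> carrier R" "eval p x \<in> carrier R" 
    "d [^] length p \<in> carrier R" "x [^] length p \<in> carrier R" and p: "set p \<subseteq> carrier R"
    using Cons(2,3) assms eval_in_carrier by auto
  note IH = Cons(1)[OF p cl(3)]
  have q: "eval ?q (d \<otimes> x) \<in> carrier R" using IH assms eval_in_carrier by auto
  have "eval (scale_poly d e (c # p)) (d \<otimes> x) \<otimes> d
      = c \<otimes> e \<otimes> (d \<otimes> x) [^] length p \<otimes> d \<oplus> eval ?q (d \<otimes> x) \<otimes> d"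
    using q cl assms by (simp add: l_distr)
  also have "\<dots> = c \<otimes> e \<otimes> (d [^] length p \<otimes> x [^] length p) \<otimes> d \<oplus> (d \<otimes> e) \<otimes> d [^] length p \<otimes> eval p x"
    using IH assms by (simp add: nat_pow_distrib)
  also have "\<dots> = e \<otimes> (d [^] length p \<otimes> d) \<otimes> (c \<otimes> x [^] length p \<oplus> eval p x)"
    using cl assms by algebra
  finally show ?case using IH cl by auto
qed

lemma (in domain) common_denominator:
  assumes "subring D R" "set p \<subseteq> quotient_field R D"
    and inv: "\<And>x. x \<in> D \<Longrightarrow> x \<noteq> \<zero> \<Longrightarrow> inv x \<in> carrier R \<and> x \<otimes> inv x = \<one>"
  shows "\<exists>d \<in> D - {\<zero>}. \<forall>c \<in> set p. c \<otimes> d \<in> D"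
  using assms(2)
proof (induction p)
  case Nil
  then show ?case using subringE(3)[OF assms(1)] by (auto intro!: bexI[of _ \<one>])
next
  case (Cons c p)
  note D = subringE[OF assms(1)]
  obtain d where d: "d \<in> D" "d \<noteq> \<zero>" "\<forall>c \<in> set p. c \<otimes> d \<in> D" using Cons by auto
  obtain a b where ab: "a \<in> D" "b \<in> D" "b \<noteq> \<zero>" "c = a \<otimes> inv b"
    using Cons(2) unfolding quotient_field_def by auto
  have cl: "a \<in> carrier R" "b \<in> carrier R" "d \<in> carrier R" "inv b \<in> carrier R" "b \<otimes> inv b = \<one>"
    using ab d D(1) inv[of b] by auto
  have 1: "c \<otimes> (d \<otimes> b) = a \<otimes> d"
  proof -
    have "c \<otimes> (d \<otimes> b) = (a \<otimes> d) \<otimes> (b \<otimes> inv b)" unfolding ab(4) using cl(1-4) by algebra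
    then show ?thesis using cl by simp
  qed
  have 2: "x \<otimes> (d \<otimes> b) = (x \<otimes> d) \<otimes> b" if "x \<in> carrier R" for x
    using that cl by (simp add: m_assoc)
  have p: "set p \<subseteq> carrier R" 
  proof -
    have "quotient_field R D \<subseteq> carrier R"
      unfolding quotient_field_def using D(1) inv by auto
    then show ?thesis using Cons(2) by auto
  qed
  have "x \<otimes> (d \<otimes> b) \<in> D" if "x \<in> set (c # p)" for x
    using that 1 2[of x] p d ab D(6) by auto
  moreover have "d \<otimes> b \<in> D - {\<zero>}" using d ab D(6) cl integral[of d b] by auto
  ultimately show ?case by blast
qed

text \<open>Behind the leading coefficient of a monic polynomial every coefficient receives at least
  one factor \<open>d\<close>, which clears its denominator. Being meant for the tail of such a
  polynomial, the lemma starts at \<open>d \<otimes> e\<close>.\<close>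

lemma (in ring) set_scale_poly:
  assumes "subring D R" "d \<in> D" "\<And>c. c \<in> set p \<Longrightarrow> c \<otimes> d \<in> D" "set p \<subseteq> carrier R" "e \<in> D"
  shows "set (scale_poly d (d \<otimes> e) p) \<subseteq> D"
  using assms(3-5)
proof (induction p arbitrary: e)
  case (Cons c p)
  note D = subringE[OF assms(1)]
  have "c \<otimes> (d \<otimes> e) = (c \<otimes> d) \<otimes> e" using Cons(3,4) assms(2) D(1) by (simp add: m_assoc subset_iff)
  also have "\<dots> \<in> D" using Cons D by auto
  finally show ?case using Cons(1)[of "d \<otimes> e"] Cons(2-) assms(2) D(6) by auto
qed auto

section \<open>Integral equations evaluated in a valuation ring\<close>

lemma (in domain) pow_nonzero: "x \<in> carrier R \<Longrightarrow> x \<noteq> \<zero> \<Longrightarrow> x [^] (n::nat) \<noteq> \<zero>"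
  by (induction n) (auto simp: integral_iff)

text \<open>When \<open>inv x\<close> is in \<open>W\<close> the highest power dominates:
  \<open>p(x)\<close> is a \<open>W\<close>-multiple of \<open>x\<close> to the power
  \<open>length p - 1\<close>. The extra factor \<open>x\<close> on the left removes the
  subtraction.\<close>

lemma (in field) eval_inv_integral:
  assumes "subring W R" "set p \<subseteq> W" "x \<in> carrier R" "x \<noteq> \<zero>" "inv x \<in> W"
  shows "\<exists>w \<in> W. eval p x \<otimes> x = w \<otimes> x [^] length p"
  using assms(2)
proof (induction p)
  case Nil
  then show ?case using subringE(1,2)[OF assms(1)] assms(3) by (auto intro!: bexI[of _ \<zero>])
next
  case (Cons c p)
  note W = subringE[OF assms(1)]
  obtain w where w: "w \<in> W" "eval p x \<otimes> x = w \<otimes> x [^] length p" using Cons by auto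
  have cl: "c \<in> carrier R" "w \<in> carrier R" "eval p x \<in> carrier R" "x [^] length p \<in> carrier R" "inv x \<in> carrier R"
    using Cons(2) W(1) w assms eval_in_carrier[of p x] by auto
  have "eval (c # p) x \<otimes> x = c \<otimes> (x [^] length p \<otimes> x) \<oplus> w \<otimes> x [^] length p"
    using cl assms(3) w(2) by (simp add: l_distr m_assoc)
  also have "\<dots> = c \<otimes> (x [^] length p \<otimes> x) \<oplus> w \<otimes> x [^] length p \<otimes> (x \<otimes> inv x)"
    using assms cl by simp
  also have "\<dots> = (c \<oplus> w \<otimes> inv x) \<otimes> (x [^] length p \<otimes> x)"
    using cl assms(3) by algebra
  finally have "eval (c # p) x \<otimes> x = (c \<oplus> w \<otimes> inv x) \<otimes> x [^] length (c # p)" by simp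
  moreover have "c \<oplus> w \<otimes> inv x \<in> W" using W(6,7) w assms(5) Cons(2) by auto
  ultimately show ?case by blast
qed

lemma (in ring) eval_in_subring:
  assumes "subring W R" "set p \<subseteq> W" "x \<in> W" shows "eval p x \<in> W"
proof -
  have "x [^] (n::nat) \<in> W" for n
    by (induction n) (use assms(3) subringE(3,6)[OF assms(1)] in auto)
  then show ?thesis using assms(2)
    by (induction p) (use subringE[OF assms(1)] in auto)
qed

text \<open>If \<open>x\<close> is a root of \<open>p\<close> then for every prefix \<open>p1\<close> of \<open>p\<close> (in Horner's scheme) the elements
  \<open>p1(x)\<close> and \<open>x p1(x)\<close> are integral over the coefficients.\<close>

lemma (in field) eval_prefix_mem:
  assumes W: "subring W R" and p: "set (p1 @ p2) \<subseteq> W" and x: "x \<in> carrier R" "x \<noteq> \<zero>"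
    and root: "eval (p1 @ p2) x = \<zero>" and vr: "x \<in> W \<or> inv x \<in> W"
  shows "eval p1 x \<in> W" "x \<otimes> eval p1 x \<in> W"
proof -
  note Ws = subringE[OF W]
  have "eval p1 x \<in> W \<and> x \<otimes> eval p1 x \<in> W"
  proof (cases "x \<in> W")
    case True
    then show ?thesis using eval_in_subring[OF W _ True, of p1] p Ws(6) by auto
  next
    case False
    then have i: "inv x \<in> W" using vr by auto
    obtain w where w: "w \<in> W" "eval p2 x \<otimes> x = w \<otimes> x [^] length p2"
      using eval_inv_integral[OF W _ x i, of p2] p by auto
    let ?n = "length p2"
    have pc: "set p1 \<subseteq> carrier R" "set p2 \<subseteq> carrier R" using p Ws(1) by auto
    have cl: "w \<in> carrier R" "eval p1 x \<in> carrier R" "eval p2 x \<in> carrier R" "x [^] ?n \<in> carrier R"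
      using w Ws(1) x eval_in_carrier pc by auto
    have nz: "x [^] ?n \<noteq> \<zero>" using pow_nonzero[OF x] .
    \<comment> \<open>Since \<open>p2(x) x = w x^n\<close>, the root equation times \<open>x\<close>
      can be divided by \<open>x^n\<close>, which leaves \<open>x p1(x) = - w\<close>.\<close>
    have "(eval p1 x \<otimes> x [^] ?n \<oplus> eval p2 x) \<otimes> x = \<zero>"
      using root eval_append[OF pc x(1)] x by simp
    then have "(eval p1 x \<otimes> x \<oplus> w) \<otimes> x [^] ?n = \<zero>"
    proof -
      have "(eval p1 x \<otimes> x \<oplus> w) \<otimes> x [^] ?n = (eval p1 x \<otimes> x) \<otimes> x [^] ?n \<oplus> eval p2 x \<otimes> x"
        using cl x w(2) by (simp add: l_distr)
      also have "\<dots> = (eval p1 x \<otimes> x [^] ?n \<oplus> eval p2 x) \<otimes> x" using cl x by algebra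
      finally show ?thesis using \<open>(eval p1 x \<otimes> x [^] ?n \<oplus> eval p2 x) \<otimes> x = \<zero>\<close> by simp
    qed
    then have "eval p1 x \<otimes> x \<oplus> w = \<zero>" using nz cl x integral by blast
    then have e: "eval p1 x \<otimes> x = \<ominus> w" using cl x by (simp add: minus_equality)
    then have "eval p1 x \<otimes> x \<in> W" using Ws(5) w by auto
    moreover have "eval p1 x = (eval p1 x \<otimes> x) \<otimes> inv x" using x cl by (simp add: m_assoc)
    ultimately show ?thesis using i Ws(6) x cl by (metis m_comm)
  qed
  then show "eval p1 x \<in> W" "x \<otimes> eval p1 x \<in> W" by auto
qed

text \<open>This is the prefix \<open>[\<one>]\<close> of the monic equation: its companion
  \<open>x \<otimes> eval [\<one>] x\<close> is \<open>x\<close> itself.\<close>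

lemma (in field) integral_mem_valuation_ring:
  assumes W: "subring W R" and p: "set p \<subseteq> W" "p \<noteq> []" "hd p = \<one>" and x: "x \<in> carrier R"
    and root: "eval p x = \<zero>" and vr: "x \<noteq> \<zero> \<Longrightarrow> x \<in> W \<or> inv x \<in> W"
  shows "x \<in> W"
proof (cases "x = \<zero>")
  case True
  then show ?thesis using subringE(2)[OF W] by simp
next
  case False
  have "p = [\<one>] @ tl p" using p by (cases p) auto
  then have "x \<otimes> eval [\<one>] x \<in> W" using eval_prefix_mem(2)[OF W, of "[\<one>]" "tl p" x] p x root vr False by simp
  then show ?thesis using x by simp
qed

context discrete_valuation
begin

section \<open>Arguments modulo the maximal ideal\<close>

lemma F_elem_carr: "x \<in> fball n \<Longrightarrow> x \<in> carrier R"
  unfolding fball_def using F_carr by auto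

lemma fball_mult_W: "x \<in> W \<Longrightarrow> y \<in> fball n \<Longrightarrow> x \<otimes> y \<in> fball n"
  using fball_mult[of x 0 y n] fball_0 by auto

lemma maximal_prime:
  assumes "x \<in> W" "y \<in> W" "x \<otimes> y \<in> fball 1" shows "x \<in> fball 1 \<or> y \<in> fball 1"
proof (rule ccontr)
  assume n: "\<not> ?thesis"
  have "x \<in> F" "y \<in> F" using assms W(2) by auto
  then have nz: "x \<noteq> \<zero>" "y \<noteq> \<zero>" "v x \<le> 0" "v y \<le> 0" using n unfolding fball_def by auto
  then have "v (x \<otimes> y) \<le> 0" "x \<otimes> y \<noteq> \<zero>" using val_mult[of x y] F_mult_nonzero[of x y] \<open>x \<in> F\<close> \<open>y \<in> F\<close> by auto
  then show False using assms(3) unfolding fball_def by auto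
qed

lemma one_notin_maximal: "\<one> \<notin> fball 1"
  unfolding fball_def using val_one by auto

lemma fball_sum_notin:
  assumes "x \<in> fball n" "y \<in> F" "y \<notin> fball n" shows "x \<oplus> y \<notin> fball n" "y \<oplus> x \<notin> fball n"
proof -
  have c: "x \<in> carrier R" "y \<in> carrier R" using assms F_carr F_elem_carr by auto
  have e: "\<ominus> x \<oplus> (x \<oplus> y) = y" using c by (simp add: r_neg1)
  show "x \<oplus> y \<notin> fball n" 
  proof
    assume "x \<oplus> y \<in> fball n"
    from fball_add[OF fball_neg[OF assms(1)] this] show False using e assms by auto
  qed
  then show "y \<oplus> x \<notin> fball n" using c add.m_comm by auto
qed

text \<open>Appending the next coefficient \<open>a\<close> to a prefix changes its value from
  \<open>p1(x)\<close> to \<open>x p1(x) + a\<close>. If all these values and products stayed in the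
  maximal ideal, so would every coefficient. As \<open>x\<close> may have negative value,
  \<open>x p1(x)\<close> has to be tracked along with \<open>p1(x)\<close>.\<close>

lemma exists_prefix_unit:
  assumes p: "set p \<subseteq> W" "\<not> set p \<subseteq> fball 1" and x: "x \<in> F"
  shows "\<exists>p1 p2. p = p1 @ p2 \<and> (eval p1 x \<notin> fball 1 \<or> x \<otimes> eval p1 x \<notin> fball 1)"
proof (rule ccontr)
  assume "\<not> ?thesis"
  then have all: "eval p1 x \<in> fball 1" "x \<otimes> eval p1 x \<in> fball 1" if "p = p1 @ p2" for p1 p2
    using that by blast+
  obtain a where "a \<in> set p" "a \<notin> fball 1" using p(2) by auto
  then obtain p1 p2 where s: "p = p1 @ a # p2" by (meson split_list)
  then have s': "p = (p1 @ [a]) @ p2" by auto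
  have c: "set p1 \<subseteq> carrier R" "a \<in> carrier R" "x \<in> carrier R" using p(1) s W_subring(1) F_carr[OF x] by auto
  have "x \<otimes> eval p1 x \<oplus> a \<notin> fball 1"
    using fball_sum_notin(1)[OF all(2)[OF s], of a] \<open>a \<notin> fball 1\<close> s p(1) W(2) by auto
  moreover have "eval (p1 @ [a]) x = x \<otimes> eval p1 x \<oplus> a"
    using eval_append_aux[OF c] m_comm eval_in_carrier c by simp
  ultimately show False using all(1)[OF s'] by simp
qed

text \<open>The residue ring of an integral extension of a local ring is a field: this is the elementwise
  form of maximality of the contracted ideal.\<close>

lemma integral_invertible_mod:
  assumes B: "subring B R" "B \<subseteq> W" and x: "x \<in> B" "x \<notin> fball 1"
    and p: "set p \<subseteq> B" "p \<noteq> []" "hd p = \<one>" "\<And>c. c \<in> set p \<Longrightarrow> c \<in> fball 1 \<or> inv c \<in> B"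
    and root: "eval p x \<in> fball 1"
  shows "\<exists>y \<in> B. \<one> \<ominus> x \<otimes> y \<in> fball 1"
  using p root
proof (induction p rule: rev_induct)
  case Nil
  then show ?case by auto
next
  case (snoc c p)
  note Bs = subringE[OF B(1)]
  have cl: "x \<in> carrier R" "set p \<subseteq> carrier R" "c \<in> carrier R" "eval p x \<in> carrier R"
    using x snoc(2) Bs(1) eval_in_carrier[of p x] by auto
  have eB: "eval p x \<in> B" using eval_in_subring[OF B(1), of p x] snoc(2) x by auto
  have e: "eval (p @ [c]) x = x \<otimes> eval p x \<oplus> c"
    using eval_append_aux[OF cl(2,3,1)] m_comm cl by simp
  show ?case
  \<comment> \<open>\<open>c\<close> is the constant term. If it lies in the maximal ideal, which is
    prime and avoids \<open>x\<close>, then \<open>p(x)\<close> lies there and the shorter monic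
    \<open>p\<close> takes over. Otherwise \<open>- p(x) / c\<close> inverts \<open>x\<close> modulo
    the ideal.\<close>
  proof (cases "c \<in> fball 1")
    case True
    have "p \<noteq> []" using snoc(4) True one_notin_maximal by auto
    have xe: "x \<otimes> eval p x \<in> W" using x eB B Bs(6) by auto
    have "x \<otimes> eval p x \<in> fball 1"
    proof (rule ccontr)
      assume "x \<otimes> eval p x \<notin> fball 1"
      from fball_sum_notin(2)[OF True _ this] xe W(2) show False using snoc(6) e by auto
    qed
    then have "eval p x \<in> fball 1" using maximal_prime[of x "eval p x"] x B eB by auto
    then show ?thesis using snoc \<open>p \<noteq> []\<close> by auto
  next
    case False
    then have i: "inv c \<in> B" using snoc(5) by auto
    have c0: "c \<noteq> \<zero>" using False F_subring(2) unfolding fball_def by auto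
    let ?y = "\<ominus> (inv c \<otimes> eval p x)"
    have ic: "inv c \<in> carrier R" "inv c \<otimes> c = \<one>" using c0 cl by auto
    have "\<one> \<ominus> x \<otimes> ?y = inv c \<otimes> c \<oplus> inv c \<otimes> (x \<otimes> eval p x)"
      using ic(1) cl unfolding ic(2) by (simp add: minus_eq r_minus m_lcomm)
    also have "\<dots> = inv c \<otimes> eval (p @ [c]) x" unfolding e using ic(1) cl by (simp add: r_distr a_comm)
    also have "\<dots> \<in> fball 1" using fball_mult_W snoc(6) i B by auto
    finally show ?thesis using i eB Bs(5,6) by blast
  qed
qed

lemma combine_fball:
  assumes "set Ks \<subseteq> W" "set Us \<subseteq> fball n" shows "combine Ks Us \<in> fball n"
  using assms
proof (induction Ks Us rule: combine.induct)
  case (1 k Ks u Us)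
  then show ?case using fball_add fball_mult_W by auto
qed (use F_subring(2) in \<open>auto simp: fball_def\<close>)

text \<open>Made for linear independence: terms in the maximal ideal cannot cancel the unit at
  \<open>k\<close>. \<open>combine\<close> stops at the end of the shorter list, hence the bounds of
  \<open>k\<close> by both lengths.\<close>

lemma combine_single_unit:
  assumes "set Ks \<subseteq> W" "set Us \<subseteq> W" "k < length Us" "k < length Ks" "Us ! k \<notin> fball 1" "Ks ! k \<notin> fball 1"
    and "\<And>j. j < length Us \<Longrightarrow> j \<noteq> k \<Longrightarrow> Us ! j \<in> fball 1"
  shows "combine Ks Us \<notin> fball 1"
  using assms
proof (induction Ks Us arbitrary: k rule: combine.induct)
  case (1 a Ks u Us)
  have W1: "a \<otimes> u \<in> W" "combine Ks Us \<in> W"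
    using 1(2,3) W_subring(6) combine_fball[of Ks Us 0] fball_0 by auto
  show ?case
  proof (cases k)
    case 0
    have "Us ! j \<in> fball 1" if "j < length Us" for j using 1(8)[of "Suc j"] that 0 by auto
    then have "combine Ks Us \<in> fball 1" using 1(2) by (intro combine_fball) (auto simp: in_set_conv_nth)
    moreover have "a \<otimes> u \<notin> fball 1" using maximal_prime[of a u] 1(2,3,6,7) 0 by auto
    ultimately show ?thesis using fball_sum_notin(2) W1 W(2) by auto
  next
    case (Suc l)
    have "combine Ks Us \<notin> fball 1"
      using 1(2-7) Suc by (intro 1(1)[of l]) (use 1(8)[of "Suc _"] in auto)
    moreover have "a \<otimes> u \<in> fball 1" using 1(8)[of 0] Suc fball_mult_W[of a u 1] 1(2) by auto
    ultimately show ?thesis using fball_sum_notin(1) W1 W(2) by auto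
  qed
qed auto

end

section \<open>Ramification indices\<close>

text \<open>\<open>w\<close> need not be onto the integers: it will be the restriction of a
  valuation that is normalised on the union of the tower. Modulo the values of \<open>F1\<close> a
  class depends only on \<open>w\<close> modulo \<open>w t\<close>, so there are finitely many;
  without this \<open>card\<close> could be the default 0.\<close>

lemma (in field) ramification_index_props:
  assumes F1: "subfield F1 R" and F2: "subfield F2 R" "F1 \<subseteq> F2" and W: "subring W2 R"
    and Q: "quotient_field R W1 = F1" "quotient_field R W2 = F2"
    and w_mult: "\<And>x y. \<lbrakk>x \<in> F2 - {\<zero>}; y \<in> F2 - {\<zero>}\<rbrakk> \<Longrightarrow> w (x \<otimes> y) = w x + (w y :: int)"
    and w_unit: "\<And>x. x \<in> F2 - {\<zero>} \<Longrightarrow> x \<in> W2 \<and> inv x \<in> W2 \<longleftrightarrow> w x = 0"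
    and t: "t \<in> F1 - {\<zero>}" "w t \<noteq> 0"
  shows "ramification_index R W1 W2 > 0"
    and "ramification_index R W1 W2 = 1 \<longleftrightarrow> (\<forall>x \<in> F2 - {\<zero>}. \<exists>y \<in> F1 - {\<zero>}. w x = w y)"
proof -
  let ?G = "units_of (R\<lparr>carrier := F2\<rparr>)" and ?H = "Units (R\<lparr>carrier := W2\<rparr>)"
  let ?c = "\<lambda>x. ?H #>\<^bsub>?G\<^esub> x" and ?S = "(\<lambda>x. ?H #>\<^bsub>?G\<^esub> x) ` (F1 - {\<zero>})" and ?Q = "?G Mod ?H"
  note Fs = subringE[OF subfieldE(1)[OF F2(1)]] and Ws = subringE[OF W]
    and F1s = subringE[OF subfieldE(1)[OF F1]]
  have WF: "W2 \<subseteq> F2" using subset_quotient_field[OF W] Q by auto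
  have uF: "Units (R\<lparr>carrier := F2\<rparr>) = F2 - {\<zero>}" using subfield.subfield_Units[OF F2(1)] .
  have cG: "carrier ?G = F2 - {\<zero>}" using uF by (simp add: units_of_def)
  have mG: "x \<otimes>\<^bsub>?G\<^esub> y = x \<otimes> y" for x y by (simp add: units_of_def)
  have oG: "\<one>\<^bsub>?G\<^esub> = \<one>" by (simp add: units_of_def)
  interpret FF: field "R\<lparr>carrier := F2\<rparr>" using subfield_iff(2)[OF F2(1)] .
  interpret G: comm_group ?G by (rule FF.units_comm_group)
  have invG: "inv\<^bsub>?G\<^esub> x = inv x" if "x \<in> F2 - {\<zero>}" for x
    by (rule G.inv_equality) (use that cG mG oG Fs(1) subfield_m_inv[OF F2(1) that] in \<open>auto simp: subset_iff\<close>)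
  have H: "?H = {x \<in> F2 - {\<zero>}. w x = 0}" 
    using Units_subring[OF W] WF w_unit by auto
  have w_one: "w \<one> = 0" using w_mult[of \<one> \<one>] Fs by auto
  have w_inv: "w (inv x) = - w x" if "x \<in> F2 - {\<zero>}" for x
    using w_mult[of x "inv x"] that subfield_m_inv[OF F2(1) that] w_one by auto
  have Fm: "x \<otimes> y \<in> F2 - {\<zero>}" if "x \<in> F2 - {\<zero>}" "y \<in> F2 - {\<zero>}" for x y
    using that Fs(6) Fs(1) integral[of x y] by (auto simp: subset_iff)
  have F1m: "x \<otimes> y \<in> F1 - {\<zero>}" if "x \<in> F1 - {\<zero>}" "y \<in> F1 - {\<zero>}" for x y
    using that F1s(6) F1s(1) integral[of x y] by (auto simp: subset_iff)
  have Fi: "inv x \<in> F2 - {\<zero>}" if "x \<in> F2 - {\<zero>}" for x using subfield_m_inv[OF F2(1) that] by auto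
  have sub: "subgroup ?H ?G"
  proof (rule G.subgroupI)
    show "?H \<subseteq> carrier ?G" using H cG by auto
    have "\<one> \<in> ?H" using H Fs(3) w_one by auto
    then show "?H \<noteq> {}" by blast
    show "inv\<^bsub>?G\<^esub> a \<in> ?H" if a: "a \<in> ?H" for a
      using a invG[of a] Fi[of a] w_inv[of a] unfolding H by auto
    show "a \<otimes>\<^bsub>?G\<^esub> b \<in> ?H" if ab: "a \<in> ?H" "b \<in> ?H" for a b
      using ab Fm[of a b] w_mult[of a b] unfolding mG H by auto
  qed
  have N: "?H \<lhd> ?G" using sub G.normal_iff_subgroup by auto
  interpret N: normal ?H ?G by (rule N)
  interpret Q: group ?Q by (rule N.factorgroup_is_group)
  have cQ: "carrier ?Q = ?c ` (F2 - {\<zero>})" unfolding carrier_FactGroup cG by simp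
  have c_mult: "?c x \<otimes>\<^bsub>?Q\<^esub> ?c y = ?c (x \<otimes> y)" if "x \<in> F2 - {\<zero>}" "y \<in> F2 - {\<zero>}" for x y
    using N.rcos_sum[of x y] that unfolding cG mG by simp
  have c_eq: "?c x = ?c y \<longleftrightarrow> w x = w y" if x: "x \<in> F2 - {\<zero>}" and y: "y \<in> F2 - {\<zero>}" for x y
  proof
    assume "?c x = ?c y"
    then have "x \<in> ?c y" using G.rcos_self[of x ?H] x sub cG by auto
    then obtain h where "h \<in> ?H" "x = h \<otimes> y" unfolding r_coset_def mG by auto
    then show "w x = w y" using H w_mult[of h y] y by auto
  next
    assume e: "w x = w y"
    have "x \<otimes> inv y \<in> ?H" unfolding H using Fm[OF x Fi[OF y]] w_mult[OF x Fi[OF y]] w_inv[OF y] e by auto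
    moreover have "x = (x \<otimes> inv y) \<otimes> y" using x y Fs(1) by (auto simp: m_assoc subset_iff)
    ultimately have "x \<in> ?c y" unfolding r_coset_def mG by blast
    then show "?c x = ?c y" using G.repr_independence[of x ?H y] y sub cG by auto
  qed
  have S: "subgroup ?S ?Q"
  proof (rule Q.subgroupI)
    show "?S \<subseteq> carrier ?Q" unfolding cQ using F2 by auto
    show "?S \<noteq> {}" using t by auto
    show "inv\<^bsub>?Q\<^esub> a \<in> ?S" if a: "a \<in> ?S" for a
    proof -
      obtain x where x: "x \<in> F1 - {\<zero>}" "a = ?c x" using a by auto
      have xi: "inv x \<in> F1 - {\<zero>}" "x \<otimes> inv x = \<one>" "inv x \<otimes> x = \<one>" using subfield_m_inv[OF F1 x(1)] by auto
      have in2: "x \<in> F2 - {\<zero>}" "inv x \<in> F2 - {\<zero>}" using xi x F2 by auto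
      have "?c (inv x) \<otimes>\<^bsub>?Q\<^esub> a = \<one>\<^bsub>?Q\<^esub>"
        unfolding x(2) c_mult[OF in2(2,1)] xi(3) one_FactGroup
        using G.coset_mult_one[OF subgroup.subset[OF sub]] unfolding oG .
      then have "inv\<^bsub>?Q\<^esub> a = ?c (inv x)"
        using Q.inv_equality[of "?c (inv x)" a] in2 x unfolding cQ by auto
      then show ?thesis using xi by auto
    qed
    show "a \<otimes>\<^bsub>?Q\<^esub> b \<in> ?S" if ab: "a \<in> ?S" "b \<in> ?S" for a b
    proof -
      obtain x y where xy: "x \<in> F1 - {\<zero>}" "a = ?c x" "y \<in> F1 - {\<zero>}" "b = ?c y" using ab by auto
      then show ?thesis using c_mult[of x y] F1m[of x y] F2 by auto
    qed
  qed
  \<comment> \<open>The class of the value of \<open>x\<close> modulo the values of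
    \<open>F1\<close>; the index counts these classes.\<close>
  define f where "f x = ?S #>\<^bsub>?Q\<^esub> (?c x)" for x
  have cos: "rcosets\<^bsub>?Q\<^esub> ?S = f ` (F2 - {\<zero>})" unfolding RCOSETS_def cQ f_def by auto
  have idx: "ramification_index R W1 W2 = card (f ` (F2 - {\<zero>}))"
    unfolding ramification_index_def value_group_def Q cos[symmetric] ..
  have f_eqI: "f x = f y" if x: "x \<in> F2 - {\<zero>}" and y: "y \<in> F2 - {\<zero>}" and z: "z \<in> F1 - {\<zero>}" "w x = w z + w y" for x y z
  proof -
    have z2: "z \<in> F2 - {\<zero>}" using z F2 by auto
    have "?c x = ?c (z \<otimes> y)" using c_eq[OF x Fm[OF z2 y]] w_mult[OF z2 y] z by simp
    also have "\<dots> = ?c z \<otimes>\<^bsub>?Q\<^esub> ?c y" using c_mult[OF z2 y] by simp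
    finally have "?c x \<in> ?S #>\<^bsub>?Q\<^esub> ?c y" unfolding r_coset_def using z by auto
    then show ?thesis unfolding f_def using Q.repr_independence[OF _ _ S] y cQ by blast
  qed
  have f_eqD: "\<exists>z \<in> F1 - {\<zero>}. w x = w z" if x: "x \<in> F2 - {\<zero>}" and e: "f x = f \<one>" for x
  proof -
    have o: "\<one> \<in> F2 - {\<zero>}" using Fs by auto
    have "?c x \<in> f \<one>" using e Q.rcos_self[OF _ S, of "?c x"] x cQ unfolding f_def by auto
    moreover have "f \<one> = ?S" unfolding f_def
      using Q.coset_join2[OF _ S, of "?c \<one>"] cQ o F1s(3) by blast
    ultimately obtain z where "z \<in> F1 - {\<zero>}" "?c x = ?c z" by auto
    then show ?thesis using c_eq[of x z] x F2 by auto
  qed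
  have t2: "t \<in> F2 - {\<zero>}" using t F2 by auto
  have mult: "\<exists>z \<in> F1 - {\<zero>}. w z = k * w t" for k :: int
  proof (induction k rule: int_induct[where k=0])
    case base
    then show ?case using w_one F1s(3) by (auto intro!: bexI[of _ \<one>])
  next
    case (step1 i)
    then obtain z where "z \<in> F1 - {\<zero>}" "w z = i * w t" by auto
    then show ?case using F1m[of z t] t F2 w_mult[of z t] by (intro bexI[of _ "z \<otimes> t"]) (auto simp: algebra_simps)
  next
    case (step2 i)
    then obtain z where z: "z \<in> F1 - {\<zero>}" "w z = i * w t" by auto
    have "inv t \<in> F1 - {\<zero>}" using subfield_m_inv[OF F1 t(1)] by auto
    then show ?case using z F1m[of z "inv t"] t F2 w_mult[of z "inv t"] w_inv[OF t2]
      by (intro bexI[of _ "z \<otimes> inv t"]) (auto simp: algebra_simps)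
  qed
  \<comment> \<open>One representative per residue is enough: values congruent modulo
    \<open>w t\<close> differ by a value of \<open>F1\<close>.\<close>
  define g where "g n = f (SOME x. x \<in> F2 - {\<zero>} \<and> w x mod \<bar>w t\<bar> = n)" for n
  have "f x = g (w x mod \<bar>w t\<bar>)" if x: "x \<in> F2 - {\<zero>}" for x
  proof -
    let ?y = "SOME y. y \<in> F2 - {\<zero>} \<and> w y mod \<bar>w t\<bar> = w x mod \<bar>w t\<bar>"
    have y: "?y \<in> F2 - {\<zero>} \<and> w ?y mod \<bar>w t\<bar> = w x mod \<bar>w t\<bar>"
      by (rule someI[of _ x]) (use x in auto)
    then have "w t dvd (w x - w ?y)" by (metis mod_eq_dvd_iff abs_dvd_iff)
    then obtain k where "w x - w ?y = k * w t" by (metis dvdE mult.commute)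
    then obtain z where "z \<in> F1 - {\<zero>}" "w x = w z + w ?y" using mult[of k] by force
    then show ?thesis unfolding g_def using f_eqI[OF x _ ] y by blast
  qed
  then have "f ` (F2 - {\<zero>}) \<subseteq> g ` {0..<\<bar>w t\<bar>}" using t(2) by (auto intro!: imageI)
  then have fin: "finite (f ` (F2 - {\<zero>}))" by (rule finite_subset) auto
  have o: "f \<one> \<in> f ` (F2 - {\<zero>})" using Fs by auto
  then show "ramification_index R W1 W2 > 0" unfolding idx using fin by (auto simp: card_gt_0_iff)
  show "ramification_index R W1 W2 = 1 \<longleftrightarrow> (\<forall>x \<in> F2 - {\<zero>}. \<exists>y \<in> F1 - {\<zero>}. w x = w y)"
  proof
    assume "ramification_index R W1 W2 = 1"
    then have "f x = f \<one>" if "x \<in> F2 - {\<zero>}" for x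
      unfolding idx using that o by (metis card_1_singletonE imageI singletonD)
    then show "\<forall>x \<in> F2 - {\<zero>}. \<exists>y \<in> F1 - {\<zero>}. w x = w y" using f_eqD by blast
  next
    assume a: "\<forall>x \<in> F2 - {\<zero>}. \<exists>y \<in> F1 - {\<zero>}. w x = w y"
    have "f x = f \<one>" if x: "x \<in> F2 - {\<zero>}" for x
    proof -
      obtain y where "y \<in> F1 - {\<zero>}" "w x = w y" using a x by blast
      then show ?thesis using f_eqI[OF x, of \<one> y] Fs w_one by auto
    qed
    then have "f ` (F2 - {\<zero>}) = {f \<one>}" using o by auto
    then show "ramification_index R W1 W2 = 1" unfolding idx by simp
  qed
qed

section \<open>Localizations of the integral closure\<close>

lemma (in ring) exists_maximal_ideal:
  assumes I: "ideal I R" "\<one> \<notin> I"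
  shows "\<exists>M. maximalideal M R \<and> I \<subseteq> M"
proof -
  let ?C = "{J. ideal J R \<and> I \<subseteq> J \<and> \<one> \<notin> J}"
  have "\<exists>M \<in> ?C . \<forall>J \<in> ?C . M \<subseteq> J \<longrightarrow> J = M"
  proof (rule subset_Zorn_nonempty)
    show "?C \<noteq> {}" using I by auto
    fix c assume c: "c \<noteq> {}" "subset.chain ?C c"
    have id: "ideal J R" "I \<subseteq> J" "\<one> \<notin> J" if "J \<in> c" for J using c that unfolding subset.chain_def by auto
    have sg: "\<zero> \<in> J" "\<And>a. a \<in> J \<Longrightarrow> \<ominus> a \<in> J" "\<And>a b. a \<in> J \<Longrightarrow> b \<in> J \<Longrightarrow> a \<oplus> b \<in> J"
      "\<And>a x. a \<in> J \<Longrightarrow> x \<in> carrier R \<Longrightarrow> x \<otimes> a \<in> J" "\<And>a x. a \<in> J \<Longrightarrow> x \<in> carrier R \<Longrightarrow> a \<otimes> x \<in> J"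
      if "J \<in> c" for J
    proof -
      interpret J: ideal J R by (rule id(1)[OF that])
      show "\<zero> \<in> J" "\<And>a. a \<in> J \<Longrightarrow> \<ominus> a \<in> J" "\<And>a b. a \<in> J \<Longrightarrow> b \<in> J \<Longrightarrow> a \<oplus> b \<in> J"
        "\<And>a x. a \<in> J \<Longrightarrow> x \<in> carrier R \<Longrightarrow> x \<otimes> a \<in> J" "\<And>a x. a \<in> J \<Longrightarrow> x \<in> carrier R \<Longrightarrow> a \<otimes> x \<in> J"
        by (auto simp: J.I_l_closed J.I_r_closed)
    qed
    have tot: "J \<subseteq> J' \<or> J' \<subseteq> J" if "J \<in> c" "J' \<in> c" for J J' using c that unfolding subset.chain_def by auto
    have "ideal (\<Union>c) R"
    proof (rule idealI[OF ring_axioms])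
      show "subgroup (\<Union>c) (add_monoid R)"
      proof (rule add.subgroupI)
        show "\<Union>c \<subseteq> carrier R" using id(1) ideal.Icarr by fastforce
        show "\<Union>c \<noteq> {}" using c(1) sg(1) by blast
        show "\<ominus> a \<in> \<Union>c" if "a \<in> \<Union>c" for a
          using that sg(2) by auto
        show "a \<oplus> b \<in> \<Union>c" if ab: "a \<in> \<Union>c" "b \<in> \<Union>c" for a b
        proof -
          obtain J J' where J: "J \<in> c" "a \<in> J" "J' \<in> c" "b \<in> J'" using ab by auto
          then obtain J'' where "J'' \<in> c" "a \<in> J''" "b \<in> J''" using tot by blast
          then show ?thesis using sg(3) by auto
        qed
      qed
      show "x \<otimes> a \<in> \<Union>c" if "a \<in> \<Union>c" "x \<in> carrier R" for a x
        using that sg(4) by auto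
      show "a \<otimes> x \<in> \<Union>c" if "a \<in> \<Union>c" "x \<in> carrier R" for a x
        using that sg(5) by auto
    qed
    moreover have "I \<subseteq> \<Union>c" using id(2) c(1) by blast
    ultimately show "\<Union>c \<in> ?C" using id(3) by auto
  qed
  then obtain M where "M \<in> ?C" and mx: "\<forall>J \<in> ?C . M \<subseteq> J \<longrightarrow> J = M" ..
  then have M: "ideal M R" "I \<subseteq> M" "\<one> \<notin> M" by auto
  have M4: "J = M" if "ideal J R" "M \<subseteq> J" "\<one> \<notin> J" for J
    using mx that M(2) by auto
  have "maximalideal M R"
  proof (rule maximalidealI[OF M(1)])
    show "carrier R \<noteq> M" using M(3) by auto
    fix J assume J: "ideal J R" "M \<subseteq> J" "J \<subseteq> carrier R"
    then show "J = M \<or> J = carrier R" using M4[OF J(1,2)] ideal.one_imp_carrier by blast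
  qed
  then show ?thesis using M by auto
qed

section \<open>Weights of infinite paths\<close>

lemma path_weight_ge_1: "path_weight S \<pi> \<ge> 1"
proof -
  have "enat (\<Prod>i<0. weight S (\<pi> i) (\<pi> (Suc i))) \<le> path_weight S \<pi>"
    unfolding path_weight_def by (rule SUP_upper) auto
  then show ?thesis by (simp add: one_enat_def)
qed

lemma path_weight_1_iff:
  assumes pos: "\<And>i. weight S (\<pi> i) (\<pi> (Suc i)) > 0"
  shows "path_weight S \<pi> = 1 \<longleftrightarrow> (\<forall>i. weight S (\<pi> i) (\<pi> (Suc i)) = 1)"
proof
  let ?w = "\<lambda>i. weight S (\<pi> i) (\<pi> (Suc i))"
  assume one: "path_weight S \<pi> = 1"
  have le: "(\<Prod>i<n. ?w i) \<le> 1" for n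
  proof -
    have "enat (\<Prod>i<n. ?w i) \<le> path_weight S \<pi>" unfolding path_weight_def by (rule SUP_upper) auto
    then show ?thesis using one by (simp add: one_enat_def)
  qed
  show "\<forall>i. ?w i = 1"
  proof
    fix i
    have "(\<Prod>j<i. ?w j) \<ge> 1" using pos by (intro prod_ge_1) (simp add: Suc_leI)
    from mult_le_mono1[OF this, of "?w i"] have "?w i \<le> (\<Prod>j<i. ?w j) * ?w i" by simp
    moreover have "(\<Prod>j<i. ?w j) * ?w i \<le> 1" using le[of "Suc i"] by simp
    ultimately show "?w i = 1" using pos[of i] by linarith
  qed
next
  assume "\<forall>i. weight S (\<pi> i) (\<pi> (Suc i)) = 1"
  then show "path_weight S \<pi> = 1" unfolding path_weight_def by (simp add: one_enat_def)
qed

locale ramified_tower = field R for R (structure) +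
  fixes V A :: "'a set" and K :: "nat \<Rightarrow> 'a set"
  assumes K: "\<And>i. subfield (K i) R"
    and K_strict: "\<And>i. K i \<subset> K (Suc i)"
    and K_finite: "\<And>i. finite_dimension (K i) (K (Suc i))"
    and V_dvr: "discrete_valuation_ring R V" and V_quot: "quotient_field R V = K 0"
    and A_def: "A = integral_closure R V (\<Union>i. K i)"
    and A_almost_dedekind: "almost_dedekind R A"
begin

section \<open>The union of the tower and the integral closure in it\<close>

definition Kinf :: "'a set" where "Kinf = (\<Union>i. K i)"

abbreviation RA where "RA \<equiv> R\<lparr>carrier := A\<rparr>"

definition MaxA :: "'a set set" where "MaxA = Max_ideals RA"

definition loc :: "'a set \<Rightarrow> 'a set" where "loc M = localization R A M"

definition val :: "'a set \<Rightarrow> 'a \<Rightarrow> int" where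
  "val M = (SOME v. discrete_valuation R Kinf (loc M) v)"

text \<open>Makes \<open>fball\<close> available outside its locale, so that balls of several
  maximal ideals can be compared; \<open>vball_fball\<close> translates inside
  interpretations.\<close>

definition vball :: "'a set \<Rightarrow> int \<Rightarrow> 'a set" where
  "vball M n = {x \<in> Kinf. x = \<zero> \<or> n \<le> val M x}"

lemmas Ks = subringE[OF subfieldE(1)[OF K]]

lemma K_mono: "i \<le> j \<Longrightarrow> K i \<subseteq> K j"
  using K_strict lift_Suc_mono_le[of K] by blast

lemma K_strict_mono: "i < j \<Longrightarrow> K i \<subset> K j"
  using K_strict lift_Suc_mono_less[of K] by blast

lemma K_inj: "K i = K j \<Longrightarrow> i = j"
  using K_strict_mono by (metis linorder_neqE_nat less_irrefl)

lemma K_inv: "x \<in> K i \<Longrightarrow> x \<noteq> \<zero> \<Longrightarrow> inv x \<in> K i"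
  using subfield_m_inv(1)[OF K] by auto

lemma Kinf_finite_subset: "finite S \<Longrightarrow> S \<subseteq> Kinf \<Longrightarrow> \<exists>i. S \<subseteq> K i"
proof (induction S rule: finite_induct)
  case (insert x S)
  then obtain i j where "S \<subseteq> K i" "x \<in> K j" unfolding Kinf_def by auto
  then have "insert x S \<subseteq> K (max i j)" using K_mono[of i "max i j"] K_mono[of j "max i j"] by auto
  then show ?case by blast
qed auto

lemma Kinf_pair: assumes "x \<in> Kinf" "y \<in> Kinf" shows "\<exists>i. x \<in> K i \<and> y \<in> K i"
  using Kinf_finite_subset[of "{x, y}"] assms by auto

lemma K_Kinf: "K i \<subseteq> Kinf"
  unfolding Kinf_def by auto

lemma Kinf: "subfield Kinf R"
proof (rule subfieldI')
  show "subring Kinf R"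
  proof (rule subringI)
    show "Kinf \<subseteq> carrier R" unfolding Kinf_def using Ks(1) by auto
    show "\<one> \<in> Kinf" unfolding Kinf_def using Ks(3) by auto
    show "\<ominus> h \<in> Kinf" if "h \<in> Kinf" for h using that Ks(5) unfolding Kinf_def by auto
    show "x \<otimes> y \<in> Kinf" "x \<oplus> y \<in> Kinf" if xy: "x \<in> Kinf" "y \<in> Kinf" for x y
      using Kinf_pair[OF xy] Ks(6,7)[of x _ y] unfolding Kinf_def by blast+
  qed
  show "inv k \<in> Kinf" if "k \<in> Kinf - {\<zero>}" for k using that K_inv unfolding Kinf_def by auto
qed

lemmas Kinfs = subringE[OF subfieldE(1)[OF Kinf]]

lemma Kinf_inv: "x \<in> Kinf \<Longrightarrow> x \<noteq> \<zero> \<Longrightarrow> inv x \<in> Kinf"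
  using subfield_m_inv(1)[OF Kinf] by auto

lemma K_carr: "x \<in> K i \<Longrightarrow> x \<in> carrier R" using Ks(1) by auto
lemma Kinf_carr: "x \<in> Kinf \<Longrightarrow> x \<in> carrier R" using Kinfs(1) by auto

lemma K0_finite: "finite_dimension (K 0) (K i)"
proof (induction i)
  case 0
  show ?case using dimension_one[OF K] finite_dimensionI by blast
next
  case (Suc i)
  then show ?case using telescopic_base_dim(1)[OF K K _ K_finite] by blast
qed

lemma monic_root:
  assumes "z \<in> Kinf"
  shows "\<exists>p. p \<noteq> [] \<and> set p \<subseteq> K 0 \<and> hd p = \<one> \<and> eval p z = \<zero>"
proof -
  obtain i where z: "z \<in> K i" using assms unfolding Kinf_def by auto
  have alg: "(algebraic over (K 0)) z"
    using finite_dimension_imp_algebraic[OF K subfieldE(1)[OF K] K0_finite z] .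
  have zc: "z \<in> carrier R" using z K_carr by auto
  let ?p = "Irr (K 0) z"
  note I = IrrE[OF K zc alg]
  have ne: "?p \<noteq> []" using I(2) by (auto simp: ring_irreducible_def univ_poly_zero)
  then have "set ?p \<subseteq> K 0" using I(1) unfolding univ_poly_carrier[symmetric] polynomial_def by auto
  then show ?thesis using ne I(3,4) by blast
qed

lemma V_subring: "subring V R"
  using V_dvr unfolding discrete_valuation_ring_def valuation_ring_def by auto

lemmas Vs = subringE[OF V_subring]

lemma V_K0: "V \<subseteq> K 0"
  using subset_quotient_field[OF V_subring] V_quot by simp

definition vV :: "'a \<Rightarrow> int" where "vV = (SOME v. discrete_valuation R (K 0) V v)"

lemma V_valuation: "discrete_valuation R (K 0) V vV"
proof -
  obtain v where "discrete_valuation R (K 0) V v" by (rule dvr_valuation[OF K V_dvr V_quot])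
  then show ?thesis unfolding vV_def by (rule someI[where P = "discrete_valuation R (K 0) V"])
qed

lemma A_Kinf: "A \<subseteq> Kinf"
  unfolding A_def integral_closure_def Kinf_def by auto

lemma A_subring: "subring A R"
  using A_almost_dedekind unfolding almost_dedekind_def by auto

lemmas As = subringE[OF A_subring]

lemma A_carr: "x \<in> A \<Longrightarrow> x \<in> carrier R" using As(1) by auto

lemma A_I: "z \<in> Kinf \<Longrightarrow> p \<noteq> [] \<Longrightarrow> set p \<subseteq> V \<Longrightarrow> hd p = \<one> \<Longrightarrow> eval p z = \<zero> \<Longrightarrow> z \<in> A"
  unfolding A_def integral_closure_def Kinf_def by auto

lemma A_E: assumes "z \<in> A" shows "\<exists>p. p \<noteq> [] \<and> set p \<subseteq> V \<and> hd p = \<one> \<and> eval p z = \<zero>"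
  using assms unfolding A_def integral_closure_def by auto

lemma V_A: "V \<subseteq> A"
proof
  fix x assume x: "x \<in> V"
  then have "x \<in> carrier R" using Vs by auto
  then have "eval [\<one>, \<ominus> x] x = \<zero>" by (simp add: r_neg)
  then show "x \<in> A" using A_I[of x "[\<one>, \<ominus> x]"] x Vs(3,5) V_K0 K_Kinf by auto
qed

text \<open>Multiplying \<open>z\<close> by a common denominator of a monic equation over
  \<open>K 0\<close> makes it integral over \<open>V\<close>, so \<open>z\<close> is a fraction with
  denominator in \<open>V\<close>.\<close>

lemma quotient_field_A: "quotient_field R A = Kinf"
proof
  show "quotient_field R A \<subseteq> Kinf" by (rule quotient_field_subset[OF Kinf A_Kinf])
  show "Kinf \<subseteq> quotient_field R A"
  proof
    fix z assume z: "z \<in> Kinf"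
    obtain p where p: "p \<noteq> []" "set p \<subseteq> K 0" "hd p = \<one>" "eval p z = \<zero>" using monic_root[OF z] by blast
    have "\<exists>d \<in> V - {\<zero>}. \<forall>c \<in> set p. c \<otimes> d \<in> V"
      by (rule common_denominator[OF V_subring]) (use p V_quot Vs(1) in auto)
    then obtain d where d: "d \<in> V" "d \<noteq> \<zero>" "\<And>c. c \<in> set p \<Longrightarrow> c \<otimes> d \<in> V" by auto
    have cl: "z \<in> carrier R" "d \<in> carrier R" "set p \<subseteq> carrier R" using z Kinf_carr d Vs(1) p K_carr by auto
    let ?q = "scale_poly d \<one> p"
    obtain r where r: "p = \<one> # r" using p by (cases p) auto
    have "set ?q \<subseteq> V" unfolding r
      using set_scale_poly[OF V_subring d(1,3), of r \<one>] r cl(3) Vs(3) cl by auto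
    moreover have "?q \<noteq> []" "hd ?q = \<one>" unfolding r by auto
    moreover have "eval ?q (d \<otimes> z) \<otimes> d = \<zero>" and qc: "set ?q \<subseteq> carrier R"
      using eval_scale_poly[OF cl(3,2) one_closed cl(1)] p(4) cl by auto
    then have "eval ?q (d \<otimes> z) = \<zero>" using d(2) cl eval_in_carrier[OF qc, of "d \<otimes> z"] integral by auto
    moreover have "d \<otimes> z \<in> Kinf" using d V_K0 K_Kinf z Kinfs(6) by blast
    ultimately have "d \<otimes> z \<in> A" using A_I by blast
    moreover have "z = (d \<otimes> z) \<otimes> inv d" using cl d(2) by (simp add: m_comm[of d z] m_assoc)
    ultimately show "z \<in> quotient_field R A" unfolding quotient_field_def using d V_A by blast
  qed
qed

lemma RA_domain: "domain RA"
  using subring_is_domain[OF A_subring] .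

text \<open>Collects the rules of a maximal ideal in terms of the operations of the ambient field.
  The last one is invertibility in the residue field: \<open>M\<close> and \<open>x\<close> together
  generate the unit ideal.\<close>

lemma MaxA_props:
  assumes "M \<in> MaxA"
  shows "ideal M RA" "M \<subseteq> A" "\<one> \<notin> M" "\<zero> \<in> M"
    and "\<And>x y. x \<in> M \<Longrightarrow> y \<in> M \<Longrightarrow> x \<oplus> y \<in> M"
    and "\<And>x y. x \<in> A \<Longrightarrow> y \<in> M \<Longrightarrow> x \<otimes> y \<in> M"
    and "\<And>x y. x \<in> A \<Longrightarrow> y \<in> A \<Longrightarrow> x \<otimes> y \<in> M \<Longrightarrow> x \<in> M \<or> y \<in> M"
    and "\<And>x. x \<in> A \<Longrightarrow> x \<notin> M \<Longrightarrow> \<exists>y \<in> A. \<one> \<ominus> x \<otimes> y \<in> M"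
proof -
  interpret D: domain RA by (rule RA_domain)
  have mx: "maximalideal M RA" using assms unfolding MaxA_def Max_ideals_def by auto
  then interpret M: maximalideal M RA .
  interpret M: primeideal M RA using D.maximalideal_prime[OF mx] .
  show id: "ideal M RA" by (rule M.ideal_axioms)
  show sub: "M \<subseteq> A" using M.Icarr by auto
  show one: "\<one> \<notin> M" using M.one_imp_carrier M.I_notcarr by auto
  show "\<zero> \<in> M" using M.zero_closed by simp
  show add: "x \<oplus> y \<in> M" if "x \<in> M" "y \<in> M" for x y using M.a_closed that by simp
  show mul: "x \<otimes> y \<in> M" if "x \<in> A" "y \<in> M" for x y using M.I_l_closed[of y x] that by simp
  show "x \<in> M \<or> y \<in> M" if "x \<in> A" "y \<in> A" "x \<otimes> y \<in> M" for x y using M.I_prime[of x y] that by simp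
  show "\<exists>y \<in> A. \<one> \<ominus> x \<otimes> y \<in> M" if x: "x \<in> A" "x \<notin> M" for x
  proof -
    let ?J = "M <+>\<^bsub>RA\<^esub> (PIdl\<^bsub>RA\<^esub> x)"
    have J: "ideal ?J RA" using D.add_ideals[OF id D.cgenideal_ideal[of x]] x by auto
    have "M \<subseteq> ?J"
    proof
      fix m assume m: "m \<in> M"
      have "\<zero>\<^bsub>RA\<^esub> \<in> PIdl\<^bsub>RA\<^esub> x" using ideal.axioms(1)[OF D.cgenideal_ideal[of x]] additive_subgroup.zero_closed x by fastforce
      moreover have "m = m \<oplus>\<^bsub>RA\<^esub> \<zero>\<^bsub>RA\<^esub>" using m sub A_carr by auto
      ultimately show "m \<in> ?J" unfolding set_add_def set_mult_def using m by force
    qed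
    moreover have "x \<in> ?J"
    proof -
      have "x \<in> PIdl\<^bsub>RA\<^esub> x" using D.cgenideal_self[of x] x by auto
      moreover have "x = \<zero> \<oplus>\<^bsub>RA\<^esub> x" using x A_carr by auto
      ultimately show "x \<in> ?J" unfolding set_add_def set_mult_def using \<open>\<zero> \<in> M\<close> by force
    qed
    moreover have "?J \<subseteq> carrier RA" using ideal.Icarr[OF J] by auto
    ultimately have "?J = carrier RA" using M.I_maximal[OF J] x by blast
    then have "\<one> \<in> ?J" using As(3) by auto
    then obtain m y where my: "m \<in> M" "y \<in> A" "\<one> = m \<oplus> y \<otimes> x"
      unfolding set_add_def set_mult_def cgenideal_def by auto
    then have c: "m \<in> carrier R" "y \<in> carrier R" "x \<in> carrier R" using x sub A_carr by auto
    have "\<one> \<ominus> x \<otimes> y = m" unfolding my(3) using c by (simp add: minus_eq m_comm[of x y] a_assoc r_neg)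
    then show ?thesis using my(1,2) by (intro bexI[of _ y]) simp_all
  qed
qed

lemma A_loc: assumes "M \<in> MaxA" shows "A \<subseteq> loc M"
proof
  fix x assume x: "x \<in> A"
  have "\<one> \<in> A - M" "x = x \<otimes> inv \<one>" using MaxA_props(3)[OF assms] As(3) x A_carr by auto
  then show "x \<in> loc M" unfolding loc_def localization_def using x by blast
qed

lemma loc_Kinf: assumes "M \<in> MaxA" shows "loc M \<subseteq> Kinf"
  using quotient_field_A MaxA_props(4)[OF assms] unfolding loc_def localization_def quotient_field_def by auto

lemma locE: assumes "M \<in> MaxA" "x \<in> loc M"
  obtains c d where "c \<in> A" "d \<in> A" "d \<notin> M" "d \<noteq> \<zero>" "x = c \<otimes> inv d" "x \<otimes> d = c"
proof -
  obtain c d where cd: "c \<in> A" "d \<in> A" "d \<notin> M" "x = c \<otimes> inv d"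
    using assms(2) unfolding loc_def localization_def by auto
  moreover have "d \<noteq> \<zero>" using cd MaxA_props(4)[OF assms(1)] by auto
  moreover have "x \<otimes> d = c" using cd \<open>d \<noteq> \<zero>\<close> A_carr by (simp add: m_assoc)
  ultimately show ?thesis using that by blast
qed

lemma loc_valuation: assumes "M \<in> MaxA" shows "discrete_valuation R Kinf (loc M) (val M)"
proof -
  have dvr: "discrete_valuation_ring R (loc M)"
    using A_almost_dedekind assms unfolding almost_dedekind_def MaxA_def loc_def by auto
  then have sr: "subring (loc M) R" unfolding discrete_valuation_ring_def valuation_ring_def by auto
  have Q: "quotient_field R (loc M) = Kinf"
  proof
    show "quotient_field R (loc M) \<subseteq> Kinf" by (rule quotient_field_subset[OF Kinf loc_Kinf[OF assms]])
    show "Kinf \<subseteq> quotient_field R (loc M)" 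
      using quotient_field_A A_loc[OF assms] unfolding quotient_field_def by blast
  qed
  obtain v where "discrete_valuation R Kinf (loc M) v" by (rule dvr_valuation[OF Kinf dvr Q])
  then show ?thesis unfolding val_def by (rule someI[where P = "discrete_valuation R Kinf (loc M)"])
qed

lemma vball_fball: assumes "M \<in> MaxA" shows "discrete_valuation.fball R Kinf (val M) = vball M"
  using discrete_valuation.fball_def[OF loc_valuation[OF assms]] unfolding vball_def by (intro ext) auto

text \<open>If \<open>x\<close> in \<open>M\<close> had value 0, its inverse would be
  \<open>c / d\<close> with \<open>d\<close> outside \<open>M\<close>, yet \<open>d = c x\<close>.
  Conversely an element outside \<open>M\<close> is an admissible denominator, so its inverse has
  nonnegative value.\<close>

lemma mem_M_iff: assumes M: "M \<in> MaxA" and x: "x \<in> A" shows "x \<in> M \<longleftrightarrow> x \<in> vball M 1"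
proof -
  interpret D: discrete_valuation R Kinf "loc M" "val M" by (rule loc_valuation[OF M])
  have xK: "x \<in> Kinf" "x \<in> loc M" "x \<in> carrier R" using x A_Kinf A_loc[OF M] A_carr by auto
  show ?thesis
  proof
    assume xM: "x \<in> M"
    show "x \<in> vball M 1"
    proof (rule ccontr)
      assume "x \<notin> vball M 1"
      then have nz: "x \<noteq> \<zero>" "val M x \<le> 0" using xK unfolding vball_def by auto
      then have "val M x = 0" using D.mem_iff xK by auto
      then have "inv x \<in> loc M" using D.mem_iff[of "inv x"] D.val_inv[of x] D.F_inv[of x] xK nz by auto
      then obtain c d where cd: "c \<in> A" "d \<in> A" "d \<notin> M" "inv x \<otimes> d = c" by (rule locE[OF M])
      have cl: "inv x \<in> carrier R" "d \<in> carrier R" using xK nz cd A_carr by auto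
      have "c \<otimes> x = inv x \<otimes> x \<otimes> d" unfolding cd(4)[symmetric] using xK(3) cl by (simp add: m_ac)
      then have "c \<otimes> x = d" using xK nz cl by simp
      then show False using MaxA_props(6)[OF M cd(1) xM] cd(3) by auto
    qed
  next
    assume xv: "x \<in> vball M 1"
    show "x \<in> M"
    proof (rule ccontr)
      assume n: "x \<notin> M"
      then have nz: "x \<noteq> \<zero>" using MaxA_props(4)[OF M] by auto
      have "inv x = \<one> \<otimes> inv x" using xK nz by simp
      then have "inv x \<in> loc M" unfolding loc_def localization_def using n x As(3) by blast
      then have "val M x \<le> 0" using D.mem_iff[of "inv x"] D.val_inv[of x] D.F_inv[of x] xK nz by auto
      then show False using xv nz unfolding vball_def by auto
    qed
  qed
qed

text \<open>The denominators of \<open>z\<close> form an ideal of \<open>A\<close> that no maximal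
  ideal contains, so 1 is among them.\<close>

lemma A_eq_Inter: assumes "z \<in> Kinf" "\<And>M. M \<in> MaxA \<Longrightarrow> z \<in> loc M" shows "z \<in> A"
proof -
  interpret D: domain RA by (rule RA_domain)
  have zc: "z \<in> carrier R" using assms Kinf_carr by auto
  let ?I = "{d \<in> A. z \<otimes> d \<in> A}"
  have I: "ideal ?I RA"
  proof (rule idealI[OF D.ring_axioms])
    show "subgroup ?I (add_monoid RA)"
    proof (rule D.add.subgroupI)
      show "?I \<noteq> {}" using As(2) zc by (auto intro!: exI[of _ \<zero>])
      have neg: "\<ominus>\<^bsub>RA\<^esub> a = \<ominus> a" if "a \<in> A" for a
        by (rule D.minus_equality) (use that As(5) A_carr in \<open>auto simp: l_neg\<close>)
      show "\<ominus>\<^bsub>RA\<^esub> a \<in> ?I" if "a \<in> ?I" for a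
        using that As(5) zc A_carr neg[of a] by (auto simp: r_minus)
      show "a \<oplus>\<^bsub>RA\<^esub> b \<in> ?I" if "a \<in> ?I" "b \<in> ?I" for a b
        using that As(7) zc A_carr by (auto simp: r_distr)
    qed auto
    show "x \<otimes>\<^bsub>RA\<^esub> a \<in> ?I" if "a \<in> ?I" "x \<in> carrier RA" for a x
      using that As(6) zc A_carr by (auto simp: m_lcomm[of z x])
    show "a \<otimes>\<^bsub>RA\<^esub> x \<in> ?I" if "a \<in> ?I" "x \<in> carrier RA" for a x
      using that As(6) zc A_carr by (auto simp: m_assoc[symmetric])
  qed
  have "\<one> \<in> ?I"
  proof (rule ccontr)
    assume "\<one> \<notin> ?I"
    then obtain M where M: "maximalideal M RA" "?I \<subseteq> M" using D.exists_maximal_ideal[OF I] by auto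
    then have MM: "M \<in> MaxA" unfolding MaxA_def Max_ideals_def by auto
    obtain c d where "c \<in> A" "d \<in> A" "d \<notin> M" "z \<otimes> d = c" using locE[OF MM assms(2)[OF MM]] by metis
    then show False using M(2) by auto
  qed
  then show ?thesis using zc by simp
qed

text \<open>\<open>V\<close> is a maximal subring of \<open>K 0\<close>, so otherwise
  \<open>A_M\<close> contains \<open>K 0\<close>. Being integrally closed, it then contains
  everything algebraic over \<open>K 0\<close>, that is, all of \<open>Kinf\<close>.\<close>

lemma K_loc_V: assumes "M \<in> MaxA" shows "loc M \<inter> K 0 = V"
proof (rule ccontr)
  assume n: "loc M \<inter> K 0 \<noteq> V"
  interpret D: discrete_valuation R Kinf "loc M" "val M" by (rule loc_valuation[OF assms])
  interpret D0: discrete_valuation R "K 0" V vV by (rule V_valuation)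
  have "loc M \<inter> K 0 = K 0"
    using n subring_inter[OF D.W(1) subfieldE(1)[OF K]] V_A A_loc[OF assms] V_K0
    by (intro D0.maximal_subring) auto
  then have sub: "K 0 \<subseteq> loc M" by auto
  have "z \<in> loc M" if z: "z \<in> Kinf" for z
  proof -
    obtain p where p: "p \<noteq> []" "set p \<subseteq> K 0" "hd p = \<one>" "eval p z = \<zero>" using monic_root[OF z] by blast
    then show ?thesis using integral_mem_valuation_ring[OF D.W(1), of p z] sub z Kinf_carr D.mem_or_inv_mem[OF z] by auto
  qed
  then show False using D.W_proper D.W(2) by auto
qed

section \<open>Extensions of the valuation to the intermediate fields\<close>

text \<open>The vertex of level \<open>i\<close> on the path of \<open>M\<close>; the order of the
  arguments makes \<open>res M\<close> the path itself.\<close>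

definition res :: "'a set \<Rightarrow> nat \<Rightarrow> 'a set" where "res M i = loc M \<inter> K i"

lemma loc_subring: "M \<in> MaxA \<Longrightarrow> subring (loc M) R"
  using discrete_valuation.W(1)[OF loc_valuation] .

lemma loc_mem_iff: "M \<in> MaxA \<Longrightarrow> x \<in> Kinf \<Longrightarrow> x \<noteq> \<zero> \<Longrightarrow> x \<in> loc M \<longleftrightarrow> 0 \<le> val M x"
  using discrete_valuation.mem_iff[OF loc_valuation] .

lemma inv_notin_iff:
  assumes "M \<in> MaxA" "x \<in> Kinf"
  shows "x \<in> vball M 1 \<longleftrightarrow> x = \<zero> \<or> inv x \<notin> loc M"
proof -
  interpret D: discrete_valuation R Kinf "loc M" "val M" by (rule loc_valuation[OF assms(1)])
  show ?thesis unfolding vball_def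
    using assms(2) D.mem_iff[of "inv x"] D.val_inv[of x] D.F_inv[of x] Kinf_carr[of x] by auto
qed

lemma vball_mono_loc: "M \<in> MaxA \<Longrightarrow> 0 \<le> n \<Longrightarrow> vball M n \<subseteq> loc M"
  using discrete_valuation.fball_0[OF loc_valuation] discrete_valuation.fball_antimono[OF loc_valuation]
  by (simp add: vball_fball) blast

text \<open>Two paths through one vertex share the valuation ring on \<open>K i\<close>, hence its
  maximal ideal. Smaller balls may differ, as the two normalised valuations can differ on
  \<open>K i\<close> by a factor.\<close>

lemma vball_1_res_cong:
  assumes "M \<in> MaxA" "P \<in> MaxA" "res M i = res P i" "x \<in> K i"
  shows "x \<in> vball M 1 \<longleftrightarrow> x \<in> vball P 1"
proof (cases "x = \<zero>")
  case True
  then show ?thesis using Kinfs(2) unfolding vball_def by auto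
next
  case False
  have "inv x \<in> K i" using K_inv assms(4) False by auto
  then have "inv x \<in> loc M \<longleftrightarrow> inv x \<in> loc P" using assms(3) unfolding res_def by auto
  then show ?thesis using inv_notin_iff[of _ x] assms K_Kinf by blast
qed

lemma res_antimono:
  assumes "res M j = res P j" "i \<le> j" shows "res M i = res P i"
  using assms K_mono[OF assms(2)] unfolding res_def by blast

lemma V_residue: assumes "M \<in> MaxA" "c \<in> V" "c \<notin> vball M 1" shows "inv c \<in> V"
proof -
  have "c \<in> Kinf" "c \<in> K 0" using assms V_K0 K_Kinf by auto
  moreover have "c \<noteq> \<zero>" using assms \<open>c \<in> Kinf\<close> unfolding vball_def by auto
  ultimately show ?thesis using inv_notin_iff[OF assms(1), of c] assms(3) K_loc_V[OF assms(1)] K_inv[of c 0] by auto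
qed

lemma uniformizer_V: "\<exists>t \<in> K 0 - {\<zero>}. \<forall>P \<in> MaxA. val P t > 0"
proof -
  interpret D0: discrete_valuation R "K 0" V vV by (rule V_valuation)
  obtain t where t: "t \<in> K 0" "t \<noteq> \<zero>" "vV t = 1" using D0.val_surj by auto
  have i: "inv t \<in> K 0" "inv t \<notin> V" using t D0.F_inv[of t] D0.mem_iff[of "inv t"] D0.val_inv[of t] K_carr by auto
  have "val P t > 0" if P: "P \<in> MaxA" for P
    using inv_notin_iff[OF P, of t] i t K_Kinf[of 0] K_loc_V[OF P] unfolding vball_def by auto
  then show ?thesis using t by auto
qed

text \<open>Dividing by an entry of least value makes that entry 1 and brings the others into
  \<open>V\<close>. The list may be a polynomial or the coefficients of a linear relation.\<close>

lemma normalize_coeffs: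
  assumes L: "set L \<subseteq> K 0" "\<not> set L \<subseteq> {\<zero>}"
  shows "\<exists>e \<in> K 0 - {\<zero>}. \<exists>k < length L. set (map ((\<otimes>) e) L) \<subseteq> V \<and> e \<otimes> L ! k = \<one>"
proof -
  interpret D0: discrete_valuation R "K 0" V vV by (rule V_valuation)
  let ?S = "set L - {\<zero>}"
  have "finite ?S" "?S \<noteq> {}" using L by auto
  from arg_min_if_finite[OF this, of vV] obtain c where c: "c \<in> ?S" "\<And>x. x \<in> ?S \<Longrightarrow> vV c \<le> vV x"
    by (metis linorder_not_le)
  then obtain k where k: "k < length L" "L ! k = c" by (auto simp: in_set_conv_nth)
  have cK: "c \<in> K 0" "c \<noteq> \<zero>" "c \<in> carrier R" using c L K_carr by auto
  have "inv c \<otimes> x \<in> V" if x: "x \<in> set L" for x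
  proof (cases "x = \<zero>")
    case True
    then show ?thesis using cK Vs(2) by simp
  next
    case False
    have xK: "x \<in> K 0" "x \<in> carrier R" using x L K_carr by auto
    have "vV (x \<otimes> inv c) \<ge> 0" using D0.val_div[OF xK(1) False cK(1,2)] c(2) x False by auto
    then have "x \<otimes> inv c \<in> V" using D0.mem_iff D0.F_mult_nonzero[of x "inv c"] D0.F_inv[of c] xK cK False by auto
    then show ?thesis using xK cK by (simp add: m_comm)
  qed
  moreover have "inv c \<in> K 0 - {\<zero>}" "inv c \<otimes> L ! k = \<one>" using cK k D0.F_inv[of c] by auto
  ultimately show ?thesis using k(1) by (intro bexI[of _ "inv c"] exI[of _ k]) auto
qed

text \<open>Monicity is traded for coefficients in \<open>V\<close>; the surviving entry 1 keeps the
  polynomial from vanishing modulo any maximal ideal.\<close>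

lemma primitive_root:
  assumes z: "z \<in> Kinf" shows "\<exists>p. set p \<subseteq> V \<and> \<one> \<in> set p \<and> eval p z = \<zero>"
proof -
  obtain p where p: "p \<noteq> []" "set p \<subseteq> K 0" "hd p = \<one>" "eval p z = \<zero>" using monic_root[OF z] by blast
  have "\<one> \<in> set p" using p by (metis hd_in_set)
  then have "\<not> set p \<subseteq> {\<zero>}" by auto
  then obtain e k where e: "e \<in> K 0 - {\<zero>}" "k < length p" "set (map ((\<otimes>) e) p) \<subseteq> V" "e \<otimes> p ! k = \<one>"
    using normalize_coeffs[OF p(2)] by blast
  have "eval (map ((\<otimes>) e) p) z = \<zero>"
    using eval_smult[of e p z] e(1) p(2,4) z K_carr[of _ 0] Kinf_carr subset_trans[OF p(2) Ks(1)] by auto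
  moreover have "\<one> \<in> set (map ((\<otimes>) e) p)" using e(2,4) by (metis image_eqI nth_mem set_map)
  ultimately show ?thesis using e(3) by blast
qed

lemma prefix_integral:
  assumes z: "z \<in> K i" "z \<noteq> \<zero>" and p: "set (p1 @ p2) \<subseteq> V" "eval (p1 @ p2) z = \<zero>"
  shows "eval p1 z \<in> A \<inter> K i" "z \<otimes> eval p1 z \<in> A \<inter> K i"
proof -
  have zK: "z \<in> Kinf" "z \<in> carrier R" using z K_Kinf K_carr by auto
  have e: "eval p1 z \<in> K i"
    using eval_in_subring[OF subfieldE(1)[OF K]] p(1) V_K0 K_mono[of 0 i] z by auto
  then have ze: "z \<otimes> eval p1 z \<in> K i" using z Ks(6) by auto
  have "eval p1 z \<in> loc M \<and> z \<otimes> eval p1 z \<in> loc M" if M: "M \<in> MaxA" for M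
    using eval_prefix_mem[OF loc_subring[OF M] _ zK(2) z(2) p(2)] p(1) V_A A_loc[OF M]
      discrete_valuation.mem_or_inv_mem[OF loc_valuation[OF M] zK(1) z(2)] by blast
  then show "eval p1 z \<in> A \<inter> K i" "z \<otimes> eval p1 z \<in> A \<inter> K i"
    using A_eq_Inter e ze K_Kinf by blast+
qed

text \<open>\<open>z\<close> is the quotient of \<open>z p1(z)\<close> and \<open>p1(z)\<close>,
  both in \<open>A \<inter> K i\<close> and not both in \<open>P\<close>. If the denominator were in
  \<open>P\<close>, it would be in \<open>M\<close>; then the numerator would be in \<open>M\<close>
  too, because \<open>z\<close> is in \<open>A_M\<close>, and both would be in
  \<open>P\<close>.\<close>

lemma res_subset_if_contraction_eq:
  assumes MP: "M \<in> MaxA" "P \<in> MaxA" and eq: "\<And>x. x \<in> A \<inter> K i \<Longrightarrow> x \<in> M \<longleftrightarrow> x \<in> P"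
  shows "res M i \<subseteq> res P i"
proof
  fix z assume "z \<in> res M i"
  then have z: "z \<in> loc M" "z \<in> K i" unfolding res_def by auto
  interpret DP: discrete_valuation R Kinf "loc P" "val P" rewrites "discrete_valuation.fball R Kinf (val P) = vball P"
    using loc_valuation[OF MP(2)] vball_fball[OF MP(2)] by auto
  interpret DM: discrete_valuation R Kinf "loc M" "val M" rewrites "discrete_valuation.fball R Kinf (val M) = vball M"
    using loc_valuation[OF MP(1)] vball_fball[OF MP(1)] by auto
  show "z \<in> res P i"
  proof (cases "z = \<zero>")
    case True
    then show ?thesis using DP.W_subring(2) Ks(2) unfolding res_def by auto
  next
    case False
    have zK: "z \<in> Kinf" "z \<in> carrier R" using z K_Kinf K_carr by auto
    obtain p where p: "set p \<subseteq> V" "\<one> \<in> set p" "eval p z = \<zero>" using primitive_root[OF zK(1)] by blast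
    obtain p1 p2 where s: "p = p1 @ p2" and u: "eval p1 z \<notin> vball P 1 \<or> z \<otimes> eval p1 z \<notin> vball P 1"
      using DP.exists_prefix_unit[of p z] p(1,2) V_A A_loc[OF MP(2)] DP.one_notin_maximal zK(1) by blast
    have e: "eval p1 z \<in> A \<inter> K i" "z \<otimes> eval p1 z \<in> A \<inter> K i"
      using prefix_integral[OF z(2) False, of p1 p2] p s by auto
    have "eval p1 z \<notin> P"
    proof
      assume P: "eval p1 z \<in> P"
      then have "eval p1 z \<in> vball M 1" using eq e(1) mem_M_iff[OF MP(1)] by auto
      then have "z \<otimes> eval p1 z \<in> vball M 1" using DM.fball_mult_W z(1) by auto
      then have "z \<otimes> eval p1 z \<in> P" using eq e(2) mem_M_iff[OF MP(1)] by auto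
      then show False using u P e mem_M_iff[OF MP(2)] by auto
    qed
    moreover have "eval p1 z \<noteq> \<zero>" using calculation MaxA_props(4)[OF MP(2)] by auto
    moreover have "z = (z \<otimes> eval p1 z) \<otimes> inv (eval p1 z)"
      using e(1) A_carr zK \<open>eval p1 z \<noteq> \<zero>\<close> by (simp add: m_assoc)
    ultimately have "z \<in> loc P" unfolding loc_def localization_def using e by blast
    then show ?thesis using z unfolding res_def by auto
  qed
qed

text \<open>\<open>A \<inter> K i\<close> is integral over \<open>V\<close>, so \<open>x\<close> has
  an inverse \<open>y\<close> modulo \<open>P\<close> within \<open>K i\<close>. The two summands
  are \<open>1 - x y\<close> and \<open>x y\<close>.\<close>

lemma comaximal_aux:
  assumes MP: "M \<in> MaxA" "P \<in> MaxA" and x: "x \<in> A \<inter> K i" "x \<in> M" "x \<notin> P"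
  shows "\<exists>p \<in> P \<inter> K i. \<exists>q \<in> M \<inter> K i. p \<oplus> q = \<one>"
proof -
  interpret DP: discrete_valuation R Kinf "loc P" "val P" rewrites "discrete_valuation.fball R Kinf (val P) = vball P"
    using loc_valuation[OF MP(2)] vball_fball[OF MP(2)] by auto
  let ?B = "A \<inter> K i"
  have B: "subring ?B R" by (rule subring_inter[OF A_subring subfieldE(1)[OF K]])
  note Bs = subringE[OF B]
  obtain p where p: "p \<noteq> []" "set p \<subseteq> V" "hd p = \<one>" "eval p x = \<zero>" using A_E x by blast
  have VB: "V \<subseteq> ?B" using V_A V_K0 K_mono[of 0 i] by auto
  have "\<exists>y \<in> ?B. \<one> \<ominus> x \<otimes> y \<in> vball P 1"
  proof (rule DP.integral_invertible_mod[OF B _ x(1)])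
    show "?B \<subseteq> loc P" using A_loc[OF MP(2)] by auto
    show "x \<notin> vball P 1" using x mem_M_iff[OF MP(2)] by auto
    show "set p \<subseteq> ?B" "p \<noteq> []" "hd p = \<one>" using p VB by auto
    show "c \<in> vball P 1 \<or> inv c \<in> ?B" if "c \<in> set p" for c
      using V_residue[OF MP(2), of c] that p VB by auto
    show "eval p x \<in> vball P 1" using p(4) Kinfs(2) unfolding vball_def by auto
  qed
  then obtain y where y: "y \<in> ?B" "\<one> \<ominus> x \<otimes> y \<in> vball P 1" by blast
  have xy: "x \<otimes> y \<in> ?B" "x \<otimes> y \<in> carrier R" using x(1) y Bs by auto
  have m: "\<one> \<ominus> x \<otimes> y \<in> ?B" unfolding minus_eq using Bs xy by auto
  then have "\<one> \<ominus> x \<otimes> y \<in> P" using mem_M_iff[OF MP(2)] y by auto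
  moreover have "x \<otimes> y \<in> M" using MaxA_props(6)[OF MP(1), of y x] x y A_carr by (auto simp: m_comm)
  moreover have "(\<one> \<ominus> x \<otimes> y) \<oplus> x \<otimes> y = \<one>" using xy by (simp add: minus_eq a_assoc l_neg)
  ultimately show ?thesis using m xy by blast
qed

lemma comaximal:
  assumes MP: "M \<in> MaxA" "P \<in> MaxA" and ne: "res M i \<noteq> res P i"
  shows "\<exists>p \<in> P \<inter> K i. \<exists>q \<in> M \<inter> K i. p \<oplus> q = \<one>"
proof -
  have "\<not> (\<forall>x \<in> A \<inter> K i. x \<in> M \<longleftrightarrow> x \<in> P)"
    using res_subset_if_contraction_eq[OF MP] res_subset_if_contraction_eq[OF MP(2,1)] ne by blast
  then obtain x where x: "x \<in> A \<inter> K i" "(x \<in> M \<and> x \<notin> P) \<or> (x \<in> P \<and> x \<notin> M)" by auto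
  from x(2) show ?thesis
  proof
    assume "x \<in> M \<and> x \<notin> P"
    then show ?thesis using comaximal_aux[OF MP x(1)] by auto
  next
    assume "x \<in> P \<and> x \<notin> M"
    then obtain p q where "p \<in> M \<inter> K i" "q \<in> P \<inter> K i" "p \<oplus> q = \<one>"
      using comaximal_aux[OF MP(2,1) x(1)] by auto
    moreover have "q \<oplus> p = \<one>" using calculation K_carr[of p i] K_carr[of q i] by (simp add: a_comm)
    ultimately show ?thesis by blast
  qed
qed

lemma comaximal_finite:
  assumes "finite S" "S \<subseteq> MaxA" "P \<in> MaxA" "\<And>M. M \<in> S \<Longrightarrow> res M i \<noteq> res P i"
  shows "\<exists>p \<in> P \<inter> K i. \<exists>q \<in> A \<inter> K i. (\<forall>M \<in> S. q \<in> M) \<and> p \<oplus> q = \<one>"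
  using assms(1,2,4)
proof (induction S rule: finite_induct)
  case empty
  then show ?case using MaxA_props(4)[OF assms(3)] Ks(2,3) As(3)
    by (intro bexI[of _ \<zero>] bexI[of _ \<one>]) auto
next
  case (insert M S)
  obtain p q where pq: "p \<in> P \<inter> K i" "q \<in> A \<inter> K i" "\<forall>M \<in> S. q \<in> M" "p \<oplus> q = \<one>"
    using insert by auto
  obtain p' q' where pq': "p' \<in> P \<inter> K i" "q' \<in> M \<inter> K i" "p' \<oplus> q' = \<one>"
    using comaximal[of M P i] insert(4,5) assms(3) by auto
  have MA: "M \<in> MaxA" "S \<subseteq> MaxA" using insert by auto
  note PP = MaxA_props[OF assms(3)] and MM = MaxA_props[OF MA(1)]
  have q'A: "q' \<in> A" using pq'(2) MM(2) by auto
  have c: "p \<in> carrier R" "q \<in> carrier R" "p' \<in> carrier R" "q' \<in> carrier R" using pq pq' K_carr by auto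
  \<comment> \<open>The expansion of \<open>p' + q' (p + q) = 1\<close>.\<close>
  let ?p = "p' \<oplus> q' \<otimes> p" and ?q = "q' \<otimes> q"
  have "?p \<oplus> ?q = p' \<oplus> q' \<otimes> (p \<oplus> q)" using c by (simp add: r_distr a_assoc)
  then have "?p \<oplus> ?q = \<one>" using pq pq' c by simp
  moreover have "?p \<in> P \<inter> K i" using PP(5,6) pq pq' q'A Ks(6,7) by auto
  moreover have "?q \<in> A \<inter> K i" using q'A pq pq' As(6) Ks(6) by auto
  moreover have "?q \<in> M'" if "M' \<in> insert M S" for M'
  proof (cases "M' = M")
    case True
    then show ?thesis using MM(6)[of q q'] pq pq' c by (auto simp: m_comm)
  next
    case False
    then show ?thesis using MaxA_props(6)[of M' q' q] that pq q'A MA by auto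
  qed
  ultimately show ?case by blast
qed

text \<open>Distinct primes of \<open>A \<inter> K i\<close> give linearly independent elements, by the Chinese remainder theorem.\<close>

lemma finite_res: "finite ((\<lambda>M. res M i) ` MaxA)"
proof (rule ccontr)
  assume inf: "infinite ((\<lambda>M. res M i) ` MaxA)"
  obtain n where n: "dimension n (K 0) (K i)" using K0_finite by auto
  obtain B where B: "finite B" "card B = Suc n" "B \<subseteq> (\<lambda>M. res M i) ` MaxA"
    using infinite_arbitrarily_large[OF inf] by blast
  then obtain U where U: "U \<subseteq> MaxA" "inj_on (\<lambda>M. res M i) U" "B = (\<lambda>M. res M i) ` U"
    by (metis subset_image_inj)
  have Uf: "finite U" "card U = Suc n" using B U by (auto simp: finite_image_iff card_image)
  obtain Ms where Ms: "set Ms = U" "distinct Ms" using finite_distinct_list[OF Uf(1)] by blast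
  have len: "length Ms = Suc n" using Ms Uf distinct_card by fastforce
  \<comment> \<open>Each \<open>q\<close> is a unit at its own \<open>M\<close> and lies in all
    other members of \<open>U\<close>. The independence of these \<open>Suc n\<close> elements over
    \<open>K 0\<close> will contradict the dimension \<open>n\<close>.\<close>
  have "\<exists>q \<in> A \<inter> K i. q \<notin> M \<and> (\<forall>M' \<in> U - {M}. q \<in> M')" if M: "M \<in> U" for M
  proof -
    have MM: "M \<in> MaxA" using M U by auto
    obtain p q where pq: "p \<in> M \<inter> K i" "q \<in> A \<inter> K i" "\<forall>M' \<in> U - {M}. q \<in> M'" "p \<oplus> q = \<one>"
    proof -
      have "finite (U - {M})" "U - {M} \<subseteq> MaxA" using Uf U by auto
      moreover have "res M' i \<noteq> res M i" if "M' \<in> U - {M}" for M' using inj_onD[OF U(2), of M' M] that M by auto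
      ultimately have "\<exists>p \<in> M \<inter> K i. \<exists>q \<in> A \<inter> K i. (\<forall>M' \<in> U - {M}. q \<in> M') \<and> p \<oplus> q = \<one>"
        by (rule comaximal_finite[OF _ _ MM])
      then show thesis using that by blast
    qed
    have "q \<notin> M" using MaxA_props(3,5)[OF MM] pq(1,4) by fastforce
    then show ?thesis using pq by blast
  qed
  then obtain q where q: "\<And>M. M \<in> U \<Longrightarrow> q M \<in> A \<inter> K i \<and> q M \<notin> M \<and> (\<forall>M' \<in> U - {M}. q M \<in> M')"
    by metis
  let ?Us = "map q Ms"
  have UsA: "set ?Us \<subseteq> A \<inter> K i" using q Ms by auto
  then have Usc: "set ?Us \<subseteq> carrier R" using A_carr by auto
  have "independent (K 0) ?Us"
  proof (rule trivial_combine_imp_independent[OF K Usc])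
    fix Ks' assume Ks': "set Ks' \<subseteq> K 0" "combine Ks' ?Us = \<zero>"
    let ?L = "take (length ?Us) Ks'"
    have L: "set ?L \<subseteq> K 0" using Ks' set_take_subset by fastforce
    have cL: "combine ?L ?Us = \<zero>" using combine_take[of ?Us Ks'] Ks'(2) by simp
    show "set ?L \<subseteq> {\<zero>}"
    proof (rule ccontr)
      assume "\<not> set ?L \<subseteq> {\<zero>}"
      \<comment> \<open>A nontrivial relation is scaled to have coefficient 1 at \<open>k\<close>;
        at the \<open>k\<close>-th ideal its left side is then a unit, although it is zero.\<close>
      then obtain e k where e: "e \<in> K 0 - {\<zero>}" "k < length ?L" "set (map ((\<otimes>) e) ?L) \<subseteq> V" "e \<otimes> ?L ! k = \<one>"
        using normalize_coeffs[OF L] by blast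
      have k: "k < length Ms" using e(2) by simp
      let ?M = "Ms ! k"
      have MU: "?M \<in> U" "?M \<in> MaxA" using k Ms(1) U(1) nth_mem by blast+
      interpret D: discrete_valuation R Kinf "loc ?M" "val ?M" rewrites "discrete_valuation.fball R Kinf (val ?M) = vball ?M"
        using loc_valuation[OF MU(2)] vball_fball[OF MU(2)] by auto
      have "combine (map ((\<otimes>) e) ?L) ?Us \<notin> vball ?M 1"
      proof (rule D.combine_single_unit[of _ _ k])
        show "set (map ((\<otimes>) e) ?L) \<subseteq> loc ?M" using e(3) V_A A_loc[OF MU(2)] by blast
        show "set ?Us \<subseteq> loc ?M" using UsA A_loc[OF MU(2)] by blast
        show "k < length ?Us" "k < length (map ((\<otimes>) e) ?L)" using e(2) by auto
        show "?Us ! k \<notin> vball ?M 1" using q[OF MU(1)] mem_M_iff[OF MU(2)] k by auto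
        show "map ((\<otimes>) e) ?L ! k \<notin> vball ?M 1" using e(2,4) D.one_notin_maximal by (simp add: nth_map)
        show "?Us ! j \<in> vball ?M 1" if j: "j < length ?Us" "j \<noteq> k" for j
        proof -
          have "Ms ! j \<in> U" "Ms ! j \<noteq> ?M" using j k Ms nth_eq_iff_index_eq[OF Ms(2)] by auto
          then have "q (Ms ! j) \<in> ?M" using q[of "Ms ! j"] MU by auto
          then show ?thesis using j mem_M_iff[OF MU(2)] MaxA_props(2)[OF MU(2)] by auto
        qed
      qed
      moreover have "combine (map ((\<otimes>) e) ?L) ?Us = \<zero>"
        using combine_r_distr[OF subset_trans[OF L Ks(1)] Usc, of e] e(1) K_carr[of e 0] cL by simp
      ultimately show False using Kinfs(2) unfolding vball_def by auto
    qed
  qed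
  then show False using independent_length_le_dimension[OF K n, of ?Us] UsA len by auto
qed

text \<open>Let \<open>s\<close> have least positive value at \<open>P\<close> among the elements of
  \<open>K i\<close>, and let \<open>p + q = 1\<close> with \<open>p\<close> in \<open>P\<close> and
  \<open>q\<close> in the ideals over the other vertices. Take \<open>x = s q^n + p p\<close>. At
  \<open>P\<close> the first term has the value of \<open>s\<close>, the second at least twice that.
  Elsewhere a large \<open>n\<close> gives the first term positive value, even where
  \<open>s\<close> has negative value, and \<open>p\<close> is a unit. Generation is stated as
  divisibility, which passes to every path through the vertex.\<close>

lemma local_generator:
  assumes P: "P \<in> MaxA"
  shows "\<exists>x \<in> A \<inter> K i. x \<in> P \<and> x \<noteq> \<zero> \<and> (\<forall>z \<in> K i \<inter> vball P 1. z \<otimes> inv x \<in> loc P) \<and>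
    (\<forall>M \<in> MaxA. res M i \<noteq> res P i \<longrightarrow> x \<notin> M)"
proof -
  interpret DP: discrete_valuation R Kinf "loc P" "val P" rewrites "discrete_valuation.fball R Kinf (val P) = vball P"
    using loc_valuation[OF P] vball_fball[OF P] by auto
  obtain t where "t \<in> K 0 - {\<zero>}" "val P t > 0" using uniformizer_V P by blast
  then have "t \<in> K i \<and> t \<noteq> \<zero> \<and> val P t > 0" using K_mono[of 0 i] by auto
  from ex_has_least_nat[of "\<lambda>t. t \<in> K i \<and> t \<noteq> \<zero> \<and> val P t > 0", OF this, of "\<lambda>t. nat (val P t)"]
  obtain s where s: "s \<in> K i" "s \<noteq> \<zero>" "val P s > 0"
    and s_min': "\<And>z. z \<in> K i \<and> z \<noteq> \<zero> \<and> val P z > 0 \<Longrightarrow> nat (val P s) \<le> nat (val P z)" by blast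
  have s_min: "val P s \<le> val P z" if "z \<in> K i" "z \<noteq> \<zero>" "z \<in> vball P 1" for z
    using s_min'[of z] that s(3) unfolding vball_def by auto
  let ?N = "{M \<in> MaxA. res M i \<noteq> res P i}"
  have "finite ((\<lambda>M. res M i) ` ?N)" by (rule finite_subset[OF _ finite_res[of i]]) auto
  from finite_subset_image[OF this, of "\<lambda>M. res M i" ?N]
  obtain U where U: "U \<subseteq> ?N" "finite U" "(\<lambda>M. res M i) ` ?N = (\<lambda>M. res M i) ` U" by auto
  obtain p q where pq: "p \<in> P \<inter> K i" "q \<in> A \<inter> K i" "\<And>M. M \<in> U \<Longrightarrow> q \<in> M" "p \<oplus> q = \<one>"
  proof -
    have "\<exists>p \<in> P \<inter> K i. \<exists>q \<in> A \<inter> K i. (\<forall>M \<in> U. q \<in> M) \<and> p \<oplus> q = \<one>"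
      by (rule comaximal_finite) (use U P in auto)
    then show thesis using that by blast
  qed
  \<comment> \<open>Exceeds \<open>|val M s|\<close> at every \<open>M\<close> in \<open>U\<close>.
    Since \<open>U\<close> represents all other vertices and membership in the maximal ideal depends
    on the vertex alone, this serves infinitely many ideals as well.\<close>
  define n where "n = Suc (\<Sum>M\<in>U. nat \<bar>val M s\<bar>)"
  let ?a = "s \<otimes> q [^] n" and ?x = "s \<otimes> q [^] n \<oplus> p \<otimes> p"
  have pA: "p \<in> A" using pq(1) MaxA_props(2)[OF P] by auto
  have c: "s \<in> carrier R" "p \<in> carrier R" "q \<in> carrier R" using s pq K_carr by auto
  have qn: "q [^] m \<in> A \<inter> K i" for m :: nat
    by (induction m) (use pq(2) As(3,6) Ks(3,6) in auto)
  have aK: "?a \<in> K i" "p \<otimes> p \<in> K i" "?x \<in> K i" using s pq qn[of n] Ks(6,7) by auto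
  then have aI: "?a \<in> Kinf" "p \<otimes> p \<in> Kinf" "?x \<in> Kinf" using K_Kinf by blast+
  have sI: "s \<in> Kinf" using s K_Kinf by auto
  have qP: "q \<notin> P" using MaxA_props(3,5)[OF P] pq(1,4) by fastforce
  have aU: "?a \<in> vball M 1" if M: "M \<in> U" for M
  proof -
    have MM: "M \<in> MaxA" using M U by auto
    interpret D: discrete_valuation R Kinf "loc M" "val M" rewrites "discrete_valuation.fball R Kinf (val M) = vball M"
      using loc_valuation[OF MM] vball_fball[OF MM] by auto
    have "q \<in> vball M 1" using mem_M_iff[OF MM] pq(2,3) M by auto
    then have "q [^] m \<in> vball M (int m)" for m :: nat
    proof (induction m)
      case 0
      then show ?case using D.fball_0 D.W_subring(3) by auto
    next
      case (Suc m)
      then show ?case using D.fball_mult[of "q [^] m" "int m" q 1] by (auto simp: add.commute)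
    qed
    then have "?a \<in> vball M (val M s + int n)" using D.fball_mult[of s "val M s"] sI unfolding vball_def[of M "val M s"] by auto
    moreover have "nat \<bar>val M s\<bar> \<le> (\<Sum>M\<in>U. nat \<bar>val M s\<bar>)" using M U(2) by (intro member_le_sum) auto
    then have "1 \<le> val M s + int n" unfolding n_def by linarith
    ultimately show ?thesis using D.fball_antimono[of 1] by blast
  qed
  have off: "?a \<in> vball M 1 \<and> p \<notin> M" if M: "M \<in> MaxA" "res M i \<noteq> res P i" for M
  proof -
    obtain M' where M': "M' \<in> U" "res M i = res M' i" using U(3) M by blast
    then have M'M: "M' \<in> MaxA" using U by auto
    have "?a \<in> vball M 1" "q \<in> vball M 1"
      using vball_1_res_cong[OF M(1) M'M M'(2)] aU[OF M'(1)] aK(1) pq(2,3) M'(1) mem_M_iff[OF M'M] by auto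
    then show ?thesis using mem_M_iff[OF M(1)] pq(2,4) MaxA_props(3,5)[OF M(1)] by fastforce
  qed
  have q0: "q \<noteq> \<zero>" using qP MaxA_props(4)[OF P] by auto
  have qI: "q \<in> Kinf" using pq(2) A_Kinf by auto
  have "val P q = 0" using qP mem_M_iff[OF P, of q] pq(2) q0 qI A_loc[OF P] loc_mem_iff[OF P qI q0] unfolding vball_def by auto
  then have qn_val: "q [^] n \<in> Kinf" "q [^] n \<noteq> \<zero>" "val P (q [^] n) = 0" using DP.val_pow[OF qI q0, of n] by auto
  have a_val: "?a \<noteq> \<zero>" "val P ?a = val P s"
    using DP.val_mult[OF sI s(2) qn_val(1,2)] DP.F_mult_nonzero[OF sI s(2) qn_val(1,2)] qn_val by auto
  have pv: "p \<in> vball P (val P s)"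
    using s_min[of p] pq(1) mem_M_iff[OF P pA] K_Kinf[of i] unfolding vball_def by auto
  have "p \<otimes> p \<in> vball P (val P ?a + 1)"
    using DP.fball_mult[OF pv pv] DP.fball_antimono[of "val P ?a + 1" "val P s + val P s"] a_val s(3) by auto
  from DP.val_add_lt[OF aI(1) a_val(1) this]
  have x_val: "?x \<noteq> \<zero>" "val P ?x = val P s" using a_val by auto
  have xP: "?x \<in> loc P" using loc_mem_iff[OF P aI(3) x_val(1)] x_val s by auto
  have xA: "?x \<in> A"
  proof (rule A_eq_Inter[OF aI(3)])
    fix M assume M: "M \<in> MaxA"
    show "?x \<in> loc M"
    proof (cases "res M i = res P i")
      case True
      then show ?thesis using xP aK(3) unfolding res_def by auto
    next
      case False
      have "?a \<in> loc M" using off[OF M False] vball_mono_loc[OF M, of 1] by auto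
      moreover have "p \<otimes> p \<in> loc M" using pA As(6) A_loc[OF M] by auto
      ultimately show ?thesis using subringE(7)[OF loc_subring[OF M]] by auto
    qed
  qed
  moreover have "?x \<in> P" using mem_M_iff[OF P xA] x_val s(3) aI(3) unfolding vball_def by auto
  moreover have "z \<otimes> inv ?x \<in> loc P" if z: "z \<in> K i \<inter> vball P 1" for z
  proof (cases "z = \<zero>")
    case True
    then show ?thesis using aI x_val Kinf_carr DP.W_subring(2) by auto
  next
    case False
    have zI: "z \<in> Kinf" using z K_Kinf by auto
    have "val P (z \<otimes> inv ?x) \<ge> 0" using DP.val_div[OF zI False aI(3) x_val(1)] x_val s_min[of z] z False by auto
    moreover have "z \<otimes> inv ?x \<in> Kinf" "z \<otimes> inv ?x \<noteq> \<zero>"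
      using DP.F_mult_nonzero[OF zI False, of "inv ?x"] DP.F_inv[OF aI(3) x_val(1)] inv_nonzero(2)[OF Kinf_carr[OF aI(3)] x_val(1)] by auto
    ultimately show ?thesis using loc_mem_iff[OF P] by auto
  qed
  moreover have "?x \<notin> M" if M: "M \<in> MaxA" "res M i \<noteq> res P i" for M
  proof -
    interpret D: discrete_valuation R Kinf "loc M" "val M" rewrites "discrete_valuation.fball R Kinf (val M) = vball M"
      using loc_valuation[OF M(1)] vball_fball[OF M(1)] by auto
    have "p \<otimes> p \<notin> M" using MaxA_props(7)[OF M(1) pA pA] off[OF M] by auto
    then have "p \<otimes> p \<notin> vball M 1" using mem_M_iff[OF M(1)] pA As(6) by auto
    then have "?x \<notin> vball M 1" using D.fball_sum_notin(1)[of ?a 1 "p \<otimes> p"] off[OF M] aI by auto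
    then show ?thesis using mem_M_iff[OF M(1) xA] by auto
  qed
  ultimately show ?thesis using aK(3) x_val(1) by blast
qed

section \<open>Maximal paths of the ramification tree\<close>

abbreviation T where "T \<equiv> ramification_tree R V K"

text \<open>The path of \<open>M\<close> is unramified from level \<open>i\<close> on iff \<open>K i\<close> already attains all values.\<close>

definition unram :: "nat \<Rightarrow> 'a set \<Rightarrow> bool" where
  "unram i M \<longleftrightarrow> (\<forall>x \<in> Kinf - {\<zero>}. \<exists>y \<in> K i - {\<zero>}. val M x = val M y)"

text \<open>The step of the tree derivation, transported to maximal ideals.\<close>

definition crit_step :: "'a set set \<Rightarrow> 'a set set" where
  "crit_step C = {P \<in> MaxA. \<forall>i. unram i P \<longrightarrow> (\<exists>M \<in> C. res M i = res P i \<and> \<not> unram i M)}"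

section \<open>Vertices and edges on the path of a maximal ideal\<close>

lemma res_subring: "M \<in> MaxA \<Longrightarrow> subring (res M i) R"
  unfolding res_def by (rule subring_inter[OF loc_subring subfieldE(1)[OF K]])

lemma res_or_inv:
  assumes "M \<in> MaxA" "x \<in> K i" "x \<noteq> \<zero>" shows "x \<in> res M i \<or> inv x \<in> res M i"
  using discrete_valuation.mem_or_inv_mem[OF loc_valuation[OF assms(1)], of x] assms K_Kinf K_inv
  unfolding res_def by blast

lemma quotient_field_res: "M \<in> MaxA \<Longrightarrow> quotient_field R (res M i) = K i"
  using res_or_inv by (intro quotient_field_eqI[OF K res_subring]) (auto simp: res_def)

lemma valuation_ring_res: "M \<in> MaxA \<Longrightarrow> valuation_ring R (res M i)"
  using res_or_inv by (intro valuation_ringI[OF K res_subring]) (auto simp: res_def)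

lemma res_Int: "i \<le> j \<Longrightarrow> res M j \<inter> K i = res M i"
  using K_mono[of i j] unfolding res_def by auto

lemma res_0: "M \<in> MaxA \<Longrightarrow> res M 0 = V"
  using K_loc_V unfolding res_def .

lemma verts_T: "W \<in> verts T \<longleftrightarrow> valuation_ring R W \<and> (\<exists>i. quotient_field R W = K i) \<and> W \<inter> K 0 = V"
  unfolding ramification_tree_def extends_def V_quot by auto

lemma vertex_res: "M \<in> MaxA \<Longrightarrow> res M i \<in> verts T"
  unfolding verts_T using valuation_ring_res quotient_field_res res_Int[of 0 i] res_0 by auto

lemma vertex_subring: "W \<in> verts T \<Longrightarrow> subring W R \<and> W \<subseteq> quotient_field R W"
  unfolding verts_T valuation_ring_def using subset_quotient_field by auto

lemma tree_le_T: "tree_le T a b \<longleftrightarrow> b \<inter> quotient_field R a = a"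
  unfolding ramification_tree_def extends_def by simp

lemma tree_root_T: "tree_root T = V"
  unfolding tree_root_def
proof (rule the_equality)
  have V: "V \<in> verts T"
    unfolding verts_T using V_dvr V_quot V_K0 unfolding discrete_valuation_ring_def by auto
  then show "V \<in> verts T \<and> (\<forall>a \<in> verts T. tree_le T V a)"
    unfolding tree_le_T V_quot using verts_T by blast
  fix r assume r: "r \<in> verts T \<and> (\<forall>a \<in> verts T. tree_le T r a)"
  then have "V \<inter> quotient_field R r = r" "r \<inter> K 0 = V"
    using bspec[OF conjunct2[OF r] V] conjunct1[OF r] unfolding tree_le_T verts_T by blast+
  then show "r = V" by auto
qed

text \<open>A vertex in between has some \<open>K j\<close> as quotient field; for
  \<open>j \<le> i\<close> it coincides with the lower vertex, for \<open>j > i\<close> with the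
  upper one.\<close>

lemma edge_res: assumes M: "M \<in> MaxA" shows "edge T (res M i) (res M (Suc i))"
  unfolding edge_def tree_lt_def tree_le_T
proof (intro conjI notI)
  show "res M i \<in> verts T" "res M (Suc i) \<in> verts T" using vertex_res M by auto
  show "res M (Suc i) \<inter> quotient_field R (res M i) = res M i"
    using quotient_field_res[OF M] res_Int[of i "Suc i" M] by simp
  show False if "res M i = res M (Suc i)"
    using that quotient_field_res[OF M, of i] quotient_field_res[OF M, of "Suc i"] K_strict[of i] by simp
  assume "\<exists>c \<in> verts T. (c \<inter> quotient_field R (res M i) = res M i \<and> res M i \<noteq> c) \<and>
    (res M (Suc i) \<inter> quotient_field R c = c \<and> c \<noteq> res M (Suc i))"
  then obtain c where c: "c \<in> verts T" "c \<inter> K i = res M i" "res M i \<noteq> c"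
    "res M (Suc i) \<inter> quotient_field R c = c" "c \<noteq> res M (Suc i)"
    using quotient_field_res[OF M] by auto
  obtain j where j: "quotient_field R c = K j" using c(1) unfolding verts_T by auto
  have cj: "c \<subseteq> K j" using vertex_subring[OF c(1)] j by auto
  show False
  proof (cases "j \<le> i")
    case True
    then show False using cj K_mono[of j i] c(2,3) by blast
  next
    case False
    then have "K (Suc i) \<subseteq> K j" using K_mono[of "Suc i" j] by auto
    then show False using c(4,5) j unfolding res_def by auto
  qed
qed

lemma infinite_path_tail_res: "M \<in> MaxA \<Longrightarrow> infinite_path T (tail i (res M))"
  unfolding infinite_path_def tail_def using edge_res by auto

lemma res_MaxPath: "M \<in> MaxA \<Longrightarrow> res M \<in> MaxPath T"
  unfolding MaxPath_def infinite_path_def using edge_res res_0 tree_root_T by auto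

text \<open>The contraction of \<open>b\<close> to \<open>K (Suc i)\<close> is a vertex above
  \<open>a\<close>; as nothing lies strictly between, it is \<open>b\<close>.\<close>

lemma edge_level:
  assumes e: "edge T a b" and a: "quotient_field R a = K i"
  shows "quotient_field R b = K (Suc i)" "b \<inter> K i = a"
proof -
  have ab: "a \<in> verts T" "b \<in> verts T" "b \<inter> K i = a" "a \<noteq> b"
    and no: "\<And>c. c \<in> verts T \<Longrightarrow> tree_lt T a c \<Longrightarrow> tree_lt T c b \<Longrightarrow> False"
    using e a unfolding edge_def tree_lt_def tree_le_T by auto
  show "b \<inter> K i = a" by fact
  obtain j where j: "quotient_field R b = K j" using ab(2) unfolding verts_T by auto
  have bj: "b \<subseteq> K j" "subring b R" using vertex_subring[OF ab(2)] j by auto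
  have "\<not> j \<le> i" using bj ab(3,4) K_mono[of j i] by auto
  then have ij: "Suc i \<le> j" by auto
  let ?c = "b \<inter> K (Suc i)"
  have sc: "subring ?c R" by (rule subring_inter[OF bj(2) subfieldE(1)[OF K]])
  have vr: "x \<in> ?c \<or> inv x \<in> ?c" if x: "x \<in> K (Suc i)" "x \<noteq> \<zero>" for x
  proof -
    have "x \<in> K j - {\<zero>}" using x K_mono[OF ij] by auto
    then have "x \<in> b \<or> inv x \<in> b" using ab(2) j unfolding verts_T valuation_ring_def by auto
    then show ?thesis using x K_inv by auto
  qed
  have qc: "quotient_field R ?c = K (Suc i)" by (rule quotient_field_eqI[OF K sc _ vr]) auto
  have "?c \<inter> K 0 = V" using ab(2) K_mono[of 0 "Suc i"] unfolding verts_T by auto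
  then have c: "?c \<in> verts T" unfolding verts_T using valuation_ringI[OF K sc _ vr] qc by auto
  have "?c \<inter> K i = a" using ab(3) K_mono[of i "Suc i"] by auto
  moreover have "a \<noteq> ?c" using qc a K_strict[of i] by auto
  ultimately have "tree_lt T a ?c" unfolding tree_lt_def tree_le_T a by auto
  then have "\<not> tree_lt T ?c b" using no[OF c] by auto
  then have "?c = b" unfolding tree_lt_def tree_le_T qc by auto
  then show "quotient_field R b = K (Suc i)" using qc by simp
qed

section \<open>The bijection between maximal ideals and maximal paths\<close>

lemma path_level:
  assumes "infinite_path T \<pi>" "quotient_field R (\<pi> 0) = K i"
  shows "quotient_field R (\<pi> j) = K (i + j)"
proof (induction j)
  case (Suc j)
  then show ?case using edge_level(1)[of "\<pi> j" "\<pi> (Suc j)" "i + j"] assms(1) unfolding infinite_path_def by auto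
qed (use assms in auto)

lemma MaxPath_E:
  assumes s: "\<rho> \<in> MaxPath T" shows "\<exists>M \<in> MaxA. \<rho> = res M"
proof -
  have p: "infinite_path T \<rho>" "\<rho> 0 = V" using s tree_root_T unfolding MaxPath_def by auto
  have lev: "quotient_field R (\<rho> j) = K j" for j using path_level[OF p(1), of 0 j] p(2) V_quot by auto
  have e: "edge T (\<rho> j) (\<rho> (Suc j))" for j using p(1) unfolding infinite_path_def by auto
  have v: "\<rho> j \<in> verts T" for j using e unfolding edge_def by auto
  have sub: "subring (\<rho> j) R" "\<rho> j \<subseteq> K j" for j using vertex_subring[OF v[of j]] lev by auto
  have Int: "\<rho> (i + n) \<inter> K i = \<rho> i" for i n
  proof (induction n)
    case 0
    then show ?case using sub(2)[of i] by auto
  next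
    case (Suc n)
    have "\<rho> (Suc (i + n)) \<inter> K (i + n) = \<rho> (i + n)" using edge_level(2)[OF e lev] .
    then show ?case using Suc K_mono[of i "i + n"] by auto
  qed
  have Int': "\<rho> j \<inter> K i = \<rho> i" if "i \<le> j" for i j using Int[of i "j - i"] that by auto
  define W where "W = (\<Union>j. \<rho> j)"
  have WK: "W \<inter> K i = \<rho> i" for i
  proof -
    have "\<rho> j \<inter> K i \<subseteq> \<rho> i" for j
    proof (cases "i \<le> j")
      case True
      then show ?thesis using Int' by auto
    next
      case False
      then show ?thesis using Int'[of j i] by auto
    qed
    then show ?thesis using sub(2)[of i] unfolding W_def by auto
  qed
  have WKinf: "W \<subseteq> Kinf" using sub(2) K_Kinf unfolding W_def by blast
  have Wc: "x \<oplus> y \<in> W \<and> x \<otimes> y \<in> W" if xy: "x \<in> W" "y \<in> W" for x y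
  proof -
    obtain i where "x \<in> K i" "y \<in> K i" using Kinf_pair[of x y] xy WKinf by auto
    then have "x \<in> \<rho> i" "y \<in> \<rho> i" using WK xy by auto
    then have "x \<oplus> y \<in> \<rho> i" "x \<otimes> y \<in> \<rho> i" using subringE(6,7)[OF sub(1)[of i]] by auto
    then show ?thesis unfolding W_def by auto
  qed
  have Wn: "\<ominus> x \<in> W" if "x \<in> W" for x using that subringE(5)[OF sub(1)] unfolding W_def by auto
  have W1: "\<one> \<in> W" "\<zero> \<in> W" using subringE(2,3)[OF sub(1)[of 0]] unfolding W_def by auto
  have Ws: "subring W R"
    by (rule subringI) (use WKinf Kinf_carr W1 Wn Wc in auto)
  have vr: "x \<in> W \<or> inv x \<in> W" if x: "x \<in> Kinf" "x \<noteq> \<zero>" for x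
  proof -
    obtain i where i: "x \<in> K i" using x unfolding Kinf_def by auto
    then have "x \<in> \<rho> i \<or> inv x \<in> \<rho> i" using v[of i] lev[of i] x unfolding verts_T valuation_ring_def by auto
    then show ?thesis unfolding W_def by auto
  qed
  have AW: "A \<subseteq> W"
  proof
    fix x assume x: "x \<in> A"
    obtain q where q: "q \<noteq> []" "set q \<subseteq> V" "hd q = \<one>" "eval q x = \<zero>" using A_E[OF x] by blast
    have "V \<subseteq> W" using p(2) unfolding W_def by blast
    then show "x \<in> W" using integral_mem_valuation_ring[OF Ws, of q x] q x A_carr A_Kinf vr by auto
  qed
  \<comment> \<open>The nonunits of \<open>W\<close> in \<open>A\<close>. \<open>W\<close> is not
    yet known to be discrete, so there are no values to compare; closure under addition uses that
    \<open>y/x\<close> or \<open>x/y\<close> is in \<open>W\<close>.\<close>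
  let ?I = "{x \<in> A. x = \<zero> \<or> inv x \<notin> W}"
  have Im: "a \<otimes> x \<in> ?I" if a: "a \<in> A" and x: "x \<in> ?I" for a x
  proof (cases "a \<otimes> x = \<zero>")
    case False
    have c: "a \<in> carrier R" "x \<in> carrier R" "x \<noteq> \<zero>" using a x False A_carr by auto
    have "inv (a \<otimes> x) \<notin> W"
    proof
      assume i: "inv (a \<otimes> x) \<in> W"
      have ic: "inv (a \<otimes> x) \<in> carrier R" using False c by auto
      have "x \<otimes> (a \<otimes> inv (a \<otimes> x)) = (a \<otimes> x) \<otimes> inv (a \<otimes> x)" using c(1,2) ic by (simp add: m_ac)
      also have "\<dots> = \<one>" using False c by simp
      finally have "inv x = a \<otimes> inv (a \<otimes> x)" using c ic by (intro comm_inv_char) auto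
      then show False using Wc[of a "inv (a \<otimes> x)"] i a AW x c by auto
    qed
    then show ?thesis using As(6) a x by auto
  qed (use As(2) in auto)
  have Ia_aux: "x \<oplus> y \<in> ?I" if x: "x \<in> ?I" and y: "y \<in> ?I" and nz: "x \<noteq> \<zero>" and q: "y \<otimes> inv x \<in> W" for x y
  proof (cases "x \<oplus> y = \<zero>")
    case False
    have c: "y \<in> carrier R" "x \<in> carrier R" "inv x \<in> carrier R" using x y nz A_carr by auto
    have "inv (x \<oplus> y) \<notin> W"
    proof
      assume i: "inv (x \<oplus> y) \<in> W"
      have ic: "inv (x \<oplus> y) \<in> carrier R" using False c by auto
      have s: "x \<otimes> (\<one> \<oplus> y \<otimes> inv x) = x \<oplus> y"
      proof -
        have "x \<otimes> (\<one> \<oplus> y \<otimes> inv x) = x \<oplus> y \<otimes> (x \<otimes> inv x)" using c by algebra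
        then show ?thesis using nz c by simp
      qed
      have "x \<otimes> ((\<one> \<oplus> y \<otimes> inv x) \<otimes> inv (x \<oplus> y)) = x \<otimes> (\<one> \<oplus> y \<otimes> inv x) \<otimes> inv (x \<oplus> y)"
        using c ic by (simp add: m_assoc)
      also have "\<dots> = \<one>" unfolding s using False c by simp
      finally have "inv x = (\<one> \<oplus> y \<otimes> inv x) \<otimes> inv (x \<oplus> y)" using c ic by (intro comm_inv_char) auto
      then have "inv x \<in> W" using Wc[OF conjunct1[OF Wc[OF W1(1) q]] i] by metis
      then show False using x nz by auto
    qed
    then show ?thesis using As(7) x y by auto
  qed (use As(2) in auto)
  have Ia: "x \<oplus> y \<in> ?I" if x: "x \<in> ?I" and y: "y \<in> ?I" for x y
  proof -
    have c: "x \<in> carrier R" "y \<in> carrier R" "x \<in> Kinf" "y \<in> Kinf" using x y A_carr A_Kinf by auto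
    consider "x = \<zero>" | "y = \<zero>" | "x \<noteq> \<zero>" "y \<noteq> \<zero>" by blast
    then show ?thesis
    proof cases
      case 3
      have d: "y \<otimes> inv x \<in> Kinf" "y \<otimes> inv x \<noteq> \<zero>" using 3 c Kinfs(6) Kinf_inv integral[of y "inv x"] by auto
      have "inv (y \<otimes> inv x) = x \<otimes> inv y"
      proof (rule comm_inv_char)
        have "y \<otimes> inv x \<otimes> (x \<otimes> inv y) = (x \<otimes> inv x) \<otimes> (y \<otimes> inv y)"
          using c inv_nonzero(1)[OF c(1) 3(1)] inv_nonzero(1)[OF c(2) 3(2)] by algebra
        then show "y \<otimes> inv x \<otimes> (x \<otimes> inv y) = \<one>" using c 3 by simp
      qed (use c 3 in auto)
      then consider "y \<otimes> inv x \<in> W" | "x \<otimes> inv y \<in> W" using vr[OF d] by auto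
      then show ?thesis
      proof cases
        case 1
        then show ?thesis using Ia_aux[OF x y 3(1)] by simp
      next
        case 2
        have "y \<oplus> x \<in> ?I" by (rule Ia_aux[OF y x 3(2) 2])
        then show ?thesis using c by (simp add: a_comm)
      qed
    qed (use c x y in auto)
  qed
  interpret D: domain RA by (rule RA_domain)
  have I: "ideal ?I RA"
  proof (rule idealI[OF D.ring_axioms])
    show "subgroup ?I (add_monoid RA)"
    proof (rule D.add.subgroupI)
      show "?I \<noteq> {}" using As(2) by blast
      have neg: "\<ominus>\<^bsub>RA\<^esub> a = \<ominus> \<one> \<otimes> a" if "a \<in> A" for a
        by (rule D.minus_equality) (use that As(3,5,6) A_carr in \<open>auto simp: l_neg l_minus\<close>)
      show "\<ominus>\<^bsub>RA\<^esub> a \<in> ?I" if "a \<in> ?I" for a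
        using Im[of "\<ominus> \<one>" a] that As(3,5) neg[of a] by auto
      show "a \<oplus>\<^bsub>RA\<^esub> b \<in> ?I" if "a \<in> ?I" "b \<in> ?I" for a b using Ia[OF that] by simp
    qed auto
    show "x \<otimes>\<^bsub>RA\<^esub> a \<in> ?I" if "a \<in> ?I" "x \<in> carrier RA" for a x using Im[of x a] that by simp
    show "a \<otimes>\<^bsub>RA\<^esub> x \<in> ?I" if "a \<in> ?I" "x \<in> carrier RA" for a x
      using Im[of x a] that A_carr by (simp add: m_comm)
  qed
  have "\<one>\<^bsub>RA\<^esub> \<notin> ?I" using W1 by simp
  then obtain M where M: "maximalideal M RA" "?I \<subseteq> M" using D.exists_maximal_ideal[OF I] by blast
  then have MM: "M \<in> MaxA" unfolding MaxA_def Max_ideals_def by auto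
  interpret DM: discrete_valuation R Kinf "loc M" "val M" by (rule loc_valuation[OF MM])
  \<comment> \<open>A denominator outside \<open>M\<close> is outside \<open>?I\<close>, hence
    invertible in \<open>W\<close>.\<close>
  have "loc M \<subseteq> W"
  proof
    fix z assume "z \<in> loc M"
    then obtain c d where cd: "c \<in> A" "d \<in> A" "d \<notin> M" "d \<noteq> \<zero>" "z = c \<otimes> inv d" by (rule locE[OF MM])
    then have "inv d \<in> W" using M(2) by auto
    then show "z \<in> W" using Wc[of c "inv d"] cd AW by auto
  qed
  moreover have "W \<noteq> Kinf"
  proof
    assume "W = Kinf"
    then have "K 0 \<subseteq> V" using WK[of 0] p(2) K_Kinf by auto
    then show False using V_K0 discrete_valuation.W_proper[OF V_valuation] by auto
  qed
  ultimately have "W = loc M" using DM.maximal_subring[OF Ws _ WKinf] by blast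
  then have "\<rho> = res M" using WK unfolding res_def by auto
  then show ?thesis using MM by auto
qed

lemma res_inj: assumes "M \<in> MaxA" "P \<in> MaxA" "res M = res P" shows "M = P"
proof -
  have "x \<in> M \<longleftrightarrow> x \<in> P" if x: "x \<in> A" for x
  proof -
    obtain i where "x \<in> K i" using x A_Kinf unfolding Kinf_def by auto
    then show ?thesis using vball_1_res_cong[OF assms(1,2), of i x] assms mem_M_iff x by auto
  qed
  then show ?thesis using MaxA_props(2)[OF assms(1)] MaxA_props(2)[OF assms(2)] by blast
qed

lemma infinite_path_E:
  assumes M: "M \<in> MaxA" and p: "infinite_path T \<pi>" "\<pi> 0 = res M i"
  shows "\<exists>M' \<in> MaxA. \<pi> = tail i (res M')"
proof -
  \<comment> \<open>The path of \<open>M\<close> connects the root with the start of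
    \<open>\<pi>\<close>.\<close>
  define \<rho> where "\<rho> j = (if j < i then res M j else \<pi> (j - i))" for j
  have "edge T (\<rho> j) (\<rho> (Suc j))" for j
  proof (cases "j < i")
    case True
    then have "\<rho> (Suc j) = res M (Suc j)" unfolding \<rho>_def using p(2) by (cases "Suc j = i") auto
    then show ?thesis using edge_res[OF M, of j] True unfolding \<rho>_def by auto
  next
    case False
    then show ?thesis using p(1) unfolding \<rho>_def infinite_path_def by (auto simp: Suc_diff_le)
  qed
  moreover have "\<rho> 0 = V" unfolding \<rho>_def using res_0[OF M] p(2) by auto
  ultimately have "\<rho> \<in> MaxPath T" unfolding MaxPath_def infinite_path_def tree_root_T by auto
  then obtain M' where M': "M' \<in> MaxA" "\<rho> = res M'" using MaxPath_E by blast
  have "\<pi> = tail i \<rho>" unfolding tail_def \<rho>_def by auto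
  then show ?thesis using M' by auto
qed

text \<open>The quotient field of a vertex determines its level, so the path can only have been cut
  at \<open>i\<close>; the vertices below are contractions of those above.\<close>

lemma max_extension_tail: assumes M: "M \<in> MaxA" shows "max_extension T (tail i (res M)) = res M"
  unfolding max_extension_def
proof (rule the_equality)
  show "res M \<in> MaxPath T \<and> (\<exists>k. tail i (res M) = tail k (res M))" using res_MaxPath[OF M] by auto
  fix \<rho> assume s: "\<rho> \<in> MaxPath T \<and> (\<exists>k. tail i (res M) = tail k \<rho>)"
  then obtain k M' where k: "tail i (res M) = tail k \<rho>" "M' \<in> MaxA" "\<rho> = res M'" using MaxPath_E by blast
  have e: "res M (i + n) = res M' (k + n)" for n using k(1,3) unfolding tail_def by metis
  have "i = k" using K_inj e[of 0] quotient_field_res[OF M, of i] quotient_field_res[OF k(2), of k] by auto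
  have "res M j = res M' j" for j
  proof -
    have "res M (i + j) = res M' (i + j)" using e \<open>i = k\<close> by simp
    then show ?thesis using res_antimono[of M "i + j" M' j] by simp
  qed
  then show "\<rho> = res M" using k(3) by auto
qed

lemma weight_res:
  assumes M: "M \<in> MaxA"
  shows "weight T (res M i) (res M (Suc i)) > 0"
    and "weight T (res M i) (res M (Suc i)) = 1 \<longleftrightarrow>
      (\<forall>x \<in> K (Suc i) - {\<zero>}. \<exists>y \<in> K i - {\<zero>}. val M x = val M y)"
proof -
  interpret D: discrete_valuation R Kinf "loc M" "val M" by (rule loc_valuation[OF M])
  obtain t where "t \<in> K 0 - {\<zero>}" "val M t > 0" using uniformizer_V M by blast
  then have t: "t \<in> K i - {\<zero>}" "val M t \<noteq> 0" using K_mono[of 0 i] by auto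
  have w: "weight T = ramification_index R" unfolding ramification_tree_def by simp
  have unit: "x \<in> res M (Suc i) \<and> inv x \<in> res M (Suc i) \<longleftrightarrow> val M x = 0" if x: "x \<in> K (Suc i) - {\<zero>}" for x
  proof -
    have xI: "x \<in> Kinf" "x \<noteq> \<zero>" "inv x \<in> K (Suc i)" using x K_Kinf K_inv by auto
    then show ?thesis unfolding res_def
      using x D.mem_iff[of x] D.mem_iff[of "inv x"] D.val_inv[of x] D.F_inv[of x] Kinf_carr[of x] by auto
  qed
  have mult: "val M (x \<otimes> y) = val M x + val M y" if "x \<in> K (Suc i) - {\<zero>}" "y \<in> K (Suc i) - {\<zero>}" for x y
    using D.val_mult that K_Kinf[of "Suc i"] by auto
  note r = ramification_index_props[OF K K K_mono[of i "Suc i"] res_subring[OF M] quotient_field_res[OF M] quotient_field_res[OF M] mult unit t]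
  show "weight T (res M i) (res M (Suc i)) > 0" unfolding w by (rule r(1)) auto
  show "weight T (res M i) (res M (Suc i)) = 1 \<longleftrightarrow>
      (\<forall>x \<in> K (Suc i) - {\<zero>}. \<exists>y \<in> K i - {\<zero>}. val M x = val M y)" unfolding w by (rule r(2)) auto
qed

text \<open>Weight 1 of an edge means that the next field brings no new values; by induction no
  later field does.\<close>

lemma path_weight_unram:
  assumes M: "M \<in> MaxA" shows "path_weight T (tail i (res M)) = 1 \<longleftrightarrow> unram i M"
proof -
  interpret D: discrete_valuation R Kinf "loc M" "val M" by (rule loc_valuation[OF M])
  have "path_weight T (tail i (res M)) = 1 \<longleftrightarrow>
    (\<forall>j. \<forall>x \<in> K (Suc (i + j)) - {\<zero>}. \<exists>y \<in> K (i + j) - {\<zero>}. val M x = val M y)"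
    using path_weight_1_iff[of T "tail i (res M)"] weight_res[OF M] unfolding tail_def by simp
  also have "\<dots> \<longleftrightarrow> unram i M"
  proof
    assume a: "\<forall>j. \<forall>x \<in> K (Suc (i + j)) - {\<zero>}. \<exists>y \<in> K (i + j) - {\<zero>}. val M x = val M y"
    have b: "\<forall>x \<in> K (i + j) - {\<zero>}. \<exists>y \<in> K i - {\<zero>}. val M x = val M y" for j
    proof (induction j)
      case (Suc j)
      show ?case
      proof
        fix x assume "x \<in> K (i + Suc j) - {\<zero>}"
        then obtain y where "y \<in> K (i + j) - {\<zero>}" "val M x = val M y" using a by fastforce
        then show "\<exists>y \<in> K i - {\<zero>}. val M x = val M y" using Suc by metis
      qed
    qed auto
    show "unram i M" unfolding unram_def
    proof
      fix x assume "x \<in> Kinf - {\<zero>}"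
      then obtain j where "x \<in> K j - {\<zero>}" unfolding Kinf_def by auto
      then have "x \<in> K (i + j) - {\<zero>}" using K_mono[of j "i + j"] by auto
      then show "\<exists>y \<in> K i - {\<zero>}. val M x = val M y" using b by blast
    qed
  next
    assume u: "unram i M"
    show "\<forall>j. \<forall>x \<in> K (Suc (i + j)) - {\<zero>}. \<exists>y \<in> K (i + j) - {\<zero>}. val M x = val M y"
    proof (intro allI ballI)
      fix j x assume "x \<in> K (Suc (i + j)) - {\<zero>}"
      then have "x \<in> Kinf - {\<zero>}" using K_Kinf by auto
      then obtain y where "y \<in> K i - {\<zero>}" "val M x = val M y" using u unfolding unram_def by auto
      then show "\<exists>y \<in> K (i + j) - {\<zero>}. val M x = val M y" using K_mono[of i "i + j"] by auto
    qed
  qed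
  finally show ?thesis .
qed

lemma unram_mono: "unram i M \<Longrightarrow> i \<le> j \<Longrightarrow> unram j M"
  using K_mono[of i j] unfolding unram_def by blast

text \<open>The powers of \<open>s\<close> and their inverses already take every integer
  value.\<close>

lemma unramI:
  assumes M: "M \<in> MaxA" and s: "s \<in> K i - {\<zero>}" "val M s = 1" shows "unram i M"
proof -
  interpret D: discrete_valuation R Kinf "loc M" "val M" by (rule loc_valuation[OF M])
  have sI: "s \<in> Kinf" "s \<noteq> \<zero>" using s K_Kinf by auto
  have sn: "s [^] (n::nat) \<in> K i" for n by (induction n) (use s Ks(3,6) in auto)
  have "\<exists>y \<in> K i - {\<zero>}. val M x = val M y" for x
  proof (cases "0 \<le> val M x")
    case True
    then show ?thesis using D.val_pow[OF sI, of "nat (val M x)"] sn[of "nat (val M x)"] s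
      by (intro bexI[of _ "s [^] nat (val M x)"]) auto
  next
    case False
    let ?n = "nat (- val M x)"
    note pw = D.val_pow[OF sI, of ?n]
    have "inv (s [^] ?n) \<in> K i - {\<zero>}" using subfield_m_inv(1)[OF K, of "s [^] ?n" i] sn pw by auto
    moreover have "val M (inv (s [^] ?n)) = val M x" using D.val_inv[of "s [^] ?n"] pw s False by auto
    ultimately show ?thesis by metis
  qed
  then show ?thesis unfolding unram_def by auto
qed

lemma unram_iff: "M \<in> MaxA \<Longrightarrow> unram i M \<longleftrightarrow> (\<exists>s \<in> K i - {\<zero>}. val M s = 1)"
  using unramI discrete_valuation.val_surj[OF loc_valuation, of M] unfolding unram_def by metis

text \<open>A uniformizer of \<open>A_M\<close> lies in some \<open>K i\<close>: discreteness of
  \<open>A_M\<close> becomes finite ramification of the path.\<close>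

lemma unram_exists: "M \<in> MaxA \<Longrightarrow> \<exists>i. unram i M"
  using discrete_valuation.val_surj[OF loc_valuation, of M] unramI[of M] unfolding Kinf_def by fastforce

lemma range_unramified_part:
  assumes M: "M \<in> MaxA"
  shows "range (unramified_part T (res M)) = {res M i | i. unram i M}"
proof -
  define k where "k = (LEAST k. unram k M)"
  have "unram k M" unfolding k_def using unram_exists[OF M] by (metis LeastI)
  then have iff: "unram i M \<longleftrightarrow> k \<le> i" for i
    using unram_mono Least_le[of "\<lambda>k. unram k M"] unfolding k_def by blast
  have "unramified_part T (res M) = tail k (res M)"
    unfolding unramified_part_def path_weight_unram[OF M] k_def ..
  then show ?thesis unfolding tail_def iff by (auto, metis le_add_diff_inverse rangeI)
qed

text \<open>An infinite path from \<open>res P i\<close> is a tail of the path of some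
  \<open>M\<close> through that vertex, and injectivity of \<open>res\<close> recovers
  \<open>M\<close> in \<open>C\<close> from the maximal extension.\<close>

lemma tree_step_eq:
  assumes C: "C \<subseteq> MaxA" shows "tree_step T (res ` C) = res ` crit_step C"
proof (intro equalityI subsetI)
  fix \<pi> assume p: "\<pi> \<in> tree_step T (res ` C)"
  then have "\<pi> \<in> MaxPath T" unfolding tree_step_def by auto
  then obtain P where P: "P \<in> MaxA" "\<pi> = res P" using MaxPath_E by blast
  have "\<exists>M \<in> C. res M i = res P i \<and> \<not> unram i M" if u: "unram i P" for i
  proof -
    have "res P i \<in> range (unramified_part T \<pi>)" unfolding P range_unramified_part[OF P(1)] using u by auto
    then obtain \<pi>' where pp: "infinite_path T \<pi>'" "\<pi>' 0 = res P i" "path_weight T \<pi>' > 1" "max_extension T \<pi>' \<in> res ` C"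
      using p unfolding tree_step_def by blast
    obtain M where M: "M \<in> MaxA" "\<pi>' = tail i (res M)" using infinite_path_E[OF P(1) pp(1,2)] by blast
    have "res M \<in> res ` C" using pp(4) max_extension_tail[OF M(1)] M(2) by simp
    then have "M \<in> C" using res_inj[OF M(1)] C by auto
    moreover have "res M i = res P i" using pp(2) M(2) unfolding tail_def by simp
    moreover have "\<not> unram i M" using pp(3) M(2) path_weight_unram[OF M(1), of i] by auto
    ultimately show ?thesis by blast
  qed
  then show "\<pi> \<in> res ` crit_step C" using P unfolding crit_step_def by auto
next
  fix \<pi> assume "\<pi> \<in> res ` crit_step C"
  then obtain P where P: "P \<in> MaxA" "\<pi> = res P"
    and st: "\<And>i. unram i P \<Longrightarrow> \<exists>M \<in> C. res M i = res P i \<and> \<not> unram i M" unfolding crit_step_def by auto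
  have "\<exists>\<pi>'. infinite_path T \<pi>' \<and> \<pi>' 0 = a \<and> path_weight T \<pi>' > 1 \<and> max_extension T \<pi>' \<in> res ` C"
    if a: "a \<in> range (unramified_part T \<pi>)" for a
  proof -
    obtain i where i: "unram i P" "a = res P i" using a unfolding P range_unramified_part[OF P(1)] by auto
    obtain M where M: "M \<in> C" "res M i = res P i" "\<not> unram i M" using st[OF i(1)] by auto
    then have MM: "M \<in> MaxA" using C by auto
    let ?p = "tail i (res M)"
    have "infinite_path T ?p" by (rule infinite_path_tail_res[OF MM])
    moreover have "?p 0 = a" using M(2) i(2) unfolding tail_def by simp
    moreover have "path_weight T ?p > 1" using path_weight_ge_1[of T ?p] path_weight_unram[OF MM, of i] M(3)
      by (metis order_le_imp_less_or_eq)
    moreover have "max_extension T ?p \<in> res ` C" using max_extension_tail[OF MM] M(1) by auto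
    ultimately show ?thesis by blast
  qed
  then show "\<pi> \<in> tree_step T (res ` C)" unfolding tree_step_def using res_MaxPath[OF P(1)] P(2) by auto
qed

section \<open>The derivation of the ring\<close>

text \<open>Closedness in the path space. Without it the extension of \<open>P\<close> to the intersection of the
  localizations at \<open>C\<close> could be maximal with \<open>P\<close> outside \<open>C\<close>.\<close>

definition tree_closed :: "'a set set \<Rightarrow> bool" where
  "tree_closed C \<longleftrightarrow> C \<subseteq> MaxA \<and> (\<forall>P \<in> MaxA. (\<forall>i. \<exists>M \<in> C. res M i = res P i) \<longrightarrow> P \<in> C)"

text \<open>The condition concerns only levels from which \<open>P\<close> is unramified, but these
  are cofinal and agreement at a high level implies agreement below; closedness does the
  rest.\<close>

lemma crit_step_subset:
  assumes C: "tree_closed C" shows "crit_step C \<subseteq> C"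
proof
  fix P assume "P \<in> crit_step C"
  then have P: "P \<in> MaxA" "\<And>i. unram i P \<Longrightarrow> \<exists>M \<in> C. res M i = res P i" unfolding crit_step_def by auto
  obtain k where k: "unram k P" using unram_exists[OF P(1)] by auto
  have "\<exists>M \<in> C. res M i = res P i" for i
  proof -
    have "unram (max k i) P" using unram_mono[OF k] by auto
    then obtain M where "M \<in> C" "res M (max k i) = res P (max k i)" using P(2) by auto
    then show ?thesis using res_antimono[of M "max k i" P i] by auto
  qed
  then show "P \<in> C" using C P(1) unfolding tree_closed_def by auto
qed

text \<open>Let \<open>M\<close> in \<open>crit_step C\<close> agree with \<open>P\<close> at level
  \<open>i\<close>. If \<open>M\<close> ramifies later, it is itself the witness for
  \<open>P\<close>; otherwise the condition on \<open>M\<close> at \<open>i\<close> supplies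
  one.\<close>

lemma crit_step_closed:
  assumes C: "tree_closed C" shows "tree_closed (crit_step C)"
  unfolding tree_closed_def
proof (intro conjI ballI impI)
  show "crit_step C \<subseteq> MaxA" unfolding crit_step_def by auto
  fix P assume P: "P \<in> MaxA" and lim: "\<forall>i. \<exists>M \<in> crit_step C. res M i = res P i"
  have "\<exists>M \<in> C. res M i = res P i \<and> \<not> unram i M" for i
  proof -
    obtain M where M: "M \<in> crit_step C" "res M i = res P i" using lim by auto
    show ?thesis
    proof (cases "unram i M")
      case True
      then obtain M' where "M' \<in> C" "res M' i = res M i" "\<not> unram i M'" using M unfolding crit_step_def by blast
      then show ?thesis using M(2) by auto
    next
      case False
      then show ?thesis using M crit_step_subset[OF C] by auto
    qed
  qed
  then show "P \<in> crit_step C" using P unfolding crit_step_def by auto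
qed

lemma uniformizer_A: assumes M: "M \<in> MaxA" shows "\<exists>u \<in> A - {\<zero>}. val M u = 1"
proof -
  interpret D: discrete_valuation R Kinf "loc M" "val M" by (rule loc_valuation[OF M])
  obtain w where w: "w \<in> Kinf" "w \<noteq> \<zero>" "val M w = 1" using D.val_surj by auto
  then have "w \<in> loc M" using D.mem_iff by auto
  then obtain c d where cd: "c \<in> A" "d \<in> A" "d \<notin> M" "d \<noteq> \<zero>" "w \<otimes> d = c" by (rule locE[OF M])
  have dI: "d \<in> Kinf" using cd A_Kinf by auto
  have "val M d = 0" using cd mem_M_iff[OF M cd(2)] D.mem_iff[OF dI cd(4)] A_loc[OF M] dI unfolding vball_def by auto
  then have "val M c = 1" "c \<noteq> \<zero>" using D.val_mult[OF w(1,2) dI cd(4)] D.F_mult_nonzero[OF w(1,2) dI cd(4)] w cd by auto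
  then show ?thesis using cd by auto
qed

lemma val_unit: assumes M: "M \<in> MaxA" and x: "x \<in> A" "x \<notin> M" shows "x \<noteq> \<zero>" "val M x = 0"
proof -
  have xI: "x \<in> Kinf" using x A_Kinf by auto
  show nz: "x \<noteq> \<zero>" using x MaxA_props(4)[OF M] by auto
  show "val M x = 0"
    using x mem_M_iff[OF M x(1)] loc_mem_iff[OF M xI nz] A_loc[OF M] xI unfolding vball_def by auto
qed

section \<open>Critical ideals of an intersection of localizations\<close>

lemma SP_ring_props:
  assumes C: "C \<subseteq> MaxA" "C \<noteq> {}"
  shows "SP_ring R A C = (\<Inter>M\<in>C. loc M)" "subring (SP_ring R A C) R" "A \<subseteq> SP_ring R A C" "SP_ring R A C \<subseteq> Kinf"
proof -
  show eq: "SP_ring R A C = (\<Inter>M\<in>C. loc M)" unfolding SP_ring_def loc_def using C by auto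
  show "subring (SP_ring R A C) R" unfolding eq
    using subring_Inter[of "loc ` C"] loc_subring C by auto
  show "A \<subseteq> SP_ring R A C" unfolding eq using A_loc C by auto
  show "SP_ring R A C \<subseteq> Kinf" unfolding eq using loc_Kinf C by auto
qed

text \<open>For \<open>n = 1\<close> it identifies the extension of \<open>P\<close>; for
  \<open>n = 2\<close> it bounds an ideal by its generators.\<close>

lemma vball_ideal:
  assumes P: "P \<in> MaxA" and S: "subring S R" "S \<subseteq> loc P"
  shows "ideal (vball P n \<inter> S) (R\<lparr>carrier := S\<rparr>)"
proof -
  interpret D: discrete_valuation R Kinf "loc P" "val P" rewrites "discrete_valuation.fball R Kinf (val P) = vball P"
    using loc_valuation[OF P] vball_fball[OF P] by auto
  interpret S: ring "R\<lparr>carrier := S\<rparr>" by (rule subring_is_ring[OF S(1)])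
  note Ss = subringE[OF S(1)]
  have m1: "\<ominus> \<one> \<in> S" using Ss(3,5) by auto
  have mul: "x \<otimes> a \<in> vball P n \<inter> S" if "a \<in> vball P n \<inter> S" "x \<in> S" for a x
    using that D.fball_mult_W[of x a n] S(2) Ss(6) by auto
  show ?thesis
  proof (rule idealI[OF S.ring_axioms])
    show "subgroup (vball P n \<inter> S) (add_monoid (R\<lparr>carrier := S\<rparr>))"
    proof (rule S.add.subgroupI)
      have "\<zero> \<in> vball P n \<inter> S" using Kinfs(2) Ss(2) unfolding vball_def by auto
      then show "vball P n \<inter> S \<noteq> {}" by blast
      have neg: "\<ominus>\<^bsub>R\<lparr>carrier := S\<rparr>\<^esub> a = \<ominus> \<one> \<otimes> a" if "a \<in> S" for a
        by (rule S.minus_equality) (use that Ss(1,5) in \<open>auto simp: subset_iff l_neg l_minus\<close>)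
      show "\<ominus>\<^bsub>R\<lparr>carrier := S\<rparr>\<^esub> a \<in> vball P n \<inter> S" if "a \<in> vball P n \<inter> S" for a
        using mul[OF that m1] neg[of a] that by auto
      show "a \<oplus>\<^bsub>R\<lparr>carrier := S\<rparr>\<^esub> b \<in> vball P n \<inter> S" if "a \<in> vball P n \<inter> S" "b \<in> vball P n \<inter> S" for a b
        using that D.fball_add[of a n b] Ss(7) by auto
    qed auto
    show "x \<otimes>\<^bsub>R\<lparr>carrier := S\<rparr>\<^esub> a \<in> vball P n \<inter> S" if "a \<in> vball P n \<inter> S" "x \<in> carrier (R\<lparr>carrier := S\<rparr>)" for a x
      using mul that by simp
    show "a \<otimes>\<^bsub>R\<lparr>carrier := S\<rparr>\<^esub> x \<in> vball P n \<inter> S" if a: "a \<in> vball P n \<inter> S" and x: "x \<in> carrier (R\<lparr>carrier := S\<rparr>)" for a x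
    proof -
      have "x \<otimes> a = a \<otimes> x" using a x Ss(1) by (auto simp: subset_iff intro: m_comm)
      then show ?thesis using mul[OF a, of x] x by simp
    qed
  qed
qed

text \<open>\<open>P\<close> may lie outside \<open>C\<close>. If no member of \<open>C\<close>
  passes through its vertex at level \<open>i\<close>, then \<open>x\<close> is a unit of
  \<open>?T\<close> and \<open>?I\<close> is the whole ring; \<open>radical_ideal\<close> admits
  this, and the same contradiction results.\<close>

lemma SP_step_imp_crit_step:
  assumes C: "C \<subseteq> MaxA" "C \<noteq> {}" and P: "P \<in> MaxA"
    and crit: "Idl\<^bsub>R\<lparr>carrier := SP_ring R A C\<rparr>\<^esub> P \<in> Crit_ideals (R\<lparr>carrier := SP_ring R A C\<rparr>)"
  shows "P \<in> crit_step C"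
proof (rule ccontr)
  let ?T = "SP_ring R A C"
  let ?RT = "R\<lparr>carrier := ?T\<rparr>"
  let ?J = "Idl\<^bsub>?RT\<^esub> P"
  note Tp = SP_ring_props[OF C]
  note Ts = subringE[OF Tp(2)]
  interpret RT: domain ?RT by (rule subring_is_domain[OF Tp(2)])
  assume "P \<notin> crit_step C"
  then obtain i where i: "unram i P" "\<And>M. M \<in> C \<Longrightarrow> res M i = res P i \<Longrightarrow> unram i M"
    using P unfolding crit_step_def by auto
  obtain x where x: "x \<in> A" "x \<in> K i" "x \<in> P" "x \<noteq> \<zero>" "\<And>z. z \<in> K i \<Longrightarrow> z \<in> vball P 1 \<Longrightarrow> z \<otimes> inv x \<in> loc P"
    "\<And>M. M \<in> MaxA \<Longrightarrow> res M i \<noteq> res P i \<Longrightarrow> x \<notin> M" using local_generator[OF P, of i] by blast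
  have xI: "x \<in> Kinf" "x \<in> carrier R" "x \<in> ?T" using x A_Kinf A_carr Tp(3) by auto
  have xval: "val M x = 0 \<or> val M x = 1" if M: "M \<in> C" for M
  proof (cases "res M i = res P i")
    case False
    then show ?thesis using val_unit[of M x] x M C(1) by auto
  next
    case True
    have MM: "M \<in> MaxA" using M C by auto
    interpret D: discrete_valuation R Kinf "loc M" "val M" by (rule loc_valuation[OF MM])
    \<comment> \<open>This uniformizer of \<open>M\<close> also lies in the maximal ideal at
      \<open>P\<close>, so \<open>x\<close> divides it in the common valuation ring and has value at
      most 1.\<close>
    obtain s where s: "s \<in> K i" "s \<noteq> \<zero>" "val M s = 1" using i(2)[OF M True] unram_iff[OF MM] by auto
    have sI: "s \<in> Kinf" using s K_Kinf by auto
    have "s \<in> vball P 1" using vball_1_res_cong[OF MM P True s(1)] s sI unfolding vball_def by auto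
    then have "s \<otimes> inv x \<in> res P i" using x(5)[OF s(1)] s(1) K_inv[OF x(2,4)] Ks(6) unfolding res_def by auto
    then have "s \<otimes> inv x \<in> loc M" using True unfolding res_def by auto
    then have "0 \<le> val M s - val M x"
      using D.val_div[OF sI s(2) xI(1) x(4)] D.mem_iff[of "s \<otimes> inv x"] D.F_mult_nonzero[OF sI s(2), of "inv x"] D.F_inv[OF xI(1) x(4)]
        inv_nonzero(2)[OF xI(2) x(4)] by auto
    moreover have "0 \<le> val M x" using loc_mem_iff[OF MM xI(1) x(4)] A_loc[OF MM] x(1) by auto
    ultimately show ?thesis using s(3) by auto
  qed
  let ?I = "PIdl\<^bsub>?RT\<^esub> x"
  have I_eq: "?I = {a \<otimes> x | a. a \<in> ?T}" unfolding cgenideal_def by simp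
  have I: "ideal ?I ?RT" by (rule RT.cgenideal_ideal) (use xI in simp)
  have J: "maximalideal ?J ?RT" "\<not> (\<exists>I \<subseteq> ?J. I \<noteq> {\<zero>} \<and> fin_gen_ideal I ?RT \<and> radical_ideal I ?RT)"
    using crit unfolding Crit_ideals_def Max_ideals_def by auto
  have PT: "P \<subseteq> carrier ?RT" using MaxA_props(2)[OF P] Tp(3) by auto
  have "x \<in> ?J" using RT.genideal_self[OF PT] x(3) by auto
  then have "?I \<subseteq> ?J" by (intro RT.cgenideal_minimal maximalideal.axioms(1)[OF J(1)])
  moreover have "x \<in> ?I" unfolding I_eq using Ts(3) xI by (auto intro!: exI[of _ \<one>])
  then have "?I \<noteq> {\<zero>}" using x(4) by auto
  moreover have "fin_gen_ideal ?I ?RT" unfolding fin_gen_ideal_def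
    using RT.cgenideal_eq_genideal[of x] xI by (intro exI[of _ "{x}"]) auto
  moreover have "radical_ideal ?I ?RT" unfolding radical_ideal_def
  proof (intro conjI I ballI allI impI)
    fix y and n :: nat assume y: "y \<in> carrier ?RT" and yn: "y [^]\<^bsub>?RT\<^esub> n \<in> ?I"
    have yT: "y \<in> ?T" "y \<in> Kinf" "y \<in> carrier R" using y Tp(4) Kinf_carr by auto
    have "y [^] n \<in> ?I" using yn nat_pow_consistent[of y n] by simp
    then obtain z where z: "z \<in> ?T" "y [^] n = z \<otimes> x" unfolding I_eq by auto
    show "y \<in> ?I"
    proof (cases "y = \<zero>")
      case True
      then show ?thesis unfolding I_eq using Ts(2) xI by (auto intro!: exI[of _ \<zero>])
    next
      case False
      have q: "y \<otimes> inv x \<in> Kinf" "y \<otimes> inv x \<noteq> \<zero>"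
        using yT False xI x(4) Kinfs(6) Kinf_inv integral[of y "inv x"] by auto
      have "y \<otimes> inv x \<in> loc M" if M: "M \<in> C" for M
      proof -
        have MM: "M \<in> MaxA" using M C by auto
        interpret D: discrete_valuation R Kinf "loc M" "val M" by (rule loc_valuation[OF MM])
        have zI: "z \<in> Kinf" "z \<in> loc M" "y \<in> loc M" using z yT M Tp(1,4) by auto
        have yv: "0 \<le> val M y" using D.mem_iff[OF yT(2) False] zI by auto
        have pw: "y [^] n \<noteq> \<zero>" "val M (y [^] n) = int n * val M y" using D.val_pow[OF yT(2) False, of n] by auto
        have z0: "z \<noteq> \<zero>" using pw(1) z(2) xI by auto
        have "0 \<le> val M z" using D.mem_iff[OF zI(1) z0] zI by auto
        then have ge: "val M x \<le> int n * val M y" using D.val_mult[OF zI(1) z0 xI(1) x(4)] z(2) pw by auto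
        \<comment> \<open>As \<open>x\<close> has value 0 or 1, this could fail only with value 1
          for \<open>x\<close> and 0 for \<open>y\<close>, which \<open>ge\<close> excludes for
          every \<open>n\<close>, including 0.\<close>
        have "val M x \<le> val M y"
        proof (rule ccontr)
          assume "\<not> ?thesis"
          then have "val M y = 0" "val M x = 1" using xval[OF M] yv by auto
          then show False using ge by auto
        qed
        then show ?thesis using D.mem_iff[OF q] D.val_div[OF yT(2) False xI(1) x(4)] by auto
      qed
      then have "y \<otimes> inv x \<in> ?T" unfolding Tp(1) by auto
      moreover have "y = (y \<otimes> inv x) \<otimes> x" using yT xI x(4) by (simp add: m_assoc)
      ultimately show ?thesis unfolding I_eq by blast
    qed
  qed
  ultimately show False using J(2) by blast
qed

lemma crit_step_imp_SP_step:
  assumes C: "tree_closed C" and P: "P \<in> crit_step C"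
  shows "Idl\<^bsub>R\<lparr>carrier := SP_ring R A C\<rparr>\<^esub> P \<in> Crit_ideals (R\<lparr>carrier := SP_ring R A C\<rparr>)"
proof -
  have PC: "P \<in> C" using crit_step_subset[OF C] P by auto
  then have C': "C \<subseteq> MaxA" "C \<noteq> {}" using C unfolding tree_closed_def by auto
  then have PM: "P \<in> MaxA" using PC by auto
  let ?T = "SP_ring R A C"
  let ?RT = "R\<lparr>carrier := ?T\<rparr>"
  let ?J = "Idl\<^bsub>?RT\<^esub> P"
  note Tp = SP_ring_props[OF C']
  note Ts = subringE[OF Tp(2)]
  interpret RT: domain ?RT by (rule subring_is_domain[OF Tp(2)])
  interpret DP: discrete_valuation R Kinf "loc P" "val P" rewrites "discrete_valuation.fball R Kinf (val P) = vball P"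
    using loc_valuation[OF PM] vball_fball[OF PM] by auto
  have PT: "P \<subseteq> carrier ?RT" using MaxA_props(2)[OF PM] Tp(3) by auto
  have TP: "?T \<subseteq> loc P" using Tp(1) PC by auto
  have Jid: "ideal ?J ?RT" by (rule RT.genideal_ideal[OF PT])
  have PJ: "P \<subseteq> ?J" by (rule RT.genideal_self[OF PT])
  \<comment> \<open>To reach \<open>z\<close> from \<open>P\<close>, take the generator
    \<open>x\<close> at a level containing \<open>z\<close>. The quotient \<open>z / x\<close> lies
    in \<open>?T\<close>: at members through the vertex of \<open>P\<close> by divisibility, at the
    others because \<open>x\<close> is a unit there.\<close>
  have J: "?J = vball P 1 \<inter> ?T"
  proof
    show "?J \<subseteq> vball P 1 \<inter> ?T"
      by (rule RT.genideal_minimal[OF vball_ideal[OF PM Tp(2) TP]])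
        (use mem_M_iff[OF PM] MaxA_props(2)[OF PM] Tp(3) in auto)
    show "vball P 1 \<inter> ?T \<subseteq> ?J"
    proof
      fix z assume z: "z \<in> vball P 1 \<inter> ?T"
      then have zI: "z \<in> Kinf" "z \<in> carrier R" using Tp(4) Kinf_carr by auto
      then obtain i where i: "z \<in> K i" unfolding Kinf_def by auto
      obtain x where x: "x \<in> A" "x \<in> K i" "x \<in> P" "x \<noteq> \<zero>" "\<And>z. z \<in> K i \<Longrightarrow> z \<in> vball P 1 \<Longrightarrow> z \<otimes> inv x \<in> loc P"
        "\<And>M. M \<in> MaxA \<Longrightarrow> res M i \<noteq> res P i \<Longrightarrow> x \<notin> M" using local_generator[OF PM, of i] by blast
      have xI: "x \<in> Kinf" "x \<in> carrier R" "inv x \<in> K i" "inv x \<in> Kinf" using x A_Kinf A_carr K_inv Kinf_inv by auto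
      have "z \<otimes> inv x \<in> loc M" if M: "M \<in> C" for M
      proof -
        have MM: "M \<in> MaxA" using M C' by auto
        show ?thesis
        proof (cases "res M i = res P i")
          case True
          have "z \<otimes> inv x \<in> res P i" using x(5)[OF i] z i xI(3) Ks(6) unfolding res_def by auto
          then show ?thesis using True unfolding res_def by auto
        next
          case False
          interpret D: discrete_valuation R Kinf "loc M" "val M" by (rule loc_valuation[OF MM])
          have "val M x = 0" using val_unit[OF MM x(1)] x(6)[OF MM False] by auto
          then have "inv x \<in> loc M" using D.mem_iff[OF xI(4)] D.val_inv[OF xI(1) x(4)] inv_nonzero(2)[OF xI(2) x(4)] by auto
          moreover have "z \<in> loc M" using z Tp(1) M by auto
          ultimately show ?thesis using D.W_subring(6) by auto
        qed
      qed
      then have "z \<otimes> inv x \<in> ?T" unfolding Tp(1) by auto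
      moreover have "x \<in> ?J" using PJ x(3) by auto
      ultimately have "(z \<otimes> inv x) \<otimes> x \<in> ?J" using ideal.I_l_closed[OF Jid, of x "z \<otimes> inv x"] by simp
      moreover have "(z \<otimes> inv x) \<otimes> x = z" using zI xI x(4) by (simp add: m_assoc)
      ultimately show "z \<in> ?J" by simp
    qed
  qed
  have oneJ: "\<one> \<notin> ?J" unfolding J using DP.one_notin_maximal by auto
  have max: "maximalideal ?J ?RT"
  proof (rule maximalidealI[OF Jid])
    show "carrier ?RT \<noteq> ?J" using oneJ Ts(3) by auto
    fix I assume I: "ideal I ?RT" "?J \<subseteq> I" "I \<subseteq> carrier ?RT"
    interpret I: ideal I ?RT by (rule I(1))
    show "I = ?J \<or> I = carrier ?RT"
    proof (cases "I = ?J")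
      case False
      \<comment> \<open>Multiplying \<open>y\<close> by a denominator outside \<open>P\<close> gives
        \<open>c\<close> in \<open>A\<close> outside \<open>P\<close>, which is invertible modulo
        \<open>P\<close> already in \<open>A\<close>.\<close>
      then obtain y where y: "y \<in> I" "y \<notin> ?J" using I by auto
      then have yT: "y \<in> ?T" "y \<in> loc P" "y \<notin> vball P 1" using I(3) TP J by auto
      obtain c d where cd: "c \<in> A" "d \<in> A" "d \<notin> P" "y \<otimes> d = c" using locE[OF PM yT(2)] by metis
      have yI: "y \<in> Kinf" "y \<noteq> \<zero>" using yT Tp(4) Kinfs(2) unfolding vball_def by auto
      have "c \<notin> P"
      proof
        assume "c \<in> P"
        then have "y \<otimes> d \<in> vball P 1" using mem_M_iff[OF PM cd(1)] cd(4) by auto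
        then have "d \<in> vball P 1" using DP.maximal_prime[OF yT(2), of d] yT(3) A_loc[OF PM] cd(2) by auto
        then show False using mem_M_iff[OF PM cd(2)] cd(3) by auto
      qed
      then obtain c' where c': "c' \<in> A" "\<one> \<ominus> c \<otimes> c' \<in> P" using MaxA_props(8)[OF PM cd(1)] by auto
      have "c \<in> I" using I.I_r_closed[of y d] y cd Tp(3) by auto
      then have "c \<otimes> c' \<in> I" using I.I_r_closed[of c c'] c' Tp(3) by auto
      moreover have "\<one> \<ominus> c \<otimes> c' \<in> I" using c' PJ I(2) by auto
      ultimately have "(\<one> \<ominus> c \<otimes> c') \<oplus> c \<otimes> c' \<in> I" using I.a_closed[of "\<one> \<ominus> c \<otimes> c'" "c \<otimes> c'"] by simp
      moreover have "(\<one> \<ominus> c \<otimes> c') \<oplus> c \<otimes> c' = \<one>" using cd(1) c'(1) A_carr by (simp add: minus_eq a_assoc l_neg)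
      ultimately have "\<one> \<in> I" by simp
      then show ?thesis using I.one_imp_carrier by simp
    qed auto
  qed
  have "False" if I: "I \<subseteq> ?J" "I \<noteq> {\<zero>}" "fin_gen_ideal I ?RT" "radical_ideal I ?RT" for I
  proof -
    obtain S where S: "finite S" "S \<subseteq> ?T" "I = Idl\<^bsub>?RT\<^esub> S" using I(3) unfolding fin_gen_ideal_def by auto
    have Iid: "ideal I ?RT" using I(4) unfolding radical_ideal_def by auto
    interpret I: ideal I ?RT by (rule Iid)
    have SI: "S \<subseteq> I" unfolding S(3) by (rule RT.genideal_self) (use S(2) in simp)
    obtain i0 where i0: "S \<subseteq> K i0" using Kinf_finite_subset[OF S(1)] S(2) Tp(4) by auto
    obtain i1 where i1: "unram i1 P" using unram_exists[OF PM] by auto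
    \<comment> \<open>High enough to contain the generators and for the condition on
      \<open>P\<close> to apply.\<close>
    define i where "i = max i0 i1"
    have i: "S \<subseteq> K i" "unram i P" using i0 K_mono[of i0 i] unram_mono[OF i1, of i] unfolding i_def by auto
    obtain M where M: "M \<in> C" "res M i = res P i" "\<not> unram i M" using P i(2) unfolding crit_step_def by auto
    have MM: "M \<in> MaxA" using M C' by auto
    interpret D: discrete_valuation R Kinf "loc M" "val M" by (rule loc_valuation[OF MM])
    have TM: "?T \<subseteq> loc M" using Tp(1) M(1) by auto
    have "s \<in> vball M 2" if s: "s \<in> S" for s
    proof (cases "s = \<zero>")
      case True
      then show ?thesis using Kinfs(2) unfolding vball_def by auto
    next
      case False
      have "s \<in> K i" "s \<in> vball P 1" using s i SI I(1) J by auto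
      then have "s \<in> vball M 1" using vball_1_res_cong[OF MM PM M(2)] by auto
      moreover have "val M s \<noteq> 1" using unramI[OF MM, of s i] \<open>s \<in> K i\<close> False M(3) by auto
      ultimately show ?thesis using False unfolding vball_def by auto
    qed
    then have "I \<subseteq> vball M 2 \<inter> ?T"
      unfolding S(3) by (intro RT.genideal_minimal[OF vball_ideal[OF MM Tp(2) TM]]) (use S(2) in auto)
    then have I2: "I \<subseteq> vball M 2" by auto
    have "\<zero> \<in> I" using I.zero_closed by simp
    then obtain x where x: "x \<in> I" "x \<noteq> \<zero>" using I(2) by auto
    have xI: "x \<in> Kinf" "x \<in> carrier R" using x I2 Kinf_carr unfolding vball_def by auto
    define k where "k = nat (val M x)"
    have k: "int k = val M x" "k \<ge> 2" using x I2 unfolding vball_def k_def by auto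
    obtain k' where k': "k = Suc k'" using k(2) by (cases k) auto
    \<comment> \<open>The quotient \<open>u^k / x\<close> has value 0 at \<open>M\<close>, so
      \<open>c x = u^k d\<close> with \<open>d\<close> outside \<open>M\<close>. A further factor
      \<open>d^(k-1)\<close> completes this to the \<open>k\<close>-th power of \<open>u d\<close>,
      whose value is only 1.\<close>
    obtain u where u: "u \<in> A" "u \<noteq> \<zero>" "val M u = 1" using uniformizer_A[OF MM] by auto
    have uI: "u \<in> Kinf" "u \<in> carrier R" using u A_Kinf A_carr by auto
    note uk = D.val_pow[OF uI(1) u(2), of k]
    have ux: "u [^] k \<otimes> inv x \<in> Kinf \<and> u [^] k \<otimes> inv x \<noteq> \<zero>"
      using D.F_mult_nonzero[of "u [^] k" "inv x"] uk D.F_inv[OF xI(1) x(2)] inv_nonzero(2)[OF xI(2) x(2)] by auto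
    have "u [^] k \<otimes> inv x \<in> loc M"
      using D.mem_iff[of "u [^] k \<otimes> inv x"] ux D.val_div[of "u [^] k" x] uk xI x(2) u(3) k(1) by auto
    then obtain c d where cd: "c \<in> A" "d \<in> A" "d \<notin> M" "d \<noteq> \<zero>" "u [^] k \<otimes> inv x \<otimes> d = c"
      using locE[OF MM] by metis
    have cl: "c \<in> carrier R" "d \<in> carrier R" "u [^] k \<in> carrier R" "inv x \<in> carrier R" using cd A_carr uI xI x(2) by auto
    have "c \<otimes> x = u [^] k \<otimes> d \<otimes> (inv x \<otimes> x)" unfolding cd(5)[symmetric] using cl xI by (simp add: m_ac)
    then have e: "c \<otimes> x = u [^] k \<otimes> d" using xI x(2) cl by simp
    have "c \<otimes> x \<in> I" using I.I_l_closed[of x c] x cd Tp(3) by auto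
    moreover have dk: "d [^] k' \<in> ?T" using cd(2) Tp(3) Ts(3,6) by (induction k') auto
    ultimately have "(u [^] k \<otimes> d) \<otimes> d [^] k' \<in> I" using I.I_r_closed[of "u [^] k \<otimes> d" "d [^] k'"] e by auto
    moreover have "(u [^] k \<otimes> d) \<otimes> d [^] k' = (u \<otimes> d) [^] k"
    proof -
      have "d \<otimes> d [^] k' = d [^] k" unfolding k' using cl by (simp add: m_comm)
      then show ?thesis using uI cl by (simp add: m_assoc nat_pow_distrib)
    qed
    ultimately have "(u \<otimes> d) [^]\<^bsub>?RT\<^esub> k \<in> I" using nat_pow_consistent[of "u \<otimes> d" k] by simp
    moreover have "u \<otimes> d \<in> carrier ?RT" using u cd As(6) Tp(3) by auto
    ultimately have "u \<otimes> d \<in> I" using I(4) unfolding radical_ideal_def by blast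
    moreover have dI: "d \<in> Kinf" using cd A_Kinf by auto
    have "val M (u \<otimes> d) = 1" "u \<otimes> d \<noteq> \<zero>"
      using D.val_mult[OF uI(1) u(2) dI cd(4)] D.F_mult_nonzero[OF uI(1) u(2) dI cd(4)] val_unit[OF MM cd(2,3)] u(3) by auto
    ultimately show False using I2 unfolding vball_def by auto
  qed
  then show ?thesis using max unfolding Crit_ideals_def Max_ideals_def by auto
qed

lemma SP_step_eq:
  assumes C: "tree_closed C" shows "SP_step R A C = crit_step C"
proof (cases "C = {}")
  case True
  \<comment> \<open>Every path is unramified from some level on, so the condition is never vacuous.
    This agrees with the convention for empty \<open>C\<close> in \<open>SP_step\<close>.\<close>
  have "crit_step {} = {}" unfolding crit_step_def using unram_exists by auto
  then show ?thesis using True unfolding SP_step_def by auto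
next
  case False
  have "C \<subseteq> MaxA" using C unfolding tree_closed_def by auto
  moreover have "crit_step C \<subseteq> MaxA" unfolding crit_step_def by auto
  ultimately show ?thesis
    using SP_step_imp_crit_step[OF _ False] crit_step_imp_SP_step[OF C] False
    unfolding SP_step_def MaxA_def[symmetric] by blast
qed

text \<open>Closedness is carried through the induction because the two steps are compared on closed
  sets only.\<close>

lemma crit_correspondence:
  "tree_closed (SP_crit R A \<alpha>) \<and> tree_crit T \<alpha> = res ` SP_crit R A \<alpha>"
proof (induction \<alpha> rule: less_induct)
  case (less \<alpha>)
  consider "\<And>\<beta>. \<alpha> \<le> \<beta>" | \<beta> where "succ_of \<alpha> \<beta>" | "\<exists>\<beta>. \<beta> < \<alpha>" "\<nexists>\<beta>. succ_of \<alpha> \<beta>"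
    by (meson linorder_not_le)
  then show ?case
  proof cases
    case 1
    then have "SP_crit R A \<alpha> = MaxA" "tree_crit T \<alpha> = MaxPath T"
      unfolding SP_crit_def tree_crit_def MaxA_def by (simp_all add: transfinite_zero)
    moreover have "MaxPath T = res ` MaxA" using MaxPath_E res_MaxPath by auto
    ultimately show ?thesis unfolding tree_closed_def by simp
  next
    case (2 \<beta>)
    then have IH: "tree_closed (SP_crit R A \<beta>)" "tree_crit T \<beta> = res ` SP_crit R A \<beta>"
      using less[of \<beta>] unfolding succ_of_def by auto
    have "SP_crit R A \<alpha> = crit_step (SP_crit R A \<beta>)"
      using transfinite_succ[OF 2] SP_step_eq[OF IH(1)] unfolding SP_crit_def by metis
    moreover have "tree_crit T \<alpha> = tree_step T (tree_crit T \<beta>)"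
      using transfinite_succ[OF 2] unfolding tree_crit_def by metis
    ultimately show ?thesis
      using crit_step_closed[OF IH(1)] IH tree_step_eq unfolding tree_closed_def by metis
  next
    case 3
    have S: "SP_crit R A \<alpha> = (\<Inter>\<beta>\<in>{..<\<alpha>}. SP_crit R A \<beta>)" and T: "tree_crit T \<alpha> = (\<Inter>\<beta>\<in>{..<\<alpha>}. tree_crit T \<beta>)"
      using transfinite_limit[OF 3] unfolding SP_crit_def tree_crit_def by metis+
    obtain \<beta>0 where b0: "\<beta>0 \<in> {..<\<alpha>}" using 3(1) by auto
    have IH: "tree_closed (SP_crit R A \<beta>)" "tree_crit T \<beta> = res ` SP_crit R A \<beta>" if "\<beta> \<in> {..<\<alpha>}" for \<beta>
      using less[of \<beta>] that by auto
    have sub: "SP_crit R A \<beta> \<subseteq> MaxA" if "\<beta> \<in> {..<\<alpha>}" for \<beta> using IH(1)[OF that] unfolding tree_closed_def by auto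
    have "P \<in> SP_crit R A \<alpha>" if P: "P \<in> MaxA" "\<forall>i. \<exists>M \<in> SP_crit R A \<alpha>. res M i = res P i" for P
    proof -
      have "P \<in> SP_crit R A \<beta>" if b: "\<beta> \<in> {..<\<alpha>}" for \<beta>
      proof -
        have "SP_crit R A \<alpha> \<subseteq> SP_crit R A \<beta>" unfolding S using b by auto
        then have "\<forall>i. \<exists>M \<in> SP_crit R A \<beta>. res M i = res P i" using P(2) by blast
        then show ?thesis using IH(1)[OF b] P(1) unfolding tree_closed_def by auto
      qed
      then show ?thesis unfolding S by auto
    qed
    moreover have "SP_crit R A \<alpha> \<subseteq> MaxA" unfolding S using sub[OF b0] b0 by auto
    \<comment> \<open>Image and intersection commute because \<open>res\<close> is injective on
      \<open>MaxA\<close> and there is an ordinal below \<open>\<alpha>\<close>.\<close>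
    moreover have "res ` (\<Inter>\<beta>\<in>{..<\<alpha>}. SP_crit R A \<beta>) = (\<Inter>\<beta>\<in>{..<\<alpha>}. res ` SP_crit R A \<beta>)"
      by (rule image_INT[of _ MaxA _ _ \<beta>0]) (use res_inj sub b0 in \<open>auto simp: inj_on_def\<close>)
    ultimately show ?thesis unfolding tree_closed_def T using S IH(2) by auto
  qed
qed

end

theorem corollary4p6:
  fixes L :: "('a, 'b) ring_scheme" and V A :: "'a set" and K :: "nat \<Rightarrow> 'a set"
  assumes "field L"
    and "\<And>i. subfield (K i) L"
    and "\<And>i. K i \<subset> K (Suc i)"
    and "\<And>i. ring.finite_dimension L (K i) (K (Suc i))"
    and "discrete_valuation_ring L V" and "quotient_field L V = K 0"
    and "A = integral_closure L V (\<Union>i. K i)"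
    and "almost_dedekind L A"
  shows "SP_rank L A = tree_SP_rank (ramification_tree L V K)"
proof -
  interpret ramified_tower L V A K
    by (intro ramified_tower.intro ramified_tower_axioms.intro assms)
  \<comment> \<open>Vertices are sets, so both ranks are least elements of the same type
    \<open>'a set ordinal\<close>, and it suffices that their defining predicates agree.\<close>
  have "tree_crit T \<alpha> = {} \<longleftrightarrow> SP_crit L A \<alpha> = {}" for \<alpha> :: "'a set ordinal"
    using crit_correspondence[of \<alpha>] by auto
  then show ?thesis
    unfolding SP_rank_def tree_SP_rank_def by simp
qed

end
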